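(* Suppose that $R$ is a Noetherian local ring, $M$ is a finitely generated $R$-module and $\mathcal I(1)=\{I(1)_i\},\ldots,\mathcal I(r)=\{I(r)_i\}$ are Noetherian filtrations of $R$ by $m_R$-primary ideals. Then there exist a positive integer $c$ and periodic functions $\sigma_{i_1,\ldots,i_r}:\mathbb N^r\to\mathbb Q$ such that whenever $n_1,\ldots,n_r\ge c$, we have that $$\lambda(M/I(1)_{n_1}\cdots I(r)_{n_r}M)=\sum_{i_1+\cdots+i_r\le\dim M}\sigma_{i_1,\ldots,i_r}(n_1,\ldots,n_r)\,n_1^{i_1}n_2^{i_2}\cdots n_r^{i_r}$$ is a quasi polynomial of total degree equal to $\dim M$, and the coefficients $\sigma_{i_1,\ldots,i_r}(n_1,\ldots,n_r)$ are constants whenever $i_1+\cdots+i_r=\dim M$.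
   Context: $\mathbb N$ denotes the nonnegative integers; $\lambda$ is length as an $R$-module; $m_R$ is the maximal ideal of $R$. A filtration $\mathcal I=\{I_n\}_{n\in\mathbb N}$ of ideals on $R$ is a descending chain $R=I_0\supset I_1\supset I_2\supset\cdots$ of ideals with $I_iI_j\subset I_{i+j}$ for all $i,j\in\mathbb N$. It is a filtration of the local ring $R$ by $m_R$-primary ideals if $I_j$ is $m_R$-primary for all $j\ge1$. It is Noetherian if $\bigoplus_{n\ge 0}I_n$ is a finitely generated $R$-algebra. A map $\sigma:\mathbb N^r\to\mathbb Q$ is periodic if there is a positive integer $\alpha$ such that $\sigma(n_1,\ldots,n_i+\alpha,\ldots,n_r)=\sigma(n_1,\ldots,n_i,\ldots,n_r)$ for all $(n_1,\ldots,n_r)\in\mathbb N^r$ and $1\le i\le r$. A quasi polynomial is a finite sum $\sum\sigma_{i_1,\ldots,i_r}(n_1,\ldots,n_r)n_1^{i_1}\cdots n_r^{i_r}$ with periodic $\sigma_{i_1,\ldots,i_r}$; its total degree is the largest $t$ such that there exist $i_1,\ldots,i_r\in\mathbb N$ with $i_1+\cdots+i_r=t$ and $\sigma_{i_1,\ldots,i_r}$ not identically zero (the zero quasi polynomial is given the same degree as the dimension of the zero module). *)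

theory Defs
  imports
    "HOL-Library.Extended_Real"
    "HOL-Algebra.Module"
    "HOL-Algebra.Ideal_Product"
    "HOL-Algebra.QuotRing"
    "HOL-Algebra.Ring_Divisibility"
    "HOL-Algebra.Generated_Rings"
    "HOL-Algebra.UnivPoly"
begin

section \<open>Local rings and primary ideals\<close>

definition local_ring :: "('a, 'b) ring_scheme \<Rightarrow> bool" where
  "local_ring R \<longleftrightarrow> cring R \<and> (\<exists>!m. maximalideal m R)"

definition max_ideal :: "('a, 'b) ring_scheme \<Rightarrow> 'a set" where
  "max_ideal R = (THE m. maximalideal m R)"

definition noetherian_local_ring :: "('a, 'b) ring_scheme \<Rightarrow> bool" where
  "noetherian_local_ring R \<longleftrightarrow> noetherian_ring R \<and> local_ring R"

definition radical :: "('a, 'b) ring_scheme \<Rightarrow> 'a set \<Rightarrow> 'a set" where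
  "radical R I = {a \<in> carrier R. \<exists>n::nat. a [^]\<^bsub>R\<^esub> n \<in> I}"

definition primary_ideal :: "('a, 'b) ring_scheme \<Rightarrow> 'a set \<Rightarrow> bool" where
  "primary_ideal R I \<longleftrightarrow> ideal I R \<and> I \<noteq> carrier R \<and>
     (\<forall>a\<in>carrier R. \<forall>b\<in>carrier R. a \<otimes>\<^bsub>R\<^esub> b \<in> I \<longrightarrow> a \<in> I \<or> b \<in> radical R I)"

definition primary_to :: "('a, 'b) ring_scheme \<Rightarrow> 'a set \<Rightarrow> 'a set \<Rightarrow> bool" where
  "primary_to R P I \<longleftrightarrow> primary_ideal R I \<and> radical R I = P"


section \<open>Filtrations\<close>

definition filtration :: "('a, 'b) ring_scheme \<Rightarrow> (nat \<Rightarrow> 'a set) \<Rightarrow> bool" where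
  "filtration R I \<longleftrightarrow>
     (\<forall>n. ideal (I n) R) \<and> I 0 = carrier R \<and> (\<forall>n. I (Suc n) \<subseteq> I n) \<and>
     (\<forall>i j. ideal_prod R (I i) (I j) \<subseteq> I (i + j))"

definition filtration_by_primary :: "('a, 'b) ring_scheme \<Rightarrow> (nat \<Rightarrow> 'a set) \<Rightarrow> bool" where
  "filtration_by_primary R I \<longleftrightarrow>
     filtration R I \<and> (\<forall>j\<ge>1. primary_to R (max_ideal R) (I j))"

text \<open>The graded \<open>R\<close>-algebra \<open>\<Oplus>\<^sub>n I\<^sub>n\<close>, realised as the subalgebra \<open>\<Oplus>\<^sub>n I\<^sub>n t\<^sup>n\<close> of \<open>R[t]\<close>.\<close>

definition rees_carrier :: "('a, 'b) ring_scheme \<Rightarrow> (nat \<Rightarrow> 'a set) \<Rightarrow> (nat \<Rightarrow> 'a) set" where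
  "rees_carrier R I = {p \<in> carrier (UP R). \<forall>n. coeff (UP R) p n \<in> I n}"

text \<open>The \<open>R\<close>-subalgebra of \<open>R[t]\<close> generated by a set \<open>S\<close> is the subring generated by \<open>S\<close>
  together with the constant polynomials.\<close>

definition noetherian_filtration :: "('a, 'b) ring_scheme \<Rightarrow> (nat \<Rightarrow> 'a set) \<Rightarrow> bool" where
  "noetherian_filtration R I \<longleftrightarrow> filtration R I \<and>
     (\<exists>S. finite S \<and> S \<subseteq> rees_carrier R I \<and>
        rees_carrier R I = generate_ring (UP R) ((\<lambda>a. monom (UP R) a 0) ` carrier R \<union> S))"


section \<open>Modules\<close>

definition submodule_span ::
  "('a, 'c) ring_scheme \<Rightarrow> ('a, 'b, 'd) module_scheme \<Rightarrow> 'b set \<Rightarrow> 'b set" where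
  "submodule_span R M S = \<Inter>{N. submodule N R M \<and> S \<subseteq> N}"

definition finitely_generated_module ::
  "('a, 'c) ring_scheme \<Rightarrow> ('a, 'b, 'd) module_scheme \<Rightarrow> bool" where
  "finitely_generated_module R M \<longleftrightarrow> Module.module R M \<and>
     (\<exists>S. finite S \<and> S \<subseteq> carrier M \<and> submodule_span R M S = carrier M)"

definition ideal_smult ::
  "('a, 'c) ring_scheme \<Rightarrow> 'a set \<Rightarrow> ('a, 'b, 'd) module_scheme \<Rightarrow> 'b set" where
  "ideal_smult R I M = submodule_span R M {a \<odot>\<^bsub>M\<^esub> x |a x. a \<in> I \<and> x \<in> carrier M}"

text \<open>A module record also has the multiplicative fields of a ring record; they play no role in
  \<^const>\<open>Module.module\<close> and are left unspecified here.\<close>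

definition quotient_module ::
  "('a, 'b, 'd) module_scheme \<Rightarrow> 'b set \<Rightarrow> ('a, 'b set) module" where
  "quotient_module M N =
     \<lparr>carrier = a_rcosets\<^bsub>M\<^esub> N, monoid.mult = undefined, one = undefined, zero = N, add = set_add M,
      smult = (\<lambda>a A. \<Union>x\<in>A. N +>\<^bsub>M\<^esub> (a \<odot>\<^bsub>M\<^esub> x))\<rparr>"

definition module_length ::
  "('a, 'c) ring_scheme \<Rightarrow> ('a, 'b, 'd) module_scheme \<Rightarrow> enat" where
  "module_length R M =
     Sup {enat n |n. \<exists>N :: nat \<Rightarrow> 'b set.
            (\<forall>i\<le>n. submodule (N i) R M) \<and> (\<forall>i<n. N i \<subset> N (Suc i))}"

definition annihilator ::
  "('a, 'c) ring_scheme \<Rightarrow> ('a, 'b, 'd) module_scheme \<Rightarrow> 'a set" where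
  "annihilator R M = {a \<in> carrier R. \<forall>x\<in>carrier M. a \<odot>\<^bsub>M\<^esub> x = \<zero>\<^bsub>M\<^esub>}"

text \<open>Dimensions take values in \<^typ>\<open>ereal\<close>, where \<^term>\<open>Sup {}\<close> is \<open>-\<infinity>\<close>: the zero ring, and
  hence the zero module, has dimension \<open>-\<infinity>\<close>.\<close>

definition krull_dim :: "('a, 'b) ring_scheme \<Rightarrow> ereal" where
  "krull_dim R =
     Sup {ereal (real n) |n. \<exists>P :: nat \<Rightarrow> 'a set.
            (\<forall>i\<le>n. primeideal (P i) R) \<and> (\<forall>i<n. P i \<subset> P (Suc i))}"

definition module_dim ::
  "('a, 'c) ring_scheme \<Rightarrow> ('a, 'b, 'd) module_scheme \<Rightarrow> ereal" where
  "module_dim R M = krull_dim (R Quot annihilator R M)"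


section \<open>Quasi polynomials\<close>

text \<open>Elements of \<open>\<nat>\<^sup>r\<close> are functions on a finite index type with \<open>r\<close> elements (so \<open>r \<ge> 1\<close>).\<close>

definition periodic :: "(('r::finite \<Rightarrow> nat) \<Rightarrow> rat) \<Rightarrow> bool" where
  "periodic s \<longleftrightarrow> (\<exists>\<alpha>>0. \<forall>n j. s (n(j := n j + \<alpha>)) = s n)"

definition multi_degree :: "('r::finite \<Rightarrow> nat) \<Rightarrow> nat" where
  "multi_degree i = (\<Sum>j\<in>UNIV. i j)"

definition monomial_value :: "('r::finite \<Rightarrow> nat) \<Rightarrow> ('r \<Rightarrow> nat) \<Rightarrow> rat" where
  "monomial_value i n = (\<Prod>j\<in>UNIV. of_nat (n j) ^ i j)"

text \<open>A quasi polynomial is given by its family of coefficient functions; \<open>\<sigma> i\<close> is the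
  coefficient of the monomial with exponent vector \<open>i\<close>.\<close>

definition quasi_polynomial ::
  "(('r::finite \<Rightarrow> nat) \<Rightarrow> ('r \<Rightarrow> nat) \<Rightarrow> rat) \<Rightarrow> bool" where
  "quasi_polynomial \<sigma> \<longleftrightarrow> (\<forall>i. periodic (\<sigma> i)) \<and> finite {i. \<exists>n. \<sigma> i n \<noteq> 0}"

text \<open>The zero quasi polynomial gets the degree \<open>-\<infinity>\<close>, like the dimension of the zero module.\<close>

definition total_degree ::
  "(('r::finite \<Rightarrow> nat) \<Rightarrow> ('r \<Rightarrow> nat) \<Rightarrow> rat) \<Rightarrow> ereal" where
  "total_degree \<sigma> = Sup {ereal (real (multi_degree i)) |i. \<exists>n. \<sigma> i n \<noteq> 0}"

end

(* Everything takes place in lattices of submodules: an interval [B, A] plays the role of the module A/B,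
   and its length is the supremum of the lengths of its chains.

   Quasi polynomials. A multigraded module is a family of intervals [B_n, A_n] with homogeneous operators,
   and it is Noetherian if its graded submodules satisfy the ascending chain condition. The kernel and the
   cokernel of an operator are again families of intervals and are Noetherian without that operator, so
   induction on the number of operators shows that the differences of n |-> length(A_n/B_n) in all
   directions, hence the function itself, are eventually quasi polynomial. Applied to
   J_n M / J_(n + e_j) M, with J_n the product of the filtrations, this gives the quasi polynomial for
   length(M/J_n M). The function is monotone in n, so the leading forms on the different residue classes
   bound each other asymptotically and coincide: the top coefficients are constant.

   Degree. The degree is the growth rate along the diagonal, and there J_n is comparable with powers of the
   maximal ideal m. By the Artin-Rees lemma the growth of N |-> length(A/(B + m^N A)) is the maximum of the
   growths over the factors R/p of a prime filtration of A/B. For R/p, comparing with R/(p + xR), x not in p,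
   lowers the growth by one; Noetherian induction on p identifies it with the maximal length of chains of
   primes above p. *)

theory Submission
  imports Defs
begin

section \<open>Lengths of intervals in a family of sets\<close>

text \<open>Intervals are used because a quotient \<open>A/B\<close> has cosets as elements: an
  induction that passes to kernels, cokernels and prime factors would leave the type of
  \<open>M\<close> at every step, while intervals stay inside one lattice. Counting operators does
  not give the degree, and Hilbert-Samuel functions are not additive: the filtration that a
  submodule \<open>C\<close> inherits from \<open>A\<close> differs from the powers of
  \<open>m\<close> on \<open>C\<close>. Artin-Rees bounds the difference by a shift of
  \<open>N\<close>, and \<open>growth\<close> survives shifts and dilations, so on the level of
  growth exact sequences behave as if lengths were additive. The drop by exactly one rests on
  \<open>R/p\<close> occurring inside itself: for \<open>x\<close> outside \<open>p\<close>,
  multiplication by \<open>x\<close> identifies \<open>R/p\<close> with \<open>(p + xR)/p\<close>.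
  If \<open>h\<close> and \<open>h'\<close> are the functions of \<open>R/p\<close> and
  \<open>R/(p + xR)\<close>, then \<open>h'(N) + h(N-k) \<le> h(N)\<close> for large
  \<open>N\<close>, so \<open>h'\<close> is bounded by a difference of a quasi polynomial. If
  \<open>x\<close> also lies in \<open>m\<close>, then \<open>h(N) \<le> h'(N) + h(N-1)\<close>, so
  summation raises the growth by at most one. No system of parameters is chosen.\<close>

definition chain_in :: "'b set set \<Rightarrow> 'b set \<Rightarrow> 'b set \<Rightarrow> nat \<Rightarrow> bool" where
  "chain_in L B A n \<longleftrightarrow>
     (\<exists>N. (\<forall>i\<le>n. N i \<in> L \<and> B \<subseteq> N i \<and> N i \<subseteq> A) \<and> (\<forall>i<n. N i \<subset> N (Suc i)))"

definition len :: "'b set set \<Rightarrow> 'b set \<Rightarrow> 'b set \<Rightarrow> enat" where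
  "len L B A = Sup {enat n |n. chain_in L B A n}"

lemma chain_inI:
  assumes "\<And>i. i \<le> n \<Longrightarrow> N i \<in> L \<and> B \<subseteq> N i \<and> N i \<subseteq> A" and "\<And>i. i < n \<Longrightarrow> N i \<subset> N (Suc i)"
  shows "chain_in L B A n"
  using assms unfolding chain_in_def by blast

lemma chain_in_0: "A \<in> L \<Longrightarrow> B \<subseteq> A \<Longrightarrow> chain_in L B A 0"
  by (rule chain_inI[where N = "\<lambda>_. A"]) auto

lemma chain_in_le:
  assumes "chain_in L B A n" "m \<le> n" shows "chain_in L B A m"
proof -
  obtain N where "\<forall>i\<le>n. N i \<in> L \<and> B \<subseteq> N i \<and> N i \<subseteq> A" "\<forall>i<n. N i \<subset> N (Suc i)"
    using assms(1) unfolding chain_in_def by blast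
  then show ?thesis using assms(2) by (intro chain_inI[where N = N]) auto
qed

lemma chain_in_extend:
  assumes "chain_in L B X n" "X \<subset> Y" "Y \<in> L" "B \<subseteq> X" shows "chain_in L B Y (Suc n)"
proof -
  obtain N where N: "\<forall>i\<le>n. N i \<in> L \<and> B \<subseteq> N i \<and> N i \<subseteq> X" "\<forall>i<n. N i \<subset> N (Suc i)"
    using assms(1) unfolding chain_in_def by blast
  show ?thesis
  proof (rule chain_inI[where N = "\<lambda>i. if i \<le> n then N i else Y"])
    fix i assume "i < Suc n"
    then consider "i < n" | "i = n" by linarith
    then show "(if i \<le> n then N i else Y) \<subset> (if Suc i \<le> n then N (Suc i) else Y)"
    proof cases
      case 2
      then show ?thesis using N(1) assms(2) by auto
    qed (use N in auto)
  qed (use N assms in \<open>auto split: if_splits; blast\<close>)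
qed

lemma chain_in_append:
  assumes "chain_in L B C p" "chain_in L C A q" "B \<subseteq> C" "C \<subseteq> A"
  shows "chain_in L B A (p + q)"
proof -
  obtain N where N: "\<forall>i\<le>p. N i \<in> L \<and> B \<subseteq> N i \<and> N i \<subseteq> C" "\<forall>i<p. N i \<subset> N (Suc i)"
    using assms(1) unfolding chain_in_def by blast
  obtain N' where N': "\<forall>i\<le>q. N' i \<in> L \<and> C \<subseteq> N' i \<and> N' i \<subseteq> A" "\<forall>i<q. N' i \<subset> N' (Suc i)"
    using assms(2) unfolding chain_in_def by blast
  show ?thesis
  proof (rule chain_inI[where N = "\<lambda>i. if i \<le> p then N i else N' (i - p)"])
    fix i assume i: "i \<le> p + q"
    show "(if i \<le> p then N i else N' (i - p)) \<in> L \<and>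
         B \<subseteq> (if i \<le> p then N i else N' (i - p)) \<and> (if i \<le> p then N i else N' (i - p)) \<subseteq> A"
    proof (cases "i \<le> p")
      case True
      then show ?thesis using N assms(4) by (auto; blast)
    next
      case False
      then have "i - p \<le> q" using i by linarith
      then show ?thesis using False N' assms(3) by (auto; blast)
    qed
  next
    fix i assume i: "i < p + q"
    consider "i < p" | "i = p" | "i > p" by linarith
    then show "(if i \<le> p then N i else N' (i - p)) \<subset> (if Suc i \<le> p then N (Suc i) else N' (Suc i - p))"
    proof cases
      case 2
      then have "N p \<subseteq> C" "C \<subseteq> N' 0" "N' 0 \<subset> N' (Suc 0)" using N N' i by auto
      then show ?thesis using 2 by auto
    next
      case 3
      then have "Suc i - p = Suc (i - p)" "i - p < q" using i by auto
      then show ?thesis using 3 N' by auto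
    qed (use N in auto)
  qed
qed

text \<open>Chains can be shortened, so a supremum that is at least \<open>n\<close> is witnessed by
  a chain with exactly \<open>n\<close> steps. This reduces statements on lengths to statements on
  chains, whether or not the length is finite.\<close>

lemma le_len_iff:
  assumes "A \<in> L" "B \<subseteq> A" shows "enat n \<le> len L B A \<longleftrightarrow> chain_in L B A n"
proof
  assume *: "enat n \<le> len L B A"
  show "chain_in L B A n"
  proof (cases n)
    case 0 then show ?thesis using chain_in_0 assms by metis
  next
    case (Suc k)
    then have "enat k < len L B A" using * by (metis Suc_ile_eq)
    then obtain m where "k < m" "chain_in L B A m"
      unfolding len_def less_Sup_iff by auto
    then show ?thesis using chain_in_le Suc by (metis Suc_leI)
  qed
qed (auto simp: len_def intro: Sup_upper)

lemma len_le_iff: "len L B A \<le> x \<longleftrightarrow> (\<forall>n. chain_in L B A n \<longrightarrow> enat n \<le> x)"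
  unfolding len_def Sup_le_iff by auto

text \<open>The device for comparing lengths of different intervals: an isomorphism theorem enters
  only as a pair of strictly monotone maps, which need not be shown to be inverse to each
  other.\<close>

lemma len_strict_map:
  assumes "\<And>N. N \<in> L \<Longrightarrow> B \<subseteq> N \<Longrightarrow> N \<subseteq> A \<Longrightarrow> \<phi> N \<in> L' \<and> B' \<subseteq> \<phi> N \<and> \<phi> N \<subseteq> A'"
    and "\<And>N N'. N \<in> L \<Longrightarrow> N' \<in> L \<Longrightarrow> B \<subseteq> N \<Longrightarrow> N \<subset> N' \<Longrightarrow> N' \<subseteq> A \<Longrightarrow> \<phi> N \<subset> \<phi> N'"
  shows "len L B A \<le> len L' B' A'"
proof -
  have "chain_in L' B' A' n" if chn: "chain_in L B A n" for n
  proof -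
    obtain N where N: "\<forall>i\<le>n. N i \<in> L \<and> B \<subseteq> N i \<and> N i \<subseteq> A" "\<forall>i<n. N i \<subset> N (Suc i)"
      using chn unfolding chain_in_def by blast
    show ?thesis
    proof (rule chain_inI[where N = "\<lambda>i. \<phi> (N i)"])
      show "\<phi> (N i) \<in> L' \<and> B' \<subseteq> \<phi> (N i) \<and> \<phi> (N i) \<subseteq> A'" if "i \<le> n" for i
        using N(1) that by (intro assms(1)) blast+
      show "\<phi> (N i) \<subset> \<phi> (N (Suc i))" if "i < n" for i
        using N that by (intro assms(2)) auto
    qed
  qed
  then show ?thesis unfolding len_def by (intro Sup_mono) blast
qed

lemma len_mono: "B' \<subseteq> B \<Longrightarrow> A \<subseteq> A' \<Longrightarrow> len L B A \<le> len L B' A'"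
  by (rule len_strict_map[where \<phi> = "\<lambda>N. N"]) auto

lemma len_pos: "A \<in> L \<Longrightarrow> B \<in> L \<Longrightarrow> B \<subset> A \<Longrightarrow> 1 \<le> len L B A"
  using chain_in_extend[OF chain_in_0[of B L B], of A] by (simp add: le_len_iff[symmetric] one_enat_def)

lemma len_self: "len L A A = 0"
proof -
  have "n = 0" if chn: "chain_in L A A n" for n
  proof (rule ccontr)
    obtain N where N: "\<forall>i\<le>n. N i \<in> L \<and> A \<subseteq> N i \<and> N i \<subseteq> A" "\<forall>i<n. N i \<subset> N (Suc i)"
      using chn unfolding chain_in_def by blast
    assume "n \<noteq> 0"
    then have "N 0 \<subset> N 1" using N(2) by simp
    moreover have "N i = A" if "i \<le> n" for i using N(1) that by blast
    ultimately show False using \<open>n \<noteq> 0\<close> by auto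
  qed
  then have "len L A A \<le> 0" unfolding len_le_iff by (auto simp: zero_enat_def)
  then show ?thesis by simp
qed

lemma len_simple_le:
  assumes "\<And>N. N \<in> L \<Longrightarrow> B \<subseteq> N \<Longrightarrow> N \<subseteq> A \<Longrightarrow> N = B \<or> N = A"
  shows "len L B A \<le> 1"
proof -
  have "n \<le> 1" if chn: "chain_in L B A n" for n
  proof (rule ccontr)
    obtain N where N: "\<forall>i\<le>n. N i \<in> L \<and> B \<subseteq> N i \<and> N i \<subseteq> A" "\<forall>i<n. N i \<subset> N (Suc i)"
      using chn unfolding chain_in_def by blast
    assume "\<not> n \<le> 1"
    then have "N 0 \<subset> N 1" "N 1 \<subset> N (Suc 1)" using N(2) by auto
    moreover have "\<forall>i\<in>{0,1,Suc 1}. N i = B \<or> N i = A" using N(1) \<open>\<not> n \<le> 1\<close> assms by auto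
    ultimately show False by auto
  qed
  then show ?thesis unfolding len_le_iff by (auto simp: one_enat_def)
qed

section \<open>Additivity of length in a modular lattice\<close>

locale modular_family =
  fixes L :: "'b set set" and j :: "'b set \<Rightarrow> 'b set \<Rightarrow> 'b set"
  assumes inter: "A \<in> L \<Longrightarrow> B \<in> L \<Longrightarrow> A \<inter> B \<in> L"
    and join: "A \<in> L \<Longrightarrow> B \<in> L \<Longrightarrow> j A B \<in> L"
    and join_ub: "A \<in> L \<Longrightarrow> B \<in> L \<Longrightarrow> A \<subseteq> j A B \<and> B \<subseteq> j A B"
    and join_least: "A \<in> L \<Longrightarrow> B \<in> L \<Longrightarrow> C \<in> L \<Longrightarrow> A \<subseteq> C \<Longrightarrow> B \<subseteq> C \<Longrightarrow> j A B \<subseteq> C"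
    and modular: "A \<in> L \<Longrightarrow> B \<in> L \<Longrightarrow> C \<in> L \<Longrightarrow> A \<subseteq> B \<Longrightarrow> j A C \<inter> B \<subseteq> j A (C \<inter> B)"
begin

text \<open>Comparable elements are told apart by their meets and joins with \<open>C\<close>:
  \<open>B\<close> lies in \<open>j A C \<inter> B\<close>, which modularity pushes into the join of
  \<open>A\<close> with \<open>C \<inter> B\<close>, and that is contained in
  \<open>A\<close>.\<close>

lemma cancel:
  assumes "A \<in> L" "B \<in> L" "C \<in> L" "A \<subseteq> B" "B \<inter> C \<subseteq> A \<inter> C" "j B C \<subseteq> j A C"
  shows "A = B"
proof -
  have "B \<subseteq> j A C \<inter> B" using join_ub[OF assms(2,3)] assms(6) by auto
  also have "\<dots> \<subseteq> j A (C \<inter> B)" using modular assms by auto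
  also have "\<dots> \<subseteq> A" using assms by (intro join_least inter) auto
  finally show ?thesis using assms by auto
qed

lemma join_mono: "A \<in> L \<Longrightarrow> B \<in> L \<Longrightarrow> C \<in> L \<Longrightarrow> A \<subseteq> B \<Longrightarrow> j A C \<subseteq> j B C"
  using join_ub[of B C] by (intro join_least join) auto

text \<open>By \<open>cancel\<close>, a strict step stays strict after intersecting with
  \<open>C\<close> or after joining with \<open>C\<close>, so each step of the given chain lengthens
  one of two chains. This gives additivity without composition series, hence also for infinite
  lengths.\<close>

lemma chain_split:
  assumes "C \<in> L" "B \<in> L" "B \<subseteq> C"
  shows "(\<forall>i\<le>n. N i \<in> L \<and> B \<subseteq> N i) \<Longrightarrow> (\<forall>i<n. N i \<subset> N (Suc i)) \<Longrightarrow>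
    \<exists>p q. chain_in L B (N n \<inter> C) p \<and> chain_in L C (j (N n) C) q \<and> n \<le> p + q"
proof (induction n)
  case 0
  then have "chain_in L B (N 0 \<inter> C) 0" "chain_in L C (j (N 0) C) 0"
    using assms join_ub[of "N 0" C] by (auto intro!: chain_in_0 inter join)
  then show ?case by fastforce
next
  case (Suc n)
  then obtain p q where pq: "chain_in L B (N n \<inter> C) p" "chain_in L C (j (N n) C) q" "n \<le> p + q"
    by (metis le_SucI less_SucI)
  have N: "N n \<in> L" "N (Suc n) \<in> L" "N n \<subset> N (Suc n)" "B \<subseteq> N n" using Suc.prems by auto
  have le: "N n \<inter> C \<subseteq> N (Suc n) \<inter> C" "j (N n) C \<subseteq> j (N (Suc n)) C"
    using N assms join_mono by auto
  consider "N n \<inter> C \<subset> N (Suc n) \<inter> C" | "j (N n) C \<subset> j (N (Suc n)) C"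
    using cancel[OF N(1,2) assms(1)] N le by blast
  then show ?case
  proof cases
    case 1
    have "chain_in L B (N (Suc n) \<inter> C) (Suc p)"
      by (rule chain_in_extend[OF pq(1) 1]) (use N assms inter in auto)
    moreover have "chain_in L C (j (N (Suc n)) C) q"
      using pq(2) le unfolding chain_in_def by (meson order_trans)
    ultimately show ?thesis using pq(3) by (intro exI[of _ "Suc p"] exI[of _ q]) auto
  next
    case 2
    have "chain_in L C (j (N (Suc n)) C) (Suc q)"
      by (rule chain_in_extend[OF pq(2) 2]) (use N assms join join_ub in auto)
    moreover have "chain_in L B (N (Suc n) \<inter> C) p"
      using pq(1) le unfolding chain_in_def by (meson order_trans)
    ultimately show ?thesis using pq(3) by (intro exI[of _ p] exI[of _ "Suc q"]) auto
  qed
qed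

lemma len_add:
  assumes "A \<in> L" "B \<in> L" "C \<in> L" "B \<subseteq> C" "C \<subseteq> A"
  shows "len L B A = len L B C + len L C A"
proof (rule antisym)
  show "len L B A \<le> len L B C + len L C A"
    unfolding len_le_iff
  proof (intro allI impI)
    fix n assume "chain_in L B A n"
    then obtain N where N: "\<forall>i\<le>n. N i \<in> L \<and> B \<subseteq> N i \<and> N i \<subseteq> A" "\<forall>i<n. N i \<subset> N (Suc i)"
      unfolding chain_in_def by blast
    then obtain p q where pq: "chain_in L B (N n \<inter> C) p" "chain_in L C (j (N n) C) q" "n \<le> p + q"
      using chain_split[of C B n N] assms by auto
    have "N n \<in> L" "N n \<subseteq> A" using N by auto
    then have "j (N n) C \<subseteq> A" using assms by (intro join_least) auto
    then have "len L B (N n \<inter> C) \<le> len L B C" "len L C (j (N n) C) \<le> len L C A"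
      by (auto intro!: len_mono)
    moreover have "enat p \<le> len L B (N n \<inter> C)" "enat q \<le> len L C (j (N n) C)"
      using pq(1,2) by (auto simp: len_def intro: Sup_upper)
    ultimately have "enat p + enat q \<le> len L B C + len L C A" by (meson add_mono order_trans)
    then show "enat n \<le> len L B C + len L C A" using pq(3) by (metis enat_ord_simps(1) order_trans plus_enat_simps(1))
  qed
  show "len L B C + len L C A \<le> len L B A"
  proof (cases "len L B C = \<infinity> \<or> len L C A = \<infinity>")
    case True
    moreover have "len L B C \<le> len L B A" "len L C A \<le> len L B A" using assms by (auto intro!: len_mono)
    ultimately show ?thesis by auto
  next
    case False
    then obtain p q where pq: "len L B C = enat p" "len L C A = enat q" by auto
    then have "chain_in L B C p" "chain_in L C A q"
      using assms by (auto simp: le_len_iff[symmetric])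
    then have "chain_in L B A (p + q)" using chain_in_append assms by metis
    then show ?thesis using pq assms by (simp add: le_len_iff[symmetric])
  qed
qed

text \<open>The second isomorphism theorem on the level of lengths: intersecting with
  \<open>A\<close> and joining with \<open>B\<close> are strictly monotone between the two
  intervals, again by \<open>cancel\<close>.\<close>

lemma len_inter_join:
  assumes "A \<in> L" "B \<in> L"
  shows "len L B (j A B) = len L (A \<inter> B) A"
proof (rule antisym)
  note ub = join_ub[OF assms] and J = join[OF assms]
  show "len L B (j A B) \<le> len L (A \<inter> B) A"
  proof (rule len_strict_map[where \<phi> = "\<lambda>N. N \<inter> A"])
    fix N N' assume N: "N \<in> L" "N' \<in> L" "B \<subseteq> N" "N \<subset> N'" "N' \<subseteq> j A B"
    have "N' \<inter> A \<subseteq> N \<inter> A \<Longrightarrow> N = N'"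
    proof (rule cancel[OF N(1,2) assms(1)])
      assume "N' \<inter> A \<subseteq> N \<inter> A"
      have "j N' A \<subseteq> j A B" using N assms J ub by (intro join_least) auto
      also have "\<dots> \<subseteq> j N A" using N assms join_ub[of N A] by (intro join_least join) auto
      finally show "j N' A \<subseteq> j N A" .
    qed (use N in auto)
    then show "N \<inter> A \<subset> N' \<inter> A" using N by blast
  qed (use assms inter in auto)
  show "len L (A \<inter> B) A \<le> len L B (j A B)"
  proof (rule len_strict_map[where \<phi> = "\<lambda>N. j N B"])
    fix N assume N: "N \<in> L" "A \<inter> B \<subseteq> N" "N \<subseteq> A"
    then show "j N B \<in> L \<and> B \<subseteq> j N B \<and> j N B \<subseteq> j A B"
      using join join_ub join_mono assms by auto
  next
    fix N N' assume N: "N \<in> L" "N' \<in> L" "A \<inter> B \<subseteq> N" "N \<subset> N'" "N' \<subseteq> A"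
    have "j N' B \<subseteq> j N B \<Longrightarrow> N = N'"
      by (rule cancel[OF N(1,2) assms(2)]) (use N in auto)
    then show "j N B \<subset> j N' B" using N join_mono[OF N(1,2) assms(2)] by blast
  qed
qed

end

section \<open>The lattice of submodules\<close>

definition submods :: "('a, 'c) ring_scheme \<Rightarrow> ('a, 'b, 'd) module_scheme \<Rightarrow> 'b set set" where
  "submods R M = {N. submodule N R M}"

definition sub_sum :: "('a, 'b, 'd) module_scheme \<Rightarrow> 'b set \<Rightarrow> 'b set \<Rightarrow> 'b set" where
  "sub_sum M A B = {x \<oplus>\<^bsub>M\<^esub> y |x y. x \<in> A \<and> y \<in> B}"

definition cyc :: "('a, 'c) ring_scheme \<Rightarrow> ('a, 'b, 'd) module_scheme \<Rightarrow> 'b \<Rightarrow> 'b set" where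
  "cyc R M v = {a \<odot>\<^bsub>M\<^esub> v |a. a \<in> carrier R}"

definition ideal_mult ::
  "('a, 'c) ring_scheme \<Rightarrow> ('a, 'b, 'd) module_scheme \<Rightarrow> 'a set \<Rightarrow> 'b set \<Rightarrow> 'b set" where
  "ideal_mult R M J A = submodule_span R M {a \<odot>\<^bsub>M\<^esub> x |a x. a \<in> J \<and> x \<in> A}"

text \<open>The annihilator of \<open>A/B\<close> when \<open>B \<subseteq> A\<close>. With
  \<open>A = {v}\<close> it is the annihilator of the class of \<open>v\<close>, so that
  \<open>(B + Rv)/B\<close> is \<open>R\<close> modulo this ideal.\<close>

definition colon ::
  "('a, 'c) ring_scheme \<Rightarrow> ('a, 'b, 'd) module_scheme \<Rightarrow> 'b set \<Rightarrow> 'b set \<Rightarrow> 'a set" where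
  "colon R M B A = {a \<in> carrier R. \<forall>x\<in>A. a \<odot>\<^bsub>M\<^esub> x \<in> B}"

text \<open>Turns ideals into submodules, so that the results on intervals cover ideals; the
  interval from \<open>P\<close> to \<open>carrier R\<close> stands for \<open>R/P\<close>.\<close>

definition self_module :: "('a, 'c) ring_scheme \<Rightarrow> ('a, 'a) module" where
  "self_module R = \<lparr>carrier = carrier R, monoid.mult = monoid.mult R, one = one R, zero = zero R,
     add = add R, smult = monoid.mult R\<rparr>"

lemma self_module_simps [simp]:
  "carrier (self_module R) = carrier R" "zero (self_module R) = zero R"
  "add (self_module R) = add R" "smult (self_module R) = monoid.mult R"
  by (simp_all add: self_module_def)

lemma ideal_prod_least:
  assumes "\<And>x y. x \<in> K \<Longrightarrow> y \<in> K \<Longrightarrow> x \<oplus>\<^bsub>R\<^esub> y \<in> K" "\<And>a b. a \<in> I \<Longrightarrow> b \<in> J \<Longrightarrow> a \<otimes>\<^bsub>R\<^esub> b \<in> K"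
  shows "ideal_prod R I J \<subseteq> K"
proof
  fix s assume "s \<in> ideal_prod R I J"
  then show "s \<in> K" by induction (use assms in auto)
qed

context module
begin

lemma submodsD:
  assumes "N \<in> submods R M"
  shows "x \<in> N \<Longrightarrow> x \<in> carrier M" "\<zero>\<^bsub>M\<^esub> \<in> N" "x \<in> N \<Longrightarrow> y \<in> N \<Longrightarrow> x \<oplus>\<^bsub>M\<^esub> y \<in> N"
    "a \<in> carrier R \<Longrightarrow> x \<in> N \<Longrightarrow> a \<odot>\<^bsub>M\<^esub> x \<in> N" "x \<in> N \<Longrightarrow> \<ominus>\<^bsub>M\<^esub> x \<in> N"
    "x \<in> N \<Longrightarrow> y \<in> N \<Longrightarrow> x \<ominus>\<^bsub>M\<^esub> y \<in> N"
proof -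
  have N: "submodule N R M" using assms by (simp add: submods_def)
  note E = submoduleE[OF N]
  show "x \<in> N \<Longrightarrow> x \<in> carrier M" for x using E(1) by auto
  show "\<zero>\<^bsub>M\<^esub> \<in> N" using subgroup.one_closed[OF submodule.axioms(1)[OF N]] by simp
  show "x \<in> N \<Longrightarrow> y \<in> N \<Longrightarrow> x \<oplus>\<^bsub>M\<^esub> y \<in> N" "a \<in> carrier R \<Longrightarrow> x \<in> N \<Longrightarrow> a \<odot>\<^bsub>M\<^esub> x \<in> N"
    "x \<in> N \<Longrightarrow> \<ominus>\<^bsub>M\<^esub> x \<in> N" "x \<in> N \<Longrightarrow> y \<in> N \<Longrightarrow> x \<ominus>\<^bsub>M\<^esub> y \<in> N"
    using E by (auto simp: M.minus_eq)
qed

lemma submods_subset: "N \<in> submods R M \<Longrightarrow> N \<subseteq> carrier M"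
  using submodsD(1) by blast

lemma submodsI:
  assumes "N \<subseteq> carrier M" "\<zero>\<^bsub>M\<^esub> \<in> N" "\<And>x y. x \<in> N \<Longrightarrow> y \<in> N \<Longrightarrow> x \<oplus>\<^bsub>M\<^esub> y \<in> N"
    "\<And>a x. a \<in> carrier R \<Longrightarrow> x \<in> N \<Longrightarrow> a \<odot>\<^bsub>M\<^esub> x \<in> N"
  shows "N \<in> submods R M"
proof -
  have "\<ominus>\<^bsub>M\<^esub> x \<in> N" if "x \<in> N" for x
  proof -
    have "(\<ominus> \<one>) \<odot>\<^bsub>M\<^esub> x = \<ominus>\<^bsub>M\<^esub> x" using that assms(1) by (subst smult_l_minus) auto
    then show ?thesis using assms(4)[of "\<ominus> \<one>" x] that by auto
  qed
  then show ?thesis unfolding submods_def using assms by (auto intro!: submoduleI)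
qed

lemma carrier_submods: "carrier M \<in> submods R M"
  by (rule submodsI) auto

lemma zero_submods: "{\<zero>\<^bsub>M\<^esub>} \<in> submods R M"
  by (rule submodsI) auto

lemma submods_inter: "A \<in> submods R M \<Longrightarrow> B \<in> submods R M \<Longrightarrow> A \<inter> B \<in> submods R M"
  by (rule submodsI) (auto dest: submodsD)

lemma smult_diff:
  "a \<in> carrier R \<Longrightarrow> x \<in> carrier M \<Longrightarrow> y \<in> carrier M \<Longrightarrow> a \<odot>\<^bsub>M\<^esub> (x \<ominus>\<^bsub>M\<^esub> y) = a \<odot>\<^bsub>M\<^esub> x \<ominus>\<^bsub>M\<^esub> a \<odot>\<^bsub>M\<^esub> y"
  by (simp add: M.minus_eq smult_r_distr smult_r_minus)

lemma add_diff_cancel [simp]: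
  "x \<in> carrier M \<Longrightarrow> y \<in> carrier M \<Longrightarrow> (x \<oplus>\<^bsub>M\<^esub> y) \<ominus>\<^bsub>M\<^esub> y = x"
  "x \<in> carrier M \<Longrightarrow> y \<in> carrier M \<Longrightarrow> (x \<oplus>\<^bsub>M\<^esub> y) \<ominus>\<^bsub>M\<^esub> x = y"
  "x \<in> carrier M \<Longrightarrow> y \<in> carrier M \<Longrightarrow> (x \<ominus>\<^bsub>M\<^esub> y) \<oplus>\<^bsub>M\<^esub> y = x"
proof -
  show *: "x \<in> carrier M \<Longrightarrow> y \<in> carrier M \<Longrightarrow> (x \<oplus>\<^bsub>M\<^esub> y) \<ominus>\<^bsub>M\<^esub> y = x" for x y
    by (simp add: M.minus_eq M.a_assoc M.r_neg)
  show "x \<in> carrier M \<Longrightarrow> y \<in> carrier M \<Longrightarrow> (x \<oplus>\<^bsub>M\<^esub> y) \<ominus>\<^bsub>M\<^esub> x = y"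
    using *[of y x] by (simp add: M.a_comm)
  show "x \<in> carrier M \<Longrightarrow> y \<in> carrier M \<Longrightarrow> (x \<ominus>\<^bsub>M\<^esub> y) \<oplus>\<^bsub>M\<^esub> y = x"
    by (simp add: M.minus_eq M.a_assoc M.l_neg)
qed

lemma submods_add_cancel:
  assumes "N \<in> submods R M" "x \<in> carrier M" "y \<in> N" "x \<oplus>\<^bsub>M\<^esub> y \<in> N" shows "x \<in> N"
  using submodsD(6)[OF assms(1,4,3)] submodsD(1)[OF assms(1,3)] assms(2) by simp

lemma submods_diff_cancel:
  assumes "N \<in> submods R M" "x \<in> carrier M" "y \<in> N" "x \<ominus>\<^bsub>M\<^esub> y \<in> N" shows "x \<in> N"
  using submodsD(3)[OF assms(1,4,3)] submodsD(1)[OF assms(1,3)] assms(2) by simp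

lemma sub_sum_I: "x \<in> A \<Longrightarrow> y \<in> B \<Longrightarrow> x \<oplus>\<^bsub>M\<^esub> y \<in> sub_sum M A B"
  by (auto simp: sub_sum_def)

lemma sub_sum_E:
  assumes "z \<in> sub_sum M A B" obtains x y where "x \<in> A" "y \<in> B" "z = x \<oplus>\<^bsub>M\<^esub> y"
  using assms by (auto simp: sub_sum_def)

lemma sub_sum_ub1: "A \<in> submods R M \<Longrightarrow> B \<in> submods R M \<Longrightarrow> A \<subseteq> sub_sum M A B"
proof
  fix x assume "A \<in> submods R M" "B \<in> submods R M" "x \<in> A"
  then show "x \<in> sub_sum M A B" using sub_sum_I[of x A "\<zero>\<^bsub>M\<^esub>" B] submodsD by simp
qed

lemma sub_sum_ub2: "A \<in> submods R M \<Longrightarrow> B \<in> submods R M \<Longrightarrow> B \<subseteq> sub_sum M A B"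
proof
  fix x assume "A \<in> submods R M" "B \<in> submods R M" "x \<in> B"
  then show "x \<in> sub_sum M A B" using sub_sum_I[of "\<zero>\<^bsub>M\<^esub>" A x B] submodsD by simp
qed

lemma sub_sum_submods:
  assumes "A \<in> submods R M" "B \<in> submods R M" shows "sub_sum M A B \<in> submods R M"
proof (rule submodsI)
  show "sub_sum M A B \<subseteq> carrier M" using assms by (auto simp: sub_sum_def dest: submodsD(1))
  show "\<zero>\<^bsub>M\<^esub> \<in> sub_sum M A B" using sub_sum_ub1[OF assms] submodsD(2)[OF assms(1)] by auto
next
  fix u v assume "u \<in> sub_sum M A B" "v \<in> sub_sum M A B"
  then obtain x y x' y' where *: "x \<in> A" "y \<in> B" "u = x \<oplus>\<^bsub>M\<^esub> y" "x' \<in> A" "y' \<in> B" "v = x' \<oplus>\<^bsub>M\<^esub> y'"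
    by (auto simp: sub_sum_def)
  then have "x \<in> carrier M" "y \<in> carrier M" "x' \<in> carrier M" "y' \<in> carrier M"
    using assms submodsD(1) by auto
  then have "u \<oplus>\<^bsub>M\<^esub> v = (x \<oplus>\<^bsub>M\<^esub> x') \<oplus>\<^bsub>M\<^esub> (y \<oplus>\<^bsub>M\<^esub> y')" using * by (simp add: M.a_ac)
  then show "u \<oplus>\<^bsub>M\<^esub> v \<in> sub_sum M A B" using * assms submodsD(3) by (auto intro!: sub_sum_I)
next
  fix a u assume "a \<in> carrier R" "u \<in> sub_sum M A B"
  then obtain x y where *: "x \<in> A" "y \<in> B" "u = x \<oplus>\<^bsub>M\<^esub> y" by (auto simp: sub_sum_def)
  then have "x \<in> carrier M" "y \<in> carrier M" using assms submodsD(1) by auto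
  then have "a \<odot>\<^bsub>M\<^esub> u = a \<odot>\<^bsub>M\<^esub> x \<oplus>\<^bsub>M\<^esub> a \<odot>\<^bsub>M\<^esub> y" using * \<open>a \<in> carrier R\<close> by (simp add: smult_r_distr)
  then show "a \<odot>\<^bsub>M\<^esub> u \<in> sub_sum M A B" using * assms submodsD(4) \<open>a \<in> carrier R\<close> by (auto intro!: sub_sum_I)
qed

lemma sub_sum_least: "C \<in> submods R M \<Longrightarrow> A \<subseteq> C \<Longrightarrow> B \<subseteq> C \<Longrightarrow> sub_sum M A B \<subseteq> C"
  by (auto simp: sub_sum_def intro: submodsD(3))

lemma sub_sum_mono: "A \<subseteq> A' \<Longrightarrow> B \<subseteq> B' \<Longrightarrow> sub_sum M A B \<subseteq> sub_sum M A' B'"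
  by (auto simp: sub_sum_def)

lemma sub_sum_modular:
  assumes "A \<in> submods R M" "B \<in> submods R M" "C \<in> submods R M" "A \<subseteq> B"
  shows "sub_sum M A C \<inter> B \<subseteq> sub_sum M A (C \<inter> B)"
proof
  fix z assume z: "z \<in> sub_sum M A C \<inter> B"
  then obtain x y where *: "x \<in> A" "y \<in> C" "z = x \<oplus>\<^bsub>M\<^esub> y" by (auto simp: sub_sum_def)
  have "x \<in> carrier M" "y \<in> carrier M" using * assms submodsD(1) by auto
  then have "y = z \<ominus>\<^bsub>M\<^esub> x" using * by simp
  then have "y \<in> B" using z * assms submodsD(6)[of B z x] by auto
  then show "z \<in> sub_sum M A (C \<inter> B)" using * by (auto intro: sub_sum_I)
qed

lemma modular_family_submods: "modular_family (submods R M) (sub_sum M)"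
  by (rule modular_family.intro)
     (simp_all add: submods_inter sub_sum_submods sub_sum_ub1 sub_sum_ub2 sub_sum_least sub_sum_modular)

lemmas len_add = modular_family.len_add[OF modular_family_submods]
  and len_inter_join = modular_family.len_inter_join[OF modular_family_submods]

lemma cyc_submods: "v \<in> carrier M \<Longrightarrow> cyc R M v \<in> submods R M"
proof (rule submodsI)
  assume v: "v \<in> carrier M"
  show "cyc R M v \<subseteq> carrier M" using v by (auto simp: cyc_def)
  show "\<zero>\<^bsub>M\<^esub> \<in> cyc R M v" unfolding cyc_def using smult_l_null[OF v] R.zero_closed by (metis (mono_tags, lifting) mem_Collect_eq)
  show "x \<oplus>\<^bsub>M\<^esub> y \<in> cyc R M v" if xy: "x \<in> cyc R M v" "y \<in> cyc R M v" for x y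
  proof -
    obtain a b where "a \<in> carrier R" "b \<in> carrier R" "x = a \<odot>\<^bsub>M\<^esub> v" "y = b \<odot>\<^bsub>M\<^esub> v"
      using xy unfolding cyc_def by blast
    then have "x \<oplus>\<^bsub>M\<^esub> y = (a \<oplus> b) \<odot>\<^bsub>M\<^esub> v" "a \<oplus> b \<in> carrier R" using v by (auto simp: smult_l_distr)
    then show ?thesis unfolding cyc_def by blast
  qed
  show "c \<odot>\<^bsub>M\<^esub> x \<in> cyc R M v" if cx: "c \<in> carrier R" "x \<in> cyc R M v" for c x
  proof -
    obtain a where "a \<in> carrier R" "x = a \<odot>\<^bsub>M\<^esub> v"
      using cx by (auto simp: cyc_def)
    then have "c \<odot>\<^bsub>M\<^esub> x = (c \<otimes> a) \<odot>\<^bsub>M\<^esub> v" "c \<otimes> a \<in> carrier R" using v cx by (auto simp: smult_assoc1)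
    then show ?thesis unfolding cyc_def by blast
  qed
qed

lemma cyc_mem: "v \<in> carrier M \<Longrightarrow> v \<in> cyc R M v"
  unfolding cyc_def by (force intro: exI[of _ "\<one>"])

lemma cyc_subset_iff: "N \<in> submods R M \<Longrightarrow> v \<in> carrier M \<Longrightarrow> cyc R M v \<subseteq> N \<longleftrightarrow> v \<in> N"
  using cyc_mem submodsD(4) by (force simp: cyc_def)

lemma submodule_span_submods:
  assumes "X \<subseteq> carrier M" shows "submodule_span R M X \<in> submods R M"
  unfolding submodule_span_def submods_def[symmetric]
proof (rule submodsI)
  show "\<Inter> {N. submodule N R M \<and> X \<subseteq> N} \<subseteq> carrier M"
    using assms carrier_submods by (auto simp: submods_def)
qed (use submodsD in \<open>auto simp: submods_def\<close>)

lemma submodule_span_subset: "X \<subseteq> submodule_span R M X"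
  by (auto simp: submodule_span_def)

lemma submodule_span_least: "N \<in> submods R M \<Longrightarrow> X \<subseteq> N \<Longrightarrow> submodule_span R M X \<subseteq> N"
  by (auto simp: submodule_span_def submods_def)

lemma ideal_mult_submods:
  assumes "J \<subseteq> carrier R" "A \<subseteq> carrier M" shows "ideal_mult R M J A \<in> submods R M"
  unfolding ideal_mult_def by (rule submodule_span_submods) (use assms in auto)

lemma ideal_mult_I: "a \<in> J \<Longrightarrow> x \<in> A \<Longrightarrow> a \<odot>\<^bsub>M\<^esub> x \<in> ideal_mult R M J A"
  unfolding ideal_mult_def by (rule subsetD[OF submodule_span_subset]) blast

lemma ideal_mult_least:
  "N \<in> submods R M \<Longrightarrow> (\<And>a x. a \<in> J \<Longrightarrow> x \<in> A \<Longrightarrow> a \<odot>\<^bsub>M\<^esub> x \<in> N) \<Longrightarrow> ideal_mult R M J A \<subseteq> N"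
  unfolding ideal_mult_def by (rule submodule_span_least) auto

lemma ideal_mult_mono:
  "J \<subseteq> J' \<Longrightarrow> A \<subseteq> A' \<Longrightarrow> J' \<subseteq> carrier R \<Longrightarrow> A' \<subseteq> carrier M \<Longrightarrow> ideal_mult R M J A \<subseteq> ideal_mult R M J' A'"
  using ideal_mult_submods[of J' A'] ideal_mult_I[of _ J' _ A'] by (intro ideal_mult_least) blast+

lemma ideal_mult_subset: "A \<in> submods R M \<Longrightarrow> J \<subseteq> carrier R \<Longrightarrow> ideal_mult R M J A \<subseteq> A"
  using submodsD(4)[of A] by (intro ideal_mult_least) blast+

lemma ideal_mult_carrier: "A \<in> submods R M \<Longrightarrow> ideal_mult R M (carrier R) A = A"
proof (rule antisym)
  assume A: "A \<in> submods R M"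
  show "A \<subseteq> ideal_mult R M (carrier R) A"
  proof
    fix x assume "x \<in> A"
    then show "x \<in> ideal_mult R M (carrier R) A"
      using ideal_mult_I[of \<one> "carrier R" x A] submodsD(1)[OF A] by simp
  qed
qed (simp add: ideal_mult_subset)

lemma colon_ideal:
  assumes "B \<in> submods R M" "A \<subseteq> carrier M" shows "ideal (colon R M B A) R"
proof (rule idealI)
  show "ring R" by (rule R.ring_axioms)
  have comm: "a \<odot>\<^bsub>M\<^esub> (x \<odot>\<^bsub>M\<^esub> v) \<in> B"
    if "\<forall>x\<in>A. a \<odot>\<^bsub>M\<^esub> x \<in> B" "v \<in> A" "a \<in> carrier R" "x \<in> carrier R" for a x v
  proof -
    have "a \<odot>\<^bsub>M\<^esub> (x \<odot>\<^bsub>M\<^esub> v) = x \<odot>\<^bsub>M\<^esub> (a \<odot>\<^bsub>M\<^esub> v)"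
      using that assms(2) by (subst (1 2) smult_assoc1[symmetric]) (auto simp: R.m_comm)
    then show ?thesis using that submodsD(4)[OF assms(1)] by auto
  qed
  show "subgroup (colon R M B A) (add_monoid R)"
    unfolding colon_def
  proof (rule R.add.subgroupI)
    show "{a \<in> carrier R. \<forall>x\<in>A. a \<odot>\<^bsub>M\<^esub> x \<in> B} \<noteq> {}" using assms submodsD(2) by (auto intro!: exI[of _ "\<zero>"])
  qed (use assms submodsD in \<open>auto simp: smult_l_distr smult_l_minus a_inv_def[symmetric] subset_iff\<close>)
  show "x \<otimes> a \<in> colon R M B A" "a \<otimes> x \<in> colon R M B A" if "a \<in> colon R M B A" "x \<in> carrier R" for a x
    using that assms(2) submodsD(4)[OF assms(1)] by (auto simp: colon_def smult_assoc1 subset_iff intro!: comm)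
qed

lemma ideal_mult_subset_iff:
  "N \<in> submods R M \<Longrightarrow> J \<subseteq> carrier R \<Longrightarrow> ideal_mult R M J A \<subseteq> N \<longleftrightarrow> J \<subseteq> colon R M N A"
proof
  assume "ideal_mult R M J A \<subseteq> N" "J \<subseteq> carrier R"
  then show "J \<subseteq> colon R M N A" using ideal_mult_I[of _ J _ A] unfolding colon_def by blast
qed (rule ideal_mult_least, auto simp: colon_def)

lemma ideal_mult_prod:
  assumes "ideal I R" "ideal J R" "A \<subseteq> carrier M"
  shows "ideal_mult R M (ideal_prod R I J) A = ideal_mult R M I (ideal_mult R M J A)"
proof (rule antisym)
  have I: "I \<subseteq> carrier R" "J \<subseteq> carrier R" "ideal_prod R I J \<subseteq> carrier R"
    using ideal.Icarr[OF assms(1)] ideal.Icarr[OF assms(2)] R.ideal_prod_in_carrier[OF assms(1,2)] by auto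
  have JA: "ideal_mult R M J A \<in> submods R M" "ideal_mult R M (ideal_prod R I J) A \<in> submods R M"
    using ideal_mult_submods I assms by auto
  then have IJA: "ideal_mult R M I (ideal_mult R M J A) \<in> submods R M"
    by (intro ideal_mult_submods I submods_subset[OF JA(1)])
  let ?K = "colon R M (ideal_mult R M I (ideal_mult R M J A)) A"
  have "ideal_prod R I J \<subseteq> ?K"
  proof (rule ideal_prod_least)
    show "x \<in> ?K \<Longrightarrow> y \<in> ?K \<Longrightarrow> x \<oplus> y \<in> ?K" for x y
      using colon_ideal[OF IJA assms(3)] by (simp add: additive_subgroup.a_closed ideal.axioms(1))
    show "a \<otimes> b \<in> ?K" if "a \<in> I" "b \<in> J" for a b
      using that I assms(3) by (auto simp: colon_def smult_assoc1 subset_iff intro!: ideal_mult_I)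
  qed
  then show "ideal_mult R M (ideal_prod R I J) A \<subseteq> ideal_mult R M I (ideal_mult R M J A)"
    using ideal_mult_subset_iff IJA I by blast
  show "ideal_mult R M I (ideal_mult R M J A) \<subseteq> ideal_mult R M (ideal_prod R I J) A"
  proof (rule ideal_mult_least[OF JA(2)])
    fix a x assume a: "a \<in> I" and x: "x \<in> ideal_mult R M J A"
    \<comment> \<open>Elements of \<open>JA\<close> are known only through the span, so the claim
      for a fixed \<open>a\<close> is phrased as membership in a submodule, which then has to be
      checked on generators alone.\<close>
    let ?N = "{x \<in> carrier M. a \<odot>\<^bsub>M\<^esub> x \<in> ideal_mult R M (ideal_prod R I J) A}"
    have aR: "a \<in> carrier R" using a I by auto
    have "?N \<in> submods R M"
    proof (rule submodsI)
      fix b x assume "b \<in> carrier R" "x \<in> ?N"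
      then have "a \<odot>\<^bsub>M\<^esub> (b \<odot>\<^bsub>M\<^esub> x) = b \<odot>\<^bsub>M\<^esub> (a \<odot>\<^bsub>M\<^esub> x)"
        using aR by (simp add: smult_assoc1[symmetric] R.m_comm)
      then show "b \<odot>\<^bsub>M\<^esub> x \<in> ?N" using JA(2) \<open>b \<in> carrier R\<close> \<open>x \<in> ?N\<close> by (auto dest: submodsD(4))
    qed (use aR JA(2) submodsD in \<open>auto simp: smult_r_distr\<close>)
    then have "ideal_mult R M J A \<subseteq> ?N"
    proof (rule ideal_mult_least)
      fix b y assume b: "b \<in> J" "y \<in> A"
      then have "b \<in> carrier R" "y \<in> carrier M" using I assms(3) by auto
      moreover have "(a \<otimes> b) \<odot>\<^bsub>M\<^esub> y \<in> ideal_mult R M (ideal_prod R I J) A"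
        by (rule ideal_mult_I[OF ideal_prod.prod[OF a b(1)] b(2)])
      ultimately show "b \<odot>\<^bsub>M\<^esub> y \<in> ?N" using aR by (simp add: smult_assoc1)
    qed
    then show "a \<odot>\<^bsub>M\<^esub> x \<in> ideal_mult R M (ideal_prod R I J) A" using x by auto
  qed
qed

lemma ideal_mult_sub_sum:
  assumes "J \<subseteq> carrier R" "A \<in> submods R M" "B \<in> submods R M"
  shows "ideal_mult R M J (sub_sum M A B) \<subseteq> sub_sum M (ideal_mult R M J A) (ideal_mult R M J B)"
proof (rule ideal_mult_least)
  have s: "ideal_mult R M J A \<in> submods R M" "ideal_mult R M J B \<in> submods R M"
    using assms by (auto intro!: ideal_mult_submods submods_subset)
  then show "sub_sum M (ideal_mult R M J A) (ideal_mult R M J B) \<in> submods R M" by (rule sub_sum_submods)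
  fix a z assume a: "a \<in> J" and "z \<in> sub_sum M A B"
  then obtain x y where *: "x \<in> A" "y \<in> B" "z = x \<oplus>\<^bsub>M\<^esub> y" by (auto simp: sub_sum_def)
  then have "a \<odot>\<^bsub>M\<^esub> z = a \<odot>\<^bsub>M\<^esub> x \<oplus>\<^bsub>M\<^esub> a \<odot>\<^bsub>M\<^esub> y"
    using assms a submodsD(1) by (auto simp: smult_r_distr)
  then show "a \<odot>\<^bsub>M\<^esub> z \<in> sub_sum M (ideal_mult R M J A) (ideal_mult R M J B)"
    using a * by (auto intro!: sub_sum_I ideal_mult_I)
qed

end

section \<open>The ring as a module over itself, and module homomorphisms\<close>

lemma (in cring) module_self: "module R (self_module R)"
proof (rule moduleI)
  show "abelian_group (self_module R)"
  proof (rule abelian_groupI)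
    show "\<exists>y\<in>carrier (self_module R). y \<oplus>\<^bsub>self_module R\<^esub> x = \<zero>\<^bsub>self_module R\<^esub>"
      if "x \<in> carrier (self_module R)" for x
      using that by (intro bexI[of _ "\<ominus> x"]) (auto simp: l_neg)
  qed (auto simp: a_ac)
qed (auto simp: l_distr r_distr m_assoc is_cring)

lemma (in cring) submods_self: "submods R (self_module R) = {I. ideal I R}"
proof -
  interpret S: module R "self_module R" by (rule module_self)
  have "I \<in> submods R (self_module R)" if "ideal I R" for I
    using that ideal.Icarr additive_subgroup.zero_closed additive_subgroup.a_closed ideal.axioms(1) ideal.I_l_closed
    by (intro S.submodsI) (auto, (fastforce)+)
  moreover have "ideal I R" if "I \<in> submods R (self_module R)" for I
  proof -
    \<comment> \<open>A submodule of \<open>R\<close> is its own colon ideal with respect to the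
      unit element, and colon ideals are known to be ideals.\<close>
    have "colon R (self_module R) I {\<one>} = I" using S.submodsD[OF that] by (auto simp: colon_def)
    then show ?thesis using S.colon_ideal[OF that, of "{\<one>}"] by simp
  qed
  ultimately show ?thesis by auto
qed

locale module_hom = P: module R P + M: module R M for R (structure) and P (structure) and M (structure) +
  fixes f
  assumes f_closed [simp]: "x \<in> carrier P \<Longrightarrow> f x \<in> carrier M"
    and f_add: "x \<in> carrier P \<Longrightarrow> y \<in> carrier P \<Longrightarrow> f (x \<oplus>\<^bsub>P\<^esub> y) = f x \<oplus>\<^bsub>M\<^esub> f y"
    and f_smult: "a \<in> carrier R \<Longrightarrow> x \<in> carrier P \<Longrightarrow> f (a \<odot>\<^bsub>P\<^esub> x) = a \<odot>\<^bsub>M\<^esub> f x"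
begin

lemma f_zero [simp]: "f \<zero>\<^bsub>P\<^esub> = \<zero>\<^bsub>M\<^esub>"
proof -
  have "f (\<zero> \<odot>\<^bsub>P\<^esub> \<zero>\<^bsub>P\<^esub>) = \<zero> \<odot>\<^bsub>M\<^esub> f \<zero>\<^bsub>P\<^esub>" by (rule f_smult) auto
  then show ?thesis by (simp del: P.smult_r_null)
qed

lemma f_diff: "x \<in> carrier P \<Longrightarrow> y \<in> carrier P \<Longrightarrow> f (x \<ominus>\<^bsub>P\<^esub> y) = f x \<ominus>\<^bsub>M\<^esub> f y"
proof -
  assume xy: "x \<in> carrier P" "y \<in> carrier P"
  then have "f x = f (x \<ominus>\<^bsub>P\<^esub> y) \<oplus>\<^bsub>M\<^esub> f y" by (subst f_add[symmetric]) auto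
  then show ?thesis using xy by simp
qed

lemma image_submods: "A \<in> submods R P \<Longrightarrow> f ` A \<in> submods R M"
proof (rule M.submodsI)
  assume A: "A \<in> submods R P"
  show "f ` A \<subseteq> carrier M" using P.submods_subset[OF A] by auto
  show "\<zero>\<^bsub>M\<^esub> \<in> f ` A" using P.submodsD(2)[OF A] f_zero by force
  show "x \<oplus>\<^bsub>M\<^esub> y \<in> f ` A" if "x \<in> f ` A" "y \<in> f ` A" for x y
    using that P.submodsD[OF A] by (auto simp: f_add[symmetric])
  show "a \<odot>\<^bsub>M\<^esub> x \<in> f ` A" if "a \<in> carrier R" "x \<in> f ` A" for a x
    using that P.submodsD[OF A] by (auto simp: f_smult[symmetric])
qed

lemma preimage_submods: "A \<in> submods R P \<Longrightarrow> B \<in> submods R M \<Longrightarrow> {v \<in> A. f v \<in> B} \<in> submods R P"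
  by (rule P.submodsI) (auto simp: f_add f_smult P.submodsD M.submodsD)

text \<open>Mirrors the isomorphism of \<open>(f(A) + B)/B\<close> with \<open>A\<close> modulo the
  preimage of \<open>B\<close>. With \<open>f\<close> multiplication by a ring element it yields
  kernels and cokernels, with \<open>f\<close> sending \<open>a\<close> to \<open>a v\<close> it
  yields cyclic factors.\<close>

lemma len_image:
  assumes A: "A \<in> submods R P" and B: "B \<in> submods R M"
  shows "len (submods R M) B (sub_sum M (f ` A) B) = len (submods R P) {v \<in> A. f v \<in> B} A"
proof (rule antisym)
  note fA = image_submods[OF A]
  show "len (submods R M) B (sub_sum M (f ` A) B) \<le> len (submods R P) {v \<in> A. f v \<in> B} A"
  proof (rule len_strict_map[where \<phi> = "\<lambda>N. {v \<in> A. f v \<in> N}"])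
    fix N N' assume N: "N \<in> submods R M" "N' \<in> submods R M" "B \<subseteq> N" "N \<subset> N'" "N' \<subseteq> sub_sum M (f ` A) B"
    then obtain y where y: "y \<in> N'" "y \<notin> N" by blast
    then obtain v b where v: "v \<in> A" "b \<in> B" "y = f v \<oplus>\<^bsub>M\<^esub> b"
      using N(5) by (auto elim!: M.sub_sum_E dest!: subsetD)
    have fv: "f v \<in> carrier M" using v P.submodsD(1)[OF A] by auto
    then have "f v \<in> N'" using M.submods_add_cancel[OF N(2) fv, of b] N v y by auto
    moreover have "f v \<notin> N" using M.submodsD(3)[OF N(1)] v y N by auto
    ultimately show "{v \<in> A. f v \<in> N} \<subset> {v \<in> A. f v \<in> N'}" using v N by blast
  qed (use A preimage_submods in auto)
  show "len (submods R P) {v \<in> A. f v \<in> B} A \<le> len (submods R M) B (sub_sum M (f ` A) B)"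
  proof (rule len_strict_map[where \<phi> = "\<lambda>N. sub_sum M (f ` N) B"])
    fix N assume "N \<in> submods R P" "{v \<in> A. f v \<in> B} \<subseteq> N" "N \<subseteq> A"
    then show "sub_sum M (f ` N) B \<in> submods R M \<and> B \<subseteq> sub_sum M (f ` N) B \<and> sub_sum M (f ` N) B \<subseteq> sub_sum M (f ` A) B"
      using M.sub_sum_submods[OF image_submods B] M.sub_sum_ub2[OF image_submods B]
        M.sub_sum_mono[of "f ` N" "f ` A" B B] by auto
  next
    fix N N' assume N: "N \<in> submods R P" "N' \<in> submods R P" "{v \<in> A. f v \<in> B} \<subseteq> N" "N \<subset> N'" "N' \<subseteq> A"
    then obtain y where y: "y \<in> N'" "y \<notin> N" by blast
    have "f y \<notin> sub_sum M (f ` N) B"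
    proof
      assume "f y \<in> sub_sum M (f ` N) B"
      then obtain u b where u: "u \<in> N" "b \<in> B" "f y = f u \<oplus>\<^bsub>M\<^esub> b" by (auto simp: sub_sum_def)
      have c: "u \<in> carrier P" "y \<in> carrier P" "u \<in> A" "y \<in> A" "b \<in> carrier M"
        using u y N P.submodsD(1)[OF A] M.submodsD(1)[OF B] by auto
      then have "f (y \<ominus>\<^bsub>P\<^esub> u) = b" using u by (simp add: f_diff)
      then have "y \<ominus>\<^bsub>P\<^esub> u \<in> N" using N(3) u P.submodsD(6)[OF A] c by auto
      then show False using P.submods_diff_cancel[OF N(1) c(2) u(1)] y by auto
    qed
    moreover have "f y \<in> sub_sum M (f ` N') B"
      using y M.sub_sum_ub1[OF image_submods[OF N(2)] B] by auto
    ultimately show "sub_sum M (f ` N) B \<subset> sub_sum M (f ` N') B"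
      using M.sub_sum_mono[of "f ` N" "f ` N'" B B] N(4) by blast
  qed
qed

end

context module
begin

lemma module_hom_smult: "x \<in> carrier R \<Longrightarrow> module_hom R M M (smult M x)"
  by unfold_locales (auto simp: smult_r_distr smult_assoc1[symmetric] R.m_comm)

lemma module_hom_cyc: "v \<in> carrier M \<Longrightarrow> module_hom R (self_module R) M (\<lambda>a. a \<odot>\<^bsub>M\<^esub> v)"
  by (intro module_hom.intro module_hom_axioms.intro R.module_self module_axioms)
     (auto simp: smult_l_distr smult_assoc1)

end

section \<open>Ascending chain conditions\<close>

text \<open>Formulated for any partial order, so that it covers submodules, families of submodules
  ordered pointwise, and sequences of such families.\<close>

definition acc :: "'x::order set \<Rightarrow> bool" where
  "acc P \<longleftrightarrow> (\<forall>N::nat \<Rightarrow> 'x. (\<forall>i. N i \<in> P) \<longrightarrow> (\<forall>i. N i \<le> N (Suc i)) \<longrightarrow> (\<exists>k. \<forall>i\<ge>k. N i = N k))"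

lemma accD:
  assumes "acc P" "\<And>i. N i \<in> P" "\<And>i. N i \<le> N (Suc i)" obtains k where "\<And>i. i \<ge> k \<Longrightarrow> N i = N k"
  using assms unfolding acc_def by blast

lemma acc_subset: "acc Q \<Longrightarrow> P \<subseteq> Q \<Longrightarrow> acc P"
  unfolding acc_def by blast

text \<open>Once both images of a chain are stationary, so is the chain: its members are comparable,
  and the two images together separate comparable elements.\<close>

lemma acc_map2:
  assumes "acc Q" "acc Q'" "\<And>X. X \<in> P \<Longrightarrow> \<phi> X \<in> Q" "\<And>X. X \<in> P \<Longrightarrow> \<psi> X \<in> Q'"
    and "\<And>X Y. X \<in> P \<Longrightarrow> Y \<in> P \<Longrightarrow> X \<le> Y \<Longrightarrow> \<phi> X \<le> \<phi> Y"
    and "\<And>X Y. X \<in> P \<Longrightarrow> Y \<in> P \<Longrightarrow> X \<le> Y \<Longrightarrow> \<psi> X \<le> \<psi> Y"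
    and "\<And>X Y. X \<in> P \<Longrightarrow> Y \<in> P \<Longrightarrow> X \<le> Y \<Longrightarrow> \<phi> X = \<phi> Y \<Longrightarrow> \<psi> X = \<psi> Y \<Longrightarrow> X = Y"
  shows "acc P"
  unfolding acc_def
proof (intro allI impI)
  fix N :: "nat \<Rightarrow> 'c" assume N: "\<forall>i. N i \<in> P" "\<forall>i. N i \<le> N (Suc i)"
  obtain k where k: "\<And>i. i \<ge> k \<Longrightarrow> \<phi> (N i) = \<phi> (N k)"
    by (rule accD[OF assms(1), of "\<lambda>i. \<phi> (N i)"]) (use assms(3,5) N in blast)+
  obtain k' where k': "\<And>i. i \<ge> k' \<Longrightarrow> \<psi> (N i) = \<psi> (N k')"
    by (rule accD[OF assms(2), of "\<lambda>i. \<psi> (N i)"]) (use assms(4,6) N in blast)+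
  have "N i = N (max k k')" if "i \<ge> max k k'" for i
  proof -
    have "N (max k k') \<le> N i" by (rule lift_Suc_mono_le[of N]) (use N that in auto)
    moreover have "\<phi> (N (max k k')) = \<phi> (N i)" using k[of i] k[of "max k k'"] that by auto
    moreover have "\<psi> (N (max k k')) = \<psi> (N i)" using k'[of i] k'[of "max k k'"] that by auto
    ultimately show ?thesis using assms(7) N by metis
  qed
  then show "\<exists>k. \<forall>i\<ge>k. N i = N k" by blast
qed

lemma acc_map:
  assumes "acc Q" "\<And>X. X \<in> P \<Longrightarrow> \<phi> X \<in> Q"
    and "\<And>X Y. X \<in> P \<Longrightarrow> Y \<in> P \<Longrightarrow> X \<le> Y \<Longrightarrow> \<phi> X \<le> \<phi> Y"
    and "\<And>X Y. X \<in> P \<Longrightarrow> Y \<in> P \<Longrightarrow> X \<le> Y \<Longrightarrow> \<phi> X = \<phi> Y \<Longrightarrow> X = Y"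
  shows "acc P"
  by (rule acc_map2[OF assms(1,1) assms(2,2) assms(3,3) assms(4)])

text \<open>The diagonal \<open>F i i\<close> is stationary from some \<open>t\<close> on, and
  monotonicity then fixes all entries \<open>F i k\<close> with \<open>i, k \<ge> t\<close>. Only
  the finitely many columns \<open>k \<le> t\<close> remain, and each of them stabilises by itself.
  This is the double chain argument of Hilbert's basis theorem.\<close>

lemma acc_mono_seq:
  assumes "acc Q" shows "acc {F :: nat \<Rightarrow> 'x::order. \<forall>k. F k \<in> Q \<and> F k \<le> F (Suc k)}"
  unfolding acc_def
proof (intro allI impI)
  fix F :: "nat \<Rightarrow> nat \<Rightarrow> 'x"
  assume F: "\<forall>i. F i \<in> {F. \<forall>k. F k \<in> Q \<and> F k \<le> F (Suc k)}" "\<forall>i. F i \<le> F (Suc i)"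
  have mono: "F i k \<le> F i' k'" if "i \<le> i'" "k \<le> k'" for i i' k k'
  proof -
    have "F i k \<le> F i k'" by (rule lift_Suc_mono_le[of "F i"]) (use F(1) that(2) in auto)
    also have "F i \<le> F i'" by (rule lift_Suc_mono_le[of F]) (use F(2) that(1) in auto)
    then have "F i k' \<le> F i' k'" by (simp add: le_fun_def)
    finally show ?thesis .
  qed
  obtain t where t: "\<And>i. i \<ge> t \<Longrightarrow> F i i = F t t"
    using accD[OF assms, of "\<lambda>i. F i i"] F(1) mono by auto
  have "\<exists>s. \<forall>i\<ge>s. F i k = F s k" for k
    using assms F(1) mono unfolding acc_def by auto
  then obtain s where s: "\<And>k i. i \<ge> s k \<Longrightarrow> F i k = F (s k) k" by metis
  define u where "u = Max (insert t (s ` {..t}))"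
  have u: "t \<le> u" "\<And>k. k \<le> t \<Longrightarrow> s k \<le> u" unfolding u_def by (rule Max_ge; simp)+
  have "F i k = F u k" if "i \<ge> u" for i k
  proof (cases "k \<le> t")
    case True
    then show ?thesis using s[of k i] s[of k u] u(2)[of k] that by auto
  next
    case False
    have "F i' k = F t t" if "i' \<ge> t" for i'
    proof (rule antisym)
      have "F i' k \<le> F (max i' k) (max i' k)" by (rule mono) auto
      also have "\<dots> = F t t" using that by (intro t) auto
      finally show "F i' k \<le> F t t" .
      show "F t t \<le> F i' k" using that False by (intro mono) auto
    qed
    then show ?thesis using u(1) that by auto
  qed
  then show "\<exists>k. \<forall>i\<ge>k. F i = F k" by blast
qed

lemma acc_maximal:
  assumes "acc P" "X \<subseteq> P" "x \<in> X" shows "\<exists>m\<in>X. \<forall>y\<in>X. \<not> m < y"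
proof (rule ccontr)
  assume "\<not> ?thesis"
  then obtain g where g: "\<And>m. m \<in> X \<Longrightarrow> g m \<in> X \<and> m < g m" by metis
  define N where "N = (\<lambda>i. (g ^^ i) x)"
  have N: "N i \<in> X" for i by (induction i) (auto simp: N_def g assms(3))
  then have lt: "N i < N (Suc i)" for i using g by (auto simp: N_def)
  have "N i \<in> P" "N i \<le> N (Suc i)" for i using N[of i] assms(2) less_imp_le[OF lt[of i]] by auto
  then obtain k where k: "\<And>i. i \<ge> k \<Longrightarrow> N i = N k" using accD[OF assms(1), of N] by metis
  have "N (Suc k) = N k" by (rule k) simp
  then show False using lt[of k] by simp
qed

lemma acc_induct [consumes 2, case_names step]:
  assumes "acc P" "x \<in> P" "\<And>x. x \<in> P \<Longrightarrow> (\<And>y. y \<in> P \<Longrightarrow> x < y \<Longrightarrow> Q y) \<Longrightarrow> Q x"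
  shows "Q x"
proof (rule ccontr)
  assume "\<not> Q x"
  then obtain m where "m \<in> {x \<in> P. \<not> Q x}" "\<forall>y\<in>{x \<in> P. \<not> Q x}. \<not> m < y"
    using acc_maximal[OF assms(1), of "{x \<in> P. \<not> Q x}" x] assms(2) by blast
  then show False using assms(3) by blast
qed

lemma (in noetherian_ring) acc_ideals: "acc {I. ideal I R}"
  unfolding acc_def
proof (intro allI impI)
  fix N :: "nat \<Rightarrow> 'a set" assume N: "\<forall>i. N i \<in> {I. ideal I R}" "\<forall>i. N i \<le> N (Suc i)"
  have mono: "i \<le> i' \<Longrightarrow> N i \<subseteq> N i'" for i i' by (rule lift_Suc_mono_le[of N]) (use N(2) in auto)
  have "subset.chain {I. ideal I R} (range N)"
    unfolding pred_on.chain_def using N(1) mono nat_le_linear by blast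
  then have "\<Union>(range N) \<in> range N" by (intro ideal_chain_is_trivial) auto
  then obtain k where "\<Union>(range N) = N k" by auto
  then have "\<forall>i\<ge>k. N i = N k" using mono by blast
  then show "\<exists>k. \<forall>i\<ge>k. N i = N k" by blast
qed

section \<open>Finitely generated modules over a Noetherian ring\<close>

context module
begin

text \<open>By \<open>cancel\<close>, comparable members of the large interval coincide if they have
  the same intersection and the same sum with \<open>C\<close>, and these two lie in the small
  intervals.\<close>

lemma acc_interval_split:
  assumes "B \<in> submods R M" "C \<in> submods R M"
    and "acc {N \<in> submods R M. B \<subseteq> N \<and> N \<subseteq> C}" "acc {N \<in> submods R M. C \<subseteq> N \<and> N \<subseteq> A}"
    and "A \<in> submods R M" "B \<subseteq> C" "C \<subseteq> A"
  shows "acc {N \<in> submods R M. B \<subseteq> N \<and> N \<subseteq> A}"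
proof (rule acc_map2[OF assms(3,4), where \<phi> = "\<lambda>N. N \<inter> C" and \<psi> = "\<lambda>N. sub_sum M N C"])
  fix X Y assume "X \<in> {N \<in> submods R M. B \<subseteq> N \<and> N \<subseteq> A}" "Y \<in> {N \<in> submods R M. B \<subseteq> N \<and> N \<subseteq> A}"
    and *: "X \<le> Y" "X \<inter> C = Y \<inter> C" "sub_sum M X C = sub_sum M Y C"
  then show "X = Y"
    by (intro modular_family.cancel[OF modular_family_submods, of X Y C]) (use assms in auto)
qed (use assms submods_inter sub_sum_submods sub_sum_ub2 sub_sum_least in
     \<open>auto intro: sub_sum_mono[THEN subsetD]\<close>)

text \<open>The interval is that of \<open>(C + Rv)/C\<close>, a quotient of \<open>R\<close>: a
  member \<open>N\<close> is recovered from the ideal of all \<open>a\<close> with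
  \<open>a v\<close> in \<open>N\<close>.\<close>

lemma acc_interval_cyc:
  assumes "acc {I. ideal I R}" "C \<in> submods R M" "v \<in> carrier M"
  shows "acc {N \<in> submods R M. C \<subseteq> N \<and> N \<subseteq> sub_sum M C (cyc R M v)}"
proof (rule acc_map[OF assms(1), where \<phi> = "\<lambda>N. colon R M N {v}"])
  fix X Y assume XY: "X \<in> {N \<in> submods R M. C \<subseteq> N \<and> N \<subseteq> sub_sum M C (cyc R M v)}"
      "Y \<in> {N \<in> submods R M. C \<subseteq> N \<and> N \<subseteq> sub_sum M C (cyc R M v)}" "X \<le> Y"
    and eq: "colon R M X {v} = colon R M Y {v}"
  have "y \<in> X" if "y \<in> Y" for y
  proof -
    obtain c a where ca: "c \<in> C" "a \<in> carrier R" "y = c \<oplus>\<^bsub>M\<^esub> a \<odot>\<^bsub>M\<^esub> v"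
      using XY(2) \<open>y \<in> Y\<close> by (auto simp: cyc_def elim!: sub_sum_E dest!: subsetD)
    then have "c \<in> Y" "c \<in> X" "c \<in> carrier M" using XY assms submodsD(1) by auto
    moreover have "a \<odot>\<^bsub>M\<^esub> v = y \<ominus>\<^bsub>M\<^esub> c" using ca \<open>c \<in> carrier M\<close> assms by simp
    ultimately have "a \<odot>\<^bsub>M\<^esub> v \<in> Y" using XY(2) \<open>y \<in> Y\<close> submodsD(6) by auto
    then have "a \<odot>\<^bsub>M\<^esub> v \<in> X" using eq ca by (auto simp: colon_def)
    then show "y \<in> X" using ca \<open>c \<in> X\<close> XY(1) submodsD(3) by auto
  qed
  then show "X = Y" using XY by auto
next
  fix X assume "X \<in> {N \<in> submods R M. C \<subseteq> N \<and> N \<subseteq> sub_sum M C (cyc R M v)}"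
  then show "colon R M X {v} \<in> {I. ideal I R}" using colon_ideal[of X "{v}"] assms(3) by simp
qed (auto simp: colon_def)

lemma acc_submods:
  assumes "acc {I. ideal I R}" "finite S" "S \<subseteq> carrier M" "submodule_span R M S = carrier M"
  shows "acc (submods R M)"
proof -
  have "acc {N \<in> submods R M. {\<zero>\<^bsub>M\<^esub>} \<subseteq> N \<and> N \<subseteq> submodule_span R M S}"
    using assms(2,3)
  proof (induction S)
    case empty
    have "submodule_span R M {} \<subseteq> {\<zero>\<^bsub>M\<^esub>}" by (rule submodule_span_least[OF zero_submods]) auto
    then have "{N \<in> submods R M. {\<zero>\<^bsub>M\<^esub>} \<subseteq> N \<and> N \<subseteq> submodule_span R M {}} \<subseteq> {{\<zero>\<^bsub>M\<^esub>}}" by auto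
    moreover have "acc {{\<zero>\<^bsub>M\<^esub>}}" unfolding acc_def by auto
    ultimately show ?case by (rule acc_subset[rotated])
  next
    case (insert v S)
    let ?C = "submodule_span R M S" and ?A = "sub_sum M (submodule_span R M S) (cyc R M v)"
    have C: "?C \<in> submods R M" "cyc R M v \<in> submods R M"
      using insert.prems by (auto intro: submodule_span_submods cyc_submods)
    have "acc {N \<in> submods R M. {\<zero>\<^bsub>M\<^esub>} \<subseteq> N \<and> N \<subseteq> ?A}"
      by (rule acc_interval_split[of _ ?C])
         (use C insert zero_submods submodsD(2)[OF C(1)] sub_sum_submods[OF C] sub_sum_ub1[OF C]
            acc_interval_cyc[OF assms(1) C(1)] in auto)
    moreover have "submodule_span R M (insert v S) \<subseteq> ?A"
      by (rule submodule_span_least[OF sub_sum_submods[OF C]])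
         (use insert.prems sub_sum_ub1[OF C] sub_sum_ub2[OF C] submodule_span_subset cyc_mem in auto)
    ultimately show ?case by (auto intro: acc_subset)
  qed
  moreover have "submods R M \<subseteq> {N \<in> submods R M. {\<zero>\<^bsub>M\<^esub>} \<subseteq> N \<and> N \<subseteq> submodule_span R M S}"
    unfolding assms(4) using submodsD(1,2) by auto
  ultimately show ?thesis by (rule acc_subset)
qed

end

section \<open>Multigraded families of submodules\<close>

definition bump :: "'r \<Rightarrow> nat \<Rightarrow> ('r \<Rightarrow> nat) \<Rightarrow> 'r \<Rightarrow> nat" where
  "bump j a n = n(j := n j + a)"

lemma bump_simps [simp]:
  "bump j a n j = n j + a" "i \<noteq> j \<Longrightarrow> bump j a n i = n i" "bump j 0 n = n"
  "bump j a (bump j b n) = bump j (a + b) n"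
  by (auto simp: bump_def)

lemma bump_commute: "bump i b (bump j a n) = bump j a (bump i b n)"
  by (auto simp: bump_def fun_eq_iff)

lemma bump_ge: "n i \<le> bump j a n i"
  by (auto simp: bump_def)

text \<open>A triple \<open>(x, a, j)\<close> stands for a homogeneous element \<open>x\<close> of multidegree \<open>a e\<^sub>j\<close>; \<open>fam R M S B A\<close>
  consists of the graded submodules of \<open>\<Oplus>\<^sub>n A\<^sub>n\<close> that contain \<open>\<Oplus>\<^sub>n B\<^sub>n\<close>, over the graded algebra
  generated by \<open>S\<close>.\<close>

definition fam ::
  "('a, 'c) ring_scheme \<Rightarrow> ('a, 'b, 'd) module_scheme \<Rightarrow> ('a \<times> nat \<times> 'r) set \<Rightarrow>
   (('r \<Rightarrow> nat) \<Rightarrow> 'b set) \<Rightarrow> (('r \<Rightarrow> nat) \<Rightarrow> 'b set) \<Rightarrow> (('r \<Rightarrow> nat) \<Rightarrow> 'b set) set" where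
  "fam R M S B A = {C. (\<forall>n. C n \<in> submods R M \<and> B n \<subseteq> C n \<and> C n \<subseteq> A n) \<and>
     (\<forall>x a j n v. (x, a, j) \<in> S \<longrightarrow> v \<in> C n \<longrightarrow> x \<odot>\<^bsub>M\<^esub> v \<in> C (bump j a n))}"

lemma famI:
  assumes "\<And>n. C n \<in> submods R M" "\<And>n. B n \<subseteq> C n" "\<And>n. C n \<subseteq> A n"
    "\<And>x a j n v. (x, a, j) \<in> S \<Longrightarrow> v \<in> C n \<Longrightarrow> x \<odot>\<^bsub>M\<^esub> v \<in> C (bump j a n)"
  shows "C \<in> fam R M S B A"
  using assms by (auto simp: fam_def)

lemma famD:
  assumes "C \<in> fam R M S B A"
  shows "C n \<in> submods R M" "B n \<subseteq> C n" "C n \<subseteq> A n"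
    "(x, a, j) \<in> S \<Longrightarrow> v \<in> C n \<Longrightarrow> x \<odot>\<^bsub>M\<^esub> v \<in> C (bump j a n)"
  using assms by (auto simp: fam_def)

context module
begin

text \<open>The Hilbert basis theorem: a graded submodule \<open>C\<close> of \<open>T = \<Sum>\<^sub>k x\<^sup>k A\<close> is determined by its modules
  \<open>L C k\<close> of leading coefficients.\<close>

lemma acc_fam_insert:
  fixes S :: "('a \<times> nat \<times> 'r) set"
  assumes x: "x \<in> carrier R" and S: "\<And>y b i. (y, b, i) \<in> S \<Longrightarrow> y \<in> carrier R"
    and A: "A \<in> fam R M S B A" and B: "B \<in> fam R M (insert (x, a, j) S) B A"
    and acc: "acc (fam R M S B A)"
  shows "\<exists>T. T \<in> fam R M (insert (x, a, j) S) B T \<and> (\<forall>n. A n \<subseteq> T n) \<and> acc (fam R M (insert (x, a, j) S) B T)"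
proof -
  let ?S = "insert (x, a, j) S"
  define pw where "pw k v = (x [^] k) \<odot>\<^bsub>M\<^esub> v" for k :: nat and v
  have pw_hom: "module_hom R M M (pw k)" for k
    unfolding pw_def using x by (intro module_hom_smult) auto
  have pw_0: "v \<in> carrier M \<Longrightarrow> pw 0 v = v" for v by (simp add: pw_def)
  have pw_Suc: "v \<in> carrier M \<Longrightarrow> pw (Suc k) v = x \<odot>\<^bsub>M\<^esub> pw k v" for k v
    using x by (simp add: pw_def smult_assoc1[symmetric] R.m_comm)
  have pw_smult: "v \<in> carrier M \<Longrightarrow> y \<in> carrier R \<Longrightarrow> pw k (y \<odot>\<^bsub>M\<^esub> v) = y \<odot>\<^bsub>M\<^esub> pw k v" for k v y
    using module_hom.f_smult[OF pw_hom] by simp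
  have pw_closed: "v \<in> carrier M \<Longrightarrow> pw k v \<in> carrier M" for k v
    using module_hom.f_closed[OF pw_hom] by simp
  note AD = famD[OF A] and BD = famD[OF B]
  have AM: "v \<in> A n \<Longrightarrow> v \<in> carrier M" for v n using submodsD(1)[OF AD(1)] .
  \<comment> \<open>Subtraction of natural numbers is truncated, so \<open>dn k\<close> undoes the
    shift by \<open>k * a\<close> only if \<open>k * a \<le> n j\<close>; for this reason
    \<open>E\<close> adds \<open>X k n\<close> under this condition only.\<close>
  define dn where "dn k n = n(j := n j - k * a)" for k n
  have dn1: "k * a \<le> n j \<Longrightarrow> bump j (k * a) (dn k n) = n" for k n by (auto simp: bump_def dn_def)
  have dn2: "dn k (bump j (k * a) n) = n" for k n by (auto simp: bump_def dn_def)
  have dn3: "dn (Suc k) (bump j a n) = dn k n" for k n by (auto simp: bump_def dn_def)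
  have dn4: "k * a \<le> n j \<Longrightarrow> dn k (bump i b n) = bump i b (dn k n)" for k n i b
    by (auto simp: bump_def dn_def fun_eq_iff)
  define X where "X k n = pw k ` A (dn k n)" for k n
  \<comment> \<open>\<open>E k n\<close> is the part of degree \<open>n\<close> of
    \<open>B + A + xA + ... + x^(k-1) A\<close>: the polynomials in \<open>x\<close> of degree below
    \<open>k\<close>, modulo \<open>B\<close>.\<close>
  define E where "E = rec_nat B (\<lambda>k F n. if k * a \<le> n j then sub_sum M (F n) (X k n) else F n)"
  have E0: "E 0 = B" and ES: "E (Suc k) n = (if k * a \<le> n j then sub_sum M (E k n) (X k n) else E k n)" for k n
    by (simp_all add: E_def)
  have Xs: "X k n \<in> submods R M" for k n
    unfolding X_def by (rule module_hom.image_submods[OF pw_hom AD(1)])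
  have Es: "E k n \<in> submods R M" for k n
    by (induction k) (auto simp: E0 ES BD(1) sub_sum_submods Xs)
  have Emono: "E k n \<subseteq> E (Suc k) n" for k n
    using sub_sum_ub1[OF Es Xs] by (auto simp: ES)
  have Emono': "k \<le> k' \<Longrightarrow> E k n \<subseteq> E k' n" for k k' n
    by (rule lift_Suc_mono_le[of "\<lambda>k. E k n"]) (use Emono in auto)
  have Ex: "v \<in> E k n \<Longrightarrow> x \<odot>\<^bsub>M\<^esub> v \<in> E (Suc k) (bump j a n)" for k n v
  proof (induction k arbitrary: v)
    case 0
    then have "x \<odot>\<^bsub>M\<^esub> v \<in> E 0 (bump j a n)" using BD(4)[of x a j v n] by (simp add: E0)
    then show ?case using Emono by blast
  next
    case (Suc k)
    show ?case
    proof (cases "k * a \<le> n j")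
      case True
      then obtain e u where eu: "e \<in> E k n" "u \<in> A (dn k n)" "v = e \<oplus>\<^bsub>M\<^esub> pw k u"
        using Suc.prems by (auto simp: ES X_def elim!: sub_sum_E)
      have c: "e \<in> carrier M" "u \<in> carrier M" using eu submodsD(1)[OF Es] AM by auto
      then have "x \<odot>\<^bsub>M\<^esub> v = x \<odot>\<^bsub>M\<^esub> e \<oplus>\<^bsub>M\<^esub> pw (Suc k) u"
        using x eu by (simp add: smult_r_distr pw_Suc pw_closed)
      moreover have "pw (Suc k) u \<in> X (Suc k) (bump j a n)" using eu by (auto simp: X_def dn3)
      moreover have "Suc k * a \<le> bump j a n j" using True by simp
      ultimately show ?thesis using Suc.IH[OF eu(1)] by (subst ES) (auto intro!: sub_sum_I)
    next
      case False
      then show ?thesis using Suc.prems Suc.IH[of v] Emono by (auto simp: ES[of k n])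
    qed
  qed
  have Ey: "(y, b, i) \<in> S \<Longrightarrow> v \<in> E k n \<Longrightarrow> y \<odot>\<^bsub>M\<^esub> v \<in> E k (bump i b n)" for k n v y b i
  proof (induction k arbitrary: v)
    case 0
    then show ?case using BD(4)[of y b i v n] by (simp add: E0)
  next
    case (Suc k)
    show ?case
    proof (cases "k * a \<le> n j")
      case True
      then obtain e u where eu: "e \<in> E k n" "u \<in> A (dn k n)" "v = e \<oplus>\<^bsub>M\<^esub> pw k u"
        using Suc.prems by (auto simp: ES X_def elim!: sub_sum_E)
      have c: "e \<in> carrier M" "u \<in> carrier M" "y \<in> carrier R" using eu submodsD(1)[OF Es] AM S Suc.prems by auto
      then have "y \<odot>\<^bsub>M\<^esub> v = y \<odot>\<^bsub>M\<^esub> e \<oplus>\<^bsub>M\<^esub> pw k (y \<odot>\<^bsub>M\<^esub> u)"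
        using eu by (simp add: smult_r_distr pw_closed pw_smult)
      moreover have "y \<odot>\<^bsub>M\<^esub> u \<in> A (bump i b (dn k n))" by (rule AD(4)[OF Suc.prems(1) eu(2)])
      then have "pw k (y \<odot>\<^bsub>M\<^esub> u) \<in> X k (bump i b n)" using True by (auto simp: X_def dn4)
      moreover have "k * a \<le> bump i b n j" using True bump_ge[of n j i b] by linarith
      ultimately show ?thesis using Suc.IH[OF Suc.prems(1) eu(1)] by (subst ES) (auto intro!: sub_sum_I)
    next
      case False
      then show ?thesis using Suc.prems Suc.IH[of v] Emono by (auto simp: ES[of k n])
    qed
  qed
  define T where "T n = (\<Union>k. E k n)" for n
  have T: "T \<in> fam R M ?S B T"
  proof (rule famI)
    fix n
    show "T n \<in> submods R M"
    proof (rule submodsI)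
      show "u \<oplus>\<^bsub>M\<^esub> v \<in> T n" if "u \<in> T n" "v \<in> T n" for u v
      proof -
        obtain k k' where "u \<in> E k n" "v \<in> E k' n" using \<open>u \<in> T n\<close> \<open>v \<in> T n\<close> by (auto simp: T_def)
        then have "u \<in> E (max k k') n" "v \<in> E (max k k') n"
          using Emono'[of k "max k k'" n] Emono'[of k' "max k k'" n] by auto
        then show ?thesis unfolding T_def using submodsD(3)[OF Es] by blast
      qed
      show "b \<odot>\<^bsub>M\<^esub> u \<in> T n" if "b \<in> carrier R" "u \<in> T n" for b u
        using that submodsD(4)[OF Es] unfolding T_def by blast
    qed (use submodsD(1,2)[OF Es] in \<open>auto simp: T_def\<close>)
    show "B n \<subseteq> T n" unfolding T_def using E0 by (metis UNIV_I UN_upper)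
  next
    fix y b i n v assume "(y, b, i) \<in> ?S" "v \<in> T n"
    then obtain k where "v \<in> E k n" by (auto simp: T_def)
    then have "y \<odot>\<^bsub>M\<^esub> v \<in> E k (bump i b n) \<or> y \<odot>\<^bsub>M\<^esub> v \<in> E (Suc k) (bump i b n)"
      using Ex[of v k n] Ey[of y b i v k n] \<open>(y, b, i) \<in> ?S\<close> by auto
    then show "y \<odot>\<^bsub>M\<^esub> v \<in> T (bump i b n)" unfolding T_def by blast
  qed auto
  have AT: "A n \<subseteq> T n" for n
  proof
    fix v assume v: "v \<in> A n"
    then have "v \<in> X 0 n" using pw_0[OF AM[OF v]] by (force simp: X_def dn_def)
    then have "v \<in> E (Suc 0) n" using sub_sum_ub2[OF Es[of 0] Xs] by (auto simp: ES)
    then show "v \<in> T n" unfolding T_def by blast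
  qed
  \<comment> \<open>Leading coefficients: those \<open>v\<close> for which \<open>x^k v\<close> lies
    in \<open>C\<close> up to terms of lower degree in \<open>x\<close>. Multiplication by
    \<open>x\<close> shows that they increase with \<open>k\<close>, so \<open>L C\<close> is a
    monotone sequence as in \<open>acc_mono_seq\<close>.\<close>
  define L where "L C k n = {v \<in> A n. pw k v \<in> sub_sum M (C (bump j (k * a) n)) (E k (bump j (k * a) n))}" for C k n
  have "acc (fam R M ?S B T)"
  proof (rule acc_map[OF acc_mono_seq[OF acc], where \<phi> = L])
    fix C assume C: "C \<in> fam R M ?S B T"
    note CD = famD[OF C]
    have "L C k \<in> fam R M S B A" for k
    proof (rule famI)
      fix n
      show "L C k n \<in> submods R M" unfolding L_def
        by (rule module_hom.preimage_submods[OF pw_hom AD(1) sub_sum_submods[OF CD(1) Es]])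
      show "B n \<subseteq> L C k n"
      proof
        fix v assume v: "v \<in> B n"
        have "pw k v \<in> B (bump j (k * a) n)"
        proof (induction k)
          case 0
          then show ?case using v pw_0 submodsD(1)[OF BD(1)] by simp
        next
          case (Suc k)
          then show ?case using BD(4)[of x a j "pw k v" "bump j (k * a) n"] v submodsD(1)[OF BD(1)]
            by (simp add: pw_Suc)
        qed
        then have "pw k v \<in> sub_sum M (C (bump j (k * a) n)) (E k (bump j (k * a) n))"
          using CD(2) sub_sum_ub1[OF CD(1) Es] by blast
        then show "v \<in> L C k n" using v BD(3) by (auto simp: L_def)
      qed
      show "L C k n \<subseteq> A n" by (auto simp: L_def)
    next
      fix y b i n v assume y: "(y, b, i) \<in> S" "v \<in> L C k n"
      then obtain c e where ce: "c \<in> C (bump j (k * a) n)" "e \<in> E k (bump j (k * a) n)" "pw k v = c \<oplus>\<^bsub>M\<^esub> e" "v \<in> A n"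
        by (auto simp: L_def elim!: sub_sum_E)
      have m: "c \<in> carrier M" "e \<in> carrier M" "v \<in> carrier M" "y \<in> carrier R"
        using ce submodsD(1)[OF CD(1)] submodsD(1)[OF Es] AM S y by auto
      then have "pw k (y \<odot>\<^bsub>M\<^esub> v) = y \<odot>\<^bsub>M\<^esub> c \<oplus>\<^bsub>M\<^esub> y \<odot>\<^bsub>M\<^esub> e"
        by (simp add: pw_smult ce smult_r_distr)
      moreover have "y \<odot>\<^bsub>M\<^esub> c \<in> C (bump j (k * a) (bump i b n))"
        using CD(4)[of y b i c "bump j (k * a) n"] y(1) ce(1) by (simp add: bump_commute)
      moreover have "y \<odot>\<^bsub>M\<^esub> e \<in> E k (bump j (k * a) (bump i b n))"
        using Ey[OF y(1) ce(2)] by (simp add: bump_commute)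
      ultimately show "y \<odot>\<^bsub>M\<^esub> v \<in> L C k (bump i b n)"
        unfolding L_def using AD(4)[OF y(1) ce(4)] by (auto intro!: sub_sum_I)
    qed
    moreover have "L C k \<le> L C (Suc k)" for k
    proof (rule le_funI, rule subsetI)
      fix n v assume "v \<in> L C k n"
      then obtain c e where ce: "c \<in> C (bump j (k * a) n)" "e \<in> E k (bump j (k * a) n)" "pw k v = c \<oplus>\<^bsub>M\<^esub> e" "v \<in> A n"
        by (auto simp: L_def elim!: sub_sum_E)
      have m: "c \<in> carrier M" "e \<in> carrier M" "v \<in> carrier M"
        using ce submodsD(1)[OF CD(1)] submodsD(1)[OF Es] AM by auto
      then have "pw (Suc k) v = x \<odot>\<^bsub>M\<^esub> c \<oplus>\<^bsub>M\<^esub> x \<odot>\<^bsub>M\<^esub> e"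
        using x by (simp add: pw_Suc ce smult_r_distr)
      moreover have "x \<odot>\<^bsub>M\<^esub> c \<in> C (bump j (Suc k * a) n)" using CD(4)[of x a j c "bump j (k * a) n"] ce(1) by simp
      moreover have "x \<odot>\<^bsub>M\<^esub> e \<in> E (Suc k) (bump j (Suc k * a) n)" using Ex[OF ce(2)] by simp
      ultimately show "v \<in> L C (Suc k) n"
        unfolding L_def using ce(4) by (auto intro!: sub_sum_I)
    qed
    ultimately show "L C \<in> {F. \<forall>k. F k \<in> fam R M S B A \<and> F k \<le> F (Suc k)}" by auto
  next
    fix C C' :: "('r \<Rightarrow> nat) \<Rightarrow> 'c set" assume "C \<le> C'"
    then have "sub_sum M (C n) (E k n) \<subseteq> sub_sum M (C' n) (E k n)" for n k
      by (intro sub_sum_mono) (auto simp: le_fun_def)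
    then show "L C \<le> L C'" unfolding L_def le_fun_def by blast
  next
    fix C C' assume C: "C \<in> fam R M ?S B T" "C' \<in> fam R M ?S B T" "C \<le> C'" "L C = L C'"
    note CD = famD[OF C(1)] and CD' = famD[OF C(2)]
    have CC: "C n \<subseteq> C' n" for n using C(3) by (auto simp: le_fun_def)
    \<comment> \<open>Induction on the degree in \<open>x\<close>. An element of \<open>C'\<close>
      with leading coefficient \<open>u\<close> is diminished by an element \<open>c\<close> of
      \<open>C\<close> with the same leading coefficient; the rest lies in \<open>C'\<close> and has
      lower degree.\<close>
    have "C' n \<inter> E k n \<subseteq> C n" for k n
    proof (induction k)
      case 0
      then show ?case using CD(2) by (auto simp: E0)
    next
      case (Suc k)
      show ?case
      proof (cases "k * a \<le> n j")
        case True
        show ?thesis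
        proof
          fix c' assume c': "c' \<in> C' n \<inter> E (Suc k) n"
          then obtain e u where eu: "e \<in> E k n" "u \<in> A (dn k n)" "c' = e \<oplus>\<^bsub>M\<^esub> pw k u"
            using True by (auto simp: ES X_def elim!: sub_sum_E)
          have m: "e \<in> carrier M" "u \<in> carrier M" "c' \<in> carrier M" "pw k u \<in> carrier M"
            using eu submodsD(1)[OF Es] AM c' submodsD(1)[OF CD'(1)] pw_closed by auto
          have "pw k u = c' \<oplus>\<^bsub>M\<^esub> \<ominus>\<^bsub>M\<^esub> e" using m eu(3) by (simp add: M.minus_eq[symmetric])
          then have "pw k u \<in> sub_sum M (C' n) (E k n)"
            using c' submodsD(5)[OF Es eu(1)] by (auto intro!: sub_sum_I)
          then have "u \<in> L C' k (dn k n)" using eu(2) dn1[of k n, OF True] by (auto simp: L_def)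
          then have "u \<in> L C k (dn k n)" by (simp add: C(4))
          then obtain c e' where ce: "c \<in> C n" "e' \<in> E k n" "pw k u = c \<oplus>\<^bsub>M\<^esub> e'"
            using dn1[of k n, OF True] by (auto simp: L_def elim!: sub_sum_E)
          have m': "c \<in> carrier M" "e' \<in> carrier M" using ce submodsD(1)[OF Es] submodsD(1)[OF CD(1)] by auto
          have "c' = (e \<oplus>\<^bsub>M\<^esub> e') \<oplus>\<^bsub>M\<^esub> c" using m m' eu(3) ce(3) by (simp add: M.a_ac)
          moreover have "e \<oplus>\<^bsub>M\<^esub> e' \<in> C' n"
            by (rule submods_add_cancel[OF CD'(1) _ subsetD[OF CC ce(1)]])
               (use m m' c' calculation in auto)
          then have "e \<oplus>\<^bsub>M\<^esub> e' \<in> C n" using Suc.IH submodsD(3)[OF Es eu(1) ce(2)] by auto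
          ultimately show "c' \<in> C n" using ce(1) submodsD(3)[OF CD(1)] by auto
        qed
      next
        case False
        then show ?thesis using Suc.IH by (simp add: ES)
      qed
    qed
    then have "C' n \<subseteq> C n" for n using CD'(3)[of n] unfolding T_def by blast
    then show "C = C'" using CC by (intro ext) blast
  qed
  then show ?thesis using T AT by blast
qed

text \<open>The start is the family equal to \<open>A\<close> in degree zero and to \<open>B\<close>
  elsewhere, whose members are determined by their part in degree zero; the elements of
  \<open>S\<close> are then adjoined one at a time. Beyond the chain condition and closure under
  \<open>S\<close>, only \<open>A \<subseteq> T\<close> in degree zero is recorded, which suffices
  to force all products of elements of \<open>S\<close> applied to \<open>A\<close> into
  \<open>T\<close>.\<close>

lemma acc_fam_exists:
  fixes S :: "('a \<times> nat \<times> 'r) set"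
  assumes "finite S" "\<And>x a j. (x, a, j) \<in> S \<Longrightarrow> x \<in> carrier R"
    and acc: "acc (submods R M)" and A: "A \<in> submods R M" and B: "B \<in> submods R M" and BA: "B \<subseteq> A"
  shows "\<exists>T. T \<in> fam R M S (\<lambda>_. B) T \<and> A \<subseteq> T (\<lambda>_. 0) \<and> acc (fam R M S (\<lambda>_. B) T)"
  using assms(1,2)
proof (induction S)
  case empty
  define T :: "('r \<Rightarrow> nat) \<Rightarrow> 'c set" where "T = (\<lambda>n. if n = (\<lambda>_. 0) then A else B)"
  have "T \<in> fam R M {} (\<lambda>_. B) T" by (rule famI) (use A B BA in \<open>auto simp: T_def\<close>)
  moreover have "acc (fam R M {} (\<lambda>_. B) T)"
  proof (rule acc_map[OF acc, where \<phi> = "\<lambda>C. C (\<lambda>_. 0)"])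
    fix X Y :: "('r \<Rightarrow> nat) \<Rightarrow> 'c set"
    assume XY: "X \<in> fam R M {} (\<lambda>_. B) T" "Y \<in> fam R M {} (\<lambda>_. B) T" "X (\<lambda>_. 0) = Y (\<lambda>_. 0)"
    have "X n = Y n" for n
      using XY(3) famD(2,3)[OF XY(1), of n] famD(2,3)[OF XY(2), of n] by (cases "n = (\<lambda>_. 0)") (auto simp: T_def)
    then show "X = Y" by blast
  qed (auto simp: fam_def le_fun_def)
  ultimately show ?case by (auto simp: T_def)
next
  case (insert s S)
  obtain x a j where s: "s = (x, a, j)" by (metis prod_cases3)
  obtain T where T: "T \<in> fam R M S (\<lambda>_. B) T" "A \<subseteq> T (\<lambda>_. 0)" "acc (fam R M S (\<lambda>_. B) T)"
    using insert by blast
  have x: "x \<in> carrier R" using insert.prems s by blast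
  have B: "(\<lambda>_. B) \<in> fam R M (insert (x, a, j) S) (\<lambda>_. B) T"
    using B famD(2)[OF T(1)] insert.prems s submodsD(4)[OF B] by (intro famI) auto
  obtain T' where "T' \<in> fam R M (insert (x, a, j) S) (\<lambda>_. B) T'" "\<forall>n. T n \<subseteq> T' n"
      "acc (fam R M (insert (x, a, j) S) (\<lambda>_. B) T')"
    using acc_fam_insert[OF x _ T(1) B T(3)] insert.prems by blast
  then show ?case using T(2) s by blast
qed

end

section \<open>Eventually quasi polynomial functions\<close>

definition ev :: "(('r \<Rightarrow> nat) \<Rightarrow> bool) \<Rightarrow> bool" where
  "ev P \<longleftrightarrow> (\<exists>c. \<forall>n. (\<forall>j. c \<le> n j) \<longrightarrow> P n)"

lemma ev_I: "(\<And>n. (\<And>j. c \<le> n j) \<Longrightarrow> P n) \<Longrightarrow> ev P"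
  unfolding ev_def by blast

lemma ev_all: "(\<And>n. P n) \<Longrightarrow> ev P"
  unfolding ev_def by blast

lemma ev_conj: "ev P \<Longrightarrow> ev Q \<Longrightarrow> ev (\<lambda>n. P n \<and> Q n)"
  unfolding ev_def by (metis max.bounded_iff)

lemma ev_mono: "ev P \<Longrightarrow> (\<And>n. P n \<Longrightarrow> Q n) \<Longrightarrow> ev Q"
  unfolding ev_def by blast

lemma ev_bump: "ev P \<Longrightarrow> ev (\<lambda>n. P (bump j a n))"
  unfolding ev_def using bump_ge le_trans by metis

lemma ev_all_index:
  fixes P :: "'j::finite \<Rightarrow> ('r \<Rightarrow> nat) \<Rightarrow> bool"
  assumes "\<And>j. ev (P j)" shows "ev (\<lambda>n. \<forall>j. P j n)"
proof -
  obtain c where c: "\<And>j n. (\<forall>i. c j \<le> n i) \<Longrightarrow> P j n" using assms unfolding ev_def by metis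
  show ?thesis
  proof (rule ev_I[where c = "Max (range c)"])
    fix n :: "'r \<Rightarrow> nat" assume n: "\<And>i. Max (range c) \<le> n i"
    have "c j \<le> n i" for i j using n[of i] Max_ge[of "range c" "c j"] by simp
    then show "\<forall>j. P j n" using c by blast
  qed
qed

definition diff_dir :: "nat \<Rightarrow> 'r \<Rightarrow> (('r \<Rightarrow> nat) \<Rightarrow> rat) \<Rightarrow> ('r \<Rightarrow> nat) \<Rightarrow> rat" where
  "diff_dir a j f n = f (bump j a n) - f n"

text \<open>Quasi polynomials of degree less than \<open>D\<close> and period \<open>\<alpha>\<close>, encoded through their iterated differences:
  this makes sums and shifts trivial and leaves the explicit coefficients to a single interpolation.\<close>

primrec qp :: "nat \<Rightarrow> nat \<Rightarrow> (('r \<Rightarrow> nat) \<Rightarrow> rat) \<Rightarrow> bool" where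
  "qp 0 \<alpha> f \<longleftrightarrow> ev (\<lambda>n. f n = 0)"
| "qp (Suc D) \<alpha> f \<longleftrightarrow> (\<forall>j. qp D \<alpha> (diff_dir \<alpha> j f))"

lemma qp_add: "qp D \<alpha> f \<Longrightarrow> qp D \<alpha> g \<Longrightarrow> qp D \<alpha> (\<lambda>n. f n + g n)"
proof (induction D arbitrary: f g)
  case 0
  then have "ev (\<lambda>n. f n = 0 \<and> g n = 0)" by (auto intro: ev_conj)
  then show ?case by (auto elim: ev_mono)
next
  case (Suc D)
  have "diff_dir \<alpha> j (\<lambda>n. f n + g n) = (\<lambda>n. diff_dir \<alpha> j f n + diff_dir \<alpha> j g n)" for j
    by (auto simp: diff_dir_def)
  then show ?case using Suc by simp
qed

lemma qp_minus: "qp D \<alpha> f \<Longrightarrow> qp D \<alpha> (\<lambda>n. - f n)"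
proof (induction D arbitrary: f)
  case (Suc D)
  have "diff_dir \<alpha> j (\<lambda>n. - f n) = (\<lambda>n. - diff_dir \<alpha> j f n)" for j
    by (auto simp: diff_dir_def)
  then show ?case using Suc by simp
qed auto

lemma qp_diff: "qp D \<alpha> f \<Longrightarrow> qp D \<alpha> g \<Longrightarrow> qp D \<alpha> (\<lambda>n. f n - g n)"
  using qp_add[OF _ qp_minus, of D \<alpha> f g] by simp

lemma qp_zero: "qp D \<alpha> (\<lambda>_. 0)"
  by (induction D) (auto simp: diff_dir_def[abs_def] intro: ev_all)

lemma qp_Suc: "qp D \<alpha> f \<Longrightarrow> qp (Suc D) \<alpha> f"
proof (induction D arbitrary: f)
  case 0
  then have "ev (\<lambda>n. diff_dir \<alpha> j f n = 0)" for j
    using ev_conj[OF _ ev_bump[of "\<lambda>n. f n = 0" j \<alpha>], of "\<lambda>n. f n = 0"] by (auto simp: diff_dir_def elim: ev_mono)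
  then show ?case by simp
qed simp

lemma qp_mono: "D \<le> D' \<Longrightarrow> qp D \<alpha> f \<Longrightarrow> qp D' \<alpha> f"
  by (induction rule: dec_induct) (auto intro: qp_Suc simp del: qp.simps)

lemma qp_bump: "qp D \<alpha> f \<Longrightarrow> qp D \<alpha> (\<lambda>n. f (bump i b n))"
proof (induction D arbitrary: f)
  case (Suc D)
  have "diff_dir \<alpha> j (\<lambda>n. f (bump i b n)) = (\<lambda>n. diff_dir \<alpha> j f (bump i b n))" for j
    by (auto simp: diff_dir_def bump_commute)
  then show ?case using Suc by simp
qed (auto intro: ev_bump)

lemma qp_sum: "(\<And>i. i < (k::nat) \<Longrightarrow> qp D \<alpha> (f i)) \<Longrightarrow> qp D \<alpha> (\<lambda>n. \<Sum>i<k. f i n)"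
  by (induction k) (auto intro: qp_zero qp_add simp del: qp.simps)

lemma diff_dir_mult: "diff_dir (k * a) j f n = (\<Sum>i<k. diff_dir a j f (bump j (i * a) n))"
  by (induction k) (auto simp: diff_dir_def algebra_simps)

lemma qp_scale: "qp D \<alpha> f \<Longrightarrow> qp D (k * \<alpha>) f"
proof (induction D arbitrary: f)
  case (Suc D)
  have "qp D (k * \<alpha>) (diff_dir (k * \<alpha>) j f)" for j
    unfolding diff_dir_mult[abs_def] using Suc by (intro qp_sum qp_bump) simp
  then show ?case by simp
qed auto

text \<open>Steps of different lengths in different directions are brought to one period by
  telescoping: a difference with step \<open>k a\<close> is a sum of \<open>k\<close> shifted
  differences with step \<open>a\<close>.\<close>

lemma qp_from_steps:
  assumes "\<And>j. \<exists>a. a dvd \<alpha> \<and> qp D \<alpha> (diff_dir a j f)" shows "qp (Suc D) \<alpha> f"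
proof -
  have "qp D \<alpha> (diff_dir \<alpha> j f)" for j
  proof -
    obtain a k where a: "\<alpha> = k * a" "qp D \<alpha> (diff_dir a j f)" using assms[of j] by (metis dvd_def mult.commute)
    have "qp D \<alpha> (diff_dir (k * a) j f)"
      unfolding diff_dir_mult[abs_def] by (intro qp_sum qp_bump a(2))
    then show ?thesis by (simp add: a(1)[symmetric])
  qed
  then show ?thesis by simp
qed

subsection \<open>Interpolation\<close>

definition fdiff :: "(nat \<Rightarrow> rat) \<Rightarrow> nat \<Rightarrow> rat" where
  "fdiff u x = u (Suc x) - u x"

text \<open>Newton's forward difference formula: the induction hypothesis expands
  \<open>fdiff u\<close>, and summing a binomial coefficient over its upper index raises the lower
  index by one.\<close>

lemma newton_forward:
  "(\<And>x. (fdiff ^^ D) u x = 0) \<Longrightarrow> u x = (\<Sum>k<D. of_nat (x choose k) * (fdiff ^^ k) u 0)"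
proof (induction D arbitrary: u x)
  case (Suc D)
  have IH: "fdiff u y = (\<Sum>k<D. of_nat (y choose k) * (fdiff ^^ k) (fdiff u) 0)" for y
    using Suc.prems by (intro Suc.IH) (simp add: funpow_Suc_right del: funpow.simps)
  have ch: "(\<Sum>y<x. of_nat (y choose k)) = (of_nat (x choose Suc k) :: rat)" for k x
    by (induction x) auto
  have "u x = u 0 + (\<Sum>y<x. fdiff u y)"
    by (induction x) (auto simp: fdiff_def)
  also have "(\<Sum>y<x. fdiff u y) = (\<Sum>k<D. (\<Sum>y<x. of_nat (y choose k)) * (fdiff ^^ k) (fdiff u) 0)"
    by (subst sum_distrib_right, subst sum.swap) (simp add: IH[symmetric])
  also have "\<dots> = (\<Sum>k<D. of_nat (x choose Suc k) * (fdiff ^^ Suc k) u 0)"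
    by (simp add: ch funpow_Suc_right del: funpow.simps)
  finally show ?case by (simp add: sum.lessThan_Suc_shift del: sum.lessThan_Suc)
qed simp

text \<open>The order of the quantifiers matters: the coefficients must be the same for all
  \<open>u\<close>, because later \<open>u\<close> ranges over the restrictions of one function to
  all lines in a coordinate direction.\<close>

lemma fdiff_pow_expand: "\<exists>d. \<forall>u. (fdiff ^^ k) u 0 = (\<Sum>l\<le>k. d l * u l)"
proof -
  have "\<exists>d. \<forall>u x. (fdiff ^^ k) u x = (\<Sum>l\<le>k. d l * u (x + l))"
  proof (induction k)
    case 0
    show ?case by (auto intro!: exI[of _ "\<lambda>_. 1"])
  next
    case (Suc k)
    then obtain d where d: "\<And>u x. (fdiff ^^ k) u x = (\<Sum>l\<le>k. d l * u (x + l))" by blast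
    define e where "e l = (if l = 0 then 0 else d (l - 1)) - (if l = Suc k then 0 else d l)" for l
    have "(fdiff ^^ Suc k) u x = (\<Sum>l\<le>Suc k. e l * u (x + l))" for u x
    proof -
      have "(\<Sum>l\<le>Suc k. e l * u (x + l)) = (\<Sum>l\<le>Suc k. (if l = 0 then 0 else d (l - 1)) * u (x + l))
            - (\<Sum>l\<le>Suc k. (if l = Suc k then 0 else d l) * u (x + l))"
        by (simp add: e_def left_diff_distrib sum_subtractf)
      also have "(\<Sum>l\<le>Suc k. (if l = 0 then 0 else d (l - 1)) * u (x + l)) = (\<Sum>l\<le>k. d l * u (Suc x + l))"
        by (subst sum.atMost_Suc_shift) simp
      also have "(\<Sum>l\<le>Suc k. (if l = Suc k then 0 else d l) * u (x + l)) = (\<Sum>l\<le>k. d l * u (x + l))"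
        by simp
      finally show ?thesis by (simp add: fdiff_def d)
    qed
    then show ?case by blast
  qed
  then obtain d where "\<And>u x. (fdiff ^^ k) u x = (\<Sum>l\<le>k. d l * u (x + l))" by blast
  then have "\<forall>u. (fdiff ^^ k) u 0 = (\<Sum>l\<le>k. d l * u l)" by simp
  then show ?thesis by blast
qed

text \<open>The interpolation weight as a polynomial in \<open>n = b + \<alpha> x\<close> instead of \<open>x\<close>.\<close>

lemma choose_polynomial:
  assumes "\<alpha> > 0"
  shows "\<exists>c. \<forall>x. of_nat (x choose k) = (\<Sum>i\<le>k. c i * (of_nat (b + \<alpha> * x) :: rat) ^ i)"
proof (induction k)
  case 0
  show ?case by (auto intro!: exI[of _ "\<lambda>_. 1"])
next
  case (Suc k)
  then obtain c where c: "\<And>x. of_nat (x choose k) = (\<Sum>i\<le>k. c i * (of_nat (b + \<alpha> * x) :: rat) ^ i)" by blast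
  \<comment> \<open>With \<open>n = b + \<alpha> x\<close> one has
    \<open>n - q = \<alpha> (x - k)\<close>, so the recursion
    \<open>(k+1) binom(x, k+1) = (x - k) binom(x, k)\<close> becomes multiplication by
    \<open>(n - q) r\<close>.\<close>
  define q :: rat where "q = of_nat b + of_nat \<alpha> * of_nat k"
  define r :: rat where "r = 1 / (of_nat \<alpha> * of_nat (Suc k))"
  define e where "e i = ((if i = 0 then 0 else c (i - 1)) - (if i = Suc k then 0 else q * c i)) * r" for i
  have "of_nat (x choose Suc k) = (\<Sum>i\<le>Suc k. e i * (of_nat (b + \<alpha> * x) :: rat) ^ i)" for x
  proof -
    let ?n = "of_nat (b + \<alpha> * x) :: rat"
    have "Suc k * (x choose Suc k) + k * (x choose k) = x * (x choose k)"
    proof (cases "k \<le> x")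
      case True
      have "Suc k * (x choose Suc k) = (x - k) * (x choose k)"
        by (metis Suc_times_binomial_eq add_diff_cancel_left' binomial_absorption binomial_absorb_comp mult.commute)
      then show ?thesis using True by (simp add: diff_mult_distrib)
    qed (simp add: binomial_eq_0)
    then have "of_nat (Suc k) * of_nat (x choose Suc k) + of_nat k * of_nat (x choose k) = (of_nat x * of_nat (x choose k) :: rat)"
      by (metis of_nat_add of_nat_mult)
    then have "of_nat (Suc k) * of_nat (x choose Suc k) = ((of_nat x - of_nat k) * of_nat (x choose k) :: rat)"
      by (simp add: algebra_simps)
    moreover have "?n - q = of_nat \<alpha> * (of_nat x - of_nat k)" by (simp add: q_def algebra_simps)
    ultimately have "(?n - q) * of_nat (x choose k) * r = of_nat \<alpha> * (of_nat (Suc k) * of_nat (x choose Suc k)) * r"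
      by (simp only: mult.assoc)
    also have "\<dots> = of_nat (x choose Suc k)" using assms by (simp add: r_def del: of_nat_Suc)
    finally have "of_nat (x choose Suc k) = (?n - q) * of_nat (x choose k) * r" by (rule sym)
    also have "(?n - q) * of_nat (x choose k) = (\<Sum>i\<le>k. c i * ?n ^ Suc i) - (\<Sum>i\<le>k. q * c i * ?n ^ i)"
      by (simp only: c sum_subtractf[symmetric] sum_distrib_left)
         (simp only: left_diff_distrib right_diff_distrib power_Suc mult_ac)
    also have "(\<Sum>i\<le>k. c i * ?n ^ Suc i) = (\<Sum>i\<le>Suc k. (if i = 0 then 0 else c (i - 1)) * ?n ^ i)"
      by (subst sum.atMost_Suc_shift) simp
    also have "(\<Sum>i\<le>k. q * c i * ?n ^ i) = (\<Sum>i\<le>Suc k. (if i = Suc k then 0 else q * c i) * ?n ^ i)"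
      by simp
    also have "((\<Sum>i\<le>Suc k. (if i = 0 then 0 else c (i - 1)) * ?n ^ i) - \<dots>) * r = (\<Sum>i\<le>Suc k. e i * ?n ^ i)"
      by (simp only: e_def sum_subtractf[symmetric] sum_distrib_right) (simp only: left_diff_distrib right_diff_distrib mult_ac)
    finally show ?thesis .
  qed
  then show ?case by blast
qed

text \<open>Lagrange weights for the nodes \<open>b, b + \<alpha>, ..., b + (D-1) \<alpha>\<close>,
  written as polynomials in the point of evaluation. One choice of \<open>V\<close> serves all
  \<open>u\<close>; it depends on \<open>b\<close>, \<open>\<alpha>\<close> and \<open>D\<close>
  only.\<close>

lemma interpolation_weights:
  assumes "\<alpha> > 0"
  shows "\<exists>V. \<forall>u. (\<forall>x. (fdiff ^^ D) u x = 0) \<longrightarrow>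
     (\<forall>x. u x = (\<Sum>l<D. (\<Sum>i<D. V l i * (of_nat (b + \<alpha> * x) :: rat) ^ i) * u l))"
proof -
  have "\<forall>k. \<exists>c. \<forall>x. of_nat (x choose k) = (\<Sum>i\<le>k. c i * (of_nat (b + \<alpha> * x) :: rat) ^ i)"
    using choose_polynomial[OF assms] by blast
  from choice[OF this] obtain c where
    c: "\<And>k x. of_nat (x choose k) = (\<Sum>i\<le>k. c k i * (of_nat (b + \<alpha> * x) :: rat) ^ i)" by blast
  have "\<forall>k. \<exists>d. \<forall>u. (fdiff ^^ k) u 0 = (\<Sum>l\<le>k. d l * u l)" using fdiff_pow_expand by blast
  from choice[OF this] obtain d where d: "\<And>k u. (fdiff ^^ k) u 0 = (\<Sum>l\<le>k. d k l * u l)" by blast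
  define V where "V l i = (\<Sum>k<D. if i \<le> k \<and> l \<le> k then c k i * d k l else 0)" for l i
  have "u x = (\<Sum>l<D. (\<Sum>i<D. V l i * (of_nat (b + \<alpha> * x) :: rat) ^ i) * u l)"
    if u: "\<forall>x. (fdiff ^^ D) u x = 0" for u x
  proof -
    let ?n = "of_nat (b + \<alpha> * x) :: rat"
    have restr: "(\<Sum>l\<le>k. F l) = (\<Sum>l<D. if l \<le> k then F l else 0)" if "k < D" for k and F :: "nat \<Rightarrow> rat"
      using that by (subst sum.inter_filter[symmetric]) (auto intro!: sum.cong)
    have "u x = (\<Sum>k<D. (\<Sum>i\<le>k. c k i * ?n ^ i) * (\<Sum>l\<le>k. d k l * u l))"
      using newton_forward[of D u x] u by (simp add: c d)
    also have "\<dots> = (\<Sum>k<D. (\<Sum>i<D. if i \<le> k then c k i * ?n ^ i else 0) * (\<Sum>l<D. if l \<le> k then d k l * u l else 0))"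
      by (intro sum.cong refl) (simp add: restr del: of_nat_add of_nat_mult)
    also have "\<dots> = (\<Sum>k<D. \<Sum>l<D. \<Sum>i<D. (if i \<le> k \<and> l \<le> k then c k i * d k l else 0) * ?n ^ i * u l)"
      by (subst sum_product, subst sum.swap) (auto intro!: sum.cong)
    also have "\<dots> = (\<Sum>l<D. \<Sum>i<D. \<Sum>k<D. (if i \<le> k \<and> l \<le> k then c k i * d k l else 0) * ?n ^ i * u l)"
      by (subst sum.swap, rule sum.cong[OF refl], rule sum.swap)
    also have "\<dots> = (\<Sum>l<D. (\<Sum>i<D. V l i * ?n ^ i) * u l)"
      by (simp add: V_def sum_distrib_right)
    finally show ?thesis .
  qed
  then show ?thesis by blast
qed

lemma sum_PiE_insert:
  assumes "finite J" "j \<notin> J"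
  shows "sum h (PiE (insert j J) (\<lambda>_. B)) = (\<Sum>y\<in>B. \<Sum>g\<in>PiE J (\<lambda>_. B). h (g(j := y)))"
  unfolding PiE_insert_eq using inj_combinator[OF assms(2), of "\<lambda>_. B"]
  by (subst sum.reindex) (auto simp: sum.cartesian_product case_prod_unfold)

text \<open>Tensor product interpolation: coordinates are replaced by nodes one after the other,
  those in \<open>J\<close> being done. The condition \<open>c \<le> pt x l\<close> keeps the
  intermediate points where the formula in one variable is valid.\<close>

lemma interpolation_multi:
  fixes h :: "('r::finite \<Rightarrow> nat) \<Rightarrow> rat" and w :: "nat \<Rightarrow> nat \<Rightarrow> rat"
  assumes "\<And>j m. (\<And>i. c \<le> m i) \<Longrightarrow> h m = (\<Sum>l<D. w l (m j) * h (m(j := pt (m j) l)))"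
    and "\<And>x l. c \<le> x \<Longrightarrow> c \<le> pt x l" and m: "\<And>i. c \<le> m i"
  shows "h m = (\<Sum>l\<in>PiE UNIV (\<lambda>_. {..<D}). (\<Prod>j\<in>UNIV. w (l j) (m j)) * h (\<lambda>j. pt (m j) (l j)))"
proof -
  have "finite J \<Longrightarrow> h m = (\<Sum>l\<in>PiE J (\<lambda>_. {..<D}). (\<Prod>j\<in>J. w (l j) (m j)) *
      h (\<lambda>j. if j \<in> J then pt (m j) (l j) else m j))" for J
  proof (induction J rule: finite_induct)
    case (insert j J)
    have "h m = (\<Sum>g\<in>PiE J (\<lambda>_. {..<D}). \<Sum>y<D. (\<Prod>j\<in>J. w (g j) (m j)) * (w y (m j) *
        h ((\<lambda>i. if i \<in> J then pt (m i) (g i) else m i)(j := pt (m j) y))))"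
      unfolding sum_distrib_left[symmetric] insert.IH
    proof (intro sum.cong refl arg_cong2[where f = "(*)"])
      fix g
      show "h (\<lambda>i. if i \<in> J then pt (m i) (g i) else m i) =
        (\<Sum>y<D. w y (m j) * h ((\<lambda>i. if i \<in> J then pt (m i) (g i) else m i)(j := pt (m j) y)))"
        using assms(1)[of "\<lambda>i. if i \<in> J then pt (m i) (g i) else m i" j] assms(2) m insert.hyps(2)
        by simp
    qed
    also have "\<dots> = (\<Sum>y<D. \<Sum>g\<in>PiE J (\<lambda>_. {..<D}). (\<Prod>j\<in>J. w (g j) (m j)) * (w y (m j) *
        h ((\<lambda>i. if i \<in> J then pt (m i) (g i) else m i)(j := pt (m j) y))))"
      by (rule sum.swap)
    also have "\<dots> = (\<Sum>l\<in>PiE (insert j J) (\<lambda>_. {..<D}). (\<Prod>j\<in>insert j J. w (l j) (m j)) *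
      h (\<lambda>i. if i \<in> insert j J then pt (m i) (l i) else m i))"
      unfolding sum_PiE_insert[OF insert.hyps]
    proof (intro sum.cong refl)
      fix y g
      have "(\<Prod>i\<in>insert j J. w ((g(j := y)) i) (m i)) = w y (m j) * (\<Prod>i\<in>J. w (g i) (m i))"
        using insert.hyps by (simp, intro disjI2 prod.cong) auto
      moreover have "(\<lambda>i. if i \<in> J then pt (m i) (g i) else m i)(j := pt (m j) y) =
          (\<lambda>i. if i \<in> insert j J then pt (m i) ((g(j := y)) i) else m i)"
        using insert.hyps by auto
      ultimately show "(\<Prod>j\<in>J. w (g j) (m j)) * (w y (m j) *
          h ((\<lambda>i. if i \<in> J then pt (m i) (g i) else m i)(j := pt (m j) y))) =
        (\<Prod>i\<in>insert j J. w ((g(j := y)) i) (m i)) *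
          h (\<lambda>i. if i \<in> insert j J then pt (m i) ((g(j := y)) i) else m i)"
        by (simp only: mult_ac)
    qed
    finally show ?case .
  qed simp
  from this[of UNIV] show ?thesis by simp
qed

definition box :: "nat \<Rightarrow> ('r \<Rightarrow> nat) set" where
  "box D = {i. \<forall>j. i j < D}"

lemma box_eq: "box D = PiE UNIV (\<lambda>_. {..<D})"
  by (auto simp: box_def)

lemma finite_box [simp]: "finite (box D :: ('r::finite \<Rightarrow> nat) set)"
  unfolding box_eq by (rule finite_PiE) auto

lemma qp_iterated:
  assumes "qp D \<alpha> f" shows "ev (\<lambda>n. (diff_dir \<alpha> j ^^ D) f n = 0)"
  using assms
proof (induction D arbitrary: f)
  case (Suc D)
  then have "ev (\<lambda>n. (diff_dir \<alpha> j ^^ D) (diff_dir \<alpha> j f) n = 0)" by simp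
  then show ?case by (simp add: funpow_Suc_right del: funpow.simps)
qed simp

lemma qp_imp_quasi_polynomial:
  fixes f :: "('r::finite \<Rightarrow> nat) \<Rightarrow> rat"
  assumes "qp D \<alpha> f" "\<alpha> > 0"
  shows "\<exists>\<sigma>. (\<forall>i n. i \<notin> box D \<longrightarrow> \<sigma> i n = 0) \<and> (\<forall>i n. \<sigma> i n = \<sigma> i (\<lambda>j. n j mod \<alpha>)) \<and>
     ev (\<lambda>n. f n = (\<Sum>i\<in>box D. \<sigma> i n * monomial_value i n))"
proof -
  have "ev (\<lambda>n. \<forall>j. (diff_dir \<alpha> j ^^ D) f n = 0)"
    by (rule ev_all_index) (rule qp_iterated[OF assms(1)])
  then obtain c0 where c0: "\<And>n j. (\<And>i. c0 \<le> n i) \<Longrightarrow> (diff_dir \<alpha> j ^^ D) f n = 0"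
    unfolding ev_def by blast
  \<comment> \<open>A multiple of \<open>\<alpha>\<close> that is at least \<open>c0\<close>: the
    base point \<open>b x\<close> is then congruent to \<open>x\<close>, depends only on the residue
    of \<open>x\<close>, and lies where the iterated differences vanish.\<close>
  define c where "c = \<alpha> * c0"
  have c: "c0 \<le> c" "c mod \<alpha> = 0" using assms(2) by (auto simp: c_def)
  define b where "b x = c + x mod \<alpha>" for x
  define pt where "pt x l = b x + \<alpha> * l" for x l
  have "\<forall>y. \<exists>V. \<forall>u. (\<forall>x. (fdiff ^^ D) u x = 0) \<longrightarrow>
     (\<forall>x. u x = (\<Sum>l<D. (\<Sum>i<D. V l i * (of_nat (y + \<alpha> * x) :: rat) ^ i) * u l))"
    using interpolation_weights[OF assms(2)] by blast
  from choice[OF this] obtain V where V: "\<And>y u x. (\<forall>x. (fdiff ^^ D) u x = 0) \<Longrightarrow>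
     u x = (\<Sum>l<D. (\<Sum>i<D. V y l i * (of_nat (y + \<alpha> * x) :: rat) ^ i) * u l)"
    by blast
  define w where "w l x = (\<Sum>i<D. V (b x) l i * of_nat x ^ i)" for l x :: nat
  have step: "f m = (\<Sum>l<D. w l (m j) * f (m(j := pt (m j) l)))" if m: "\<And>i. c \<le> m i" for j m
  proof -
    define u where "u x = f (m(j := pt (m j) x))" for x
    have u: "(fdiff ^^ k) u x = (diff_dir \<alpha> j ^^ k) f (m(j := pt (m j) x))" for k x
    proof (induction k arbitrary: x)
      case (Suc k)
      have "bump j \<alpha> (m(j := pt (m j) x)) = m(j := pt (m j) (Suc x))" by (auto simp: bump_def pt_def)
      then show ?case
        by (simp only: funpow.simps o_apply fdiff_def[of "(fdiff ^^ k) u"] Suc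
            diff_dir_def[of _ _ "(diff_dir \<alpha> j ^^ k) f"])
    qed (simp add: u_def)
    have "(fdiff ^^ D) u x = 0" for x
    proof -
      have "c0 \<le> (m(j := pt (m j) x)) i" for i
        using c m[of i] by (auto simp: pt_def b_def intro: order_trans[OF c(1)])
      then show ?thesis unfolding u by (intro c0)
    qed
    define x where "x = (m j - c) div \<alpha>"
    have "(m j - c) mod \<alpha> = m j mod \<alpha>"
      using c(2) m[of j] by (metis mod_diff_right_eq c_def le_add_diff_inverse mod_mult_self4)
    then have x: "b (m j) + \<alpha> * x = m j"
      using m[of j] by (simp add: b_def x_def) (metis add.assoc le_add_diff_inverse mod_mult_div_eq)
    have "f m = u x" using x by (simp add: u_def pt_def)
    also have "\<dots> = (\<Sum>l<D. (\<Sum>i<D. V (b (m j)) l i * (of_nat (b (m j) + \<alpha> * x) :: rat) ^ i) * u l)"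
      by (rule V) (use \<open>\<And>x. (fdiff ^^ D) u x = 0\<close> in blast)
    finally show ?thesis by (simp only: w_def x u_def)
  qed
  \<comment> \<open>The coordinates of \<open>n\<close> enter only through \<open>b\<close> and
    \<open>pt\<close>, that is, through their residues modulo \<open>\<alpha>\<close>; this is the
    source of periodicity.\<close>
  define \<sigma> where "\<sigma> i n = (if i \<in> box D then
      \<Sum>l\<in>box D. (\<Prod>j\<in>UNIV. V (b (n j)) (l j) (i j)) * f (\<lambda>j. pt (n j) (l j)) else 0)" for i n
  have "f m = (\<Sum>i\<in>box D. \<sigma> i m * monomial_value i m)" if m: "\<And>i. c \<le> m i" for m
  proof -
    have "f m = (\<Sum>l\<in>box D. (\<Prod>j\<in>UNIV. w (l j) (m j)) * f (\<lambda>j. pt (m j) (l j)))"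
      unfolding box_eq
    proof (rule interpolation_multi[of c])
      show "f m = (\<Sum>l<D. w l (m j) * f (m(j := pt (m j) l)))" if "\<And>i. c \<le> m i" for j m
        by (rule step[OF that])
    qed (use m in \<open>auto simp: pt_def b_def\<close>)
    also have "\<dots> = (\<Sum>l\<in>box D. \<Sum>i\<in>box D. (\<Prod>j\<in>UNIV. V (b (m j)) (l j) (i j)) * monomial_value i m *
        f (\<lambda>j. pt (m j) (l j)))"
      unfolding w_def box_eq
      by (subst prod_sum_PiE) (auto simp: prod.distrib monomial_value_def sum_distrib_right)
    also have "\<dots> = (\<Sum>i\<in>box D. \<sigma> i m * monomial_value i m)"
      by (subst sum.swap) (auto simp: \<sigma>_def sum_distrib_right sum_distrib_left mult_ac intro!: sum.cong)
    finally show ?thesis .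
  qed
  then have "ev (\<lambda>n. f n = (\<Sum>i\<in>box D. \<sigma> i n * monomial_value i n))" by (rule ev_I)
  moreover have "\<sigma> i n = \<sigma> i (\<lambda>j. n j mod \<alpha>)" for i n by (simp add: \<sigma>_def b_def pt_def)
  ultimately show ?thesis by (auto simp: \<sigma>_def intro!: exI[of _ \<sigma>])
qed

subsection \<open>Growth and leading coefficients\<close>

text \<open>\<open>growth g E\<close> says \<open>g(N) = O(N\<^sup>E\<^sup>-\<^sup>1)\<close>; the shift makes \<open>E = 0\<close> mean that the
  natural-valued \<open>g\<close> vanishes eventually.\<close>

definition growth :: "(nat \<Rightarrow> rat) \<Rightarrow> nat \<Rightarrow> bool" where
  "growth g E \<longleftrightarrow> (\<exists>C N0. \<forall>N\<ge>N0. of_nat N * g N \<le> C * of_nat N ^ E)"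

lemma growthI: "(\<And>N. N \<ge> N0 \<Longrightarrow> of_nat N * g N \<le> C * of_nat N ^ E) \<Longrightarrow> growth g E"
  unfolding growth_def by blast

lemma growth_le:
  assumes "growth g E" "\<And>N. N \<ge> N1 \<Longrightarrow> h N \<le> g N" shows "growth h E"
proof -
  obtain C N0 where C: "\<And>N. N \<ge> N0 \<Longrightarrow> of_nat N * g N \<le> C * of_nat N ^ E"
    using assms(1) unfolding growth_def by blast
  show ?thesis
  proof (rule growthI[where C = C and ?N0.0 = "max N0 N1"])
    fix N assume "max N0 N1 \<le> N"
    then have "of_nat N * h N \<le> of_nat N * g N" "of_nat N * g N \<le> C * of_nat N ^ E"
      using C assms(2) by (auto intro: mult_left_mono)
    then show "of_nat N * h N \<le> C * of_nat N ^ E" by linarith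
  qed
qed

lemma growth_add:
  assumes "growth g E" "growth h E" shows "growth (\<lambda>N. g N + h N) E"
proof -
  obtain C N0 where C: "\<And>N. N \<ge> N0 \<Longrightarrow> of_nat N * g N \<le> C * of_nat N ^ E"
    using assms(1) unfolding growth_def by blast
  obtain C' N0' where C': "\<And>N. N \<ge> N0' \<Longrightarrow> of_nat N * h N \<le> C' * of_nat N ^ E"
    using assms(2) unfolding growth_def by blast
  show ?thesis
  proof (rule growthI[where C = "C + C'" and ?N0.0 = "max N0 N0'"])
    fix N assume "max N0 N0' \<le> N"
    then have "of_nat N * g N \<le> C * of_nat N ^ E" "of_nat N * h N \<le> C' * of_nat N ^ E"
      using C C' by auto
    then show "of_nat N * (g N + h N) \<le> (C + C') * of_nat N ^ E" by (simp add: algebra_simps)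
  qed
qed

lemma growthE:
  assumes "growth g E" obtains C N0 where "C \<ge> 0" "\<And>N. N \<ge> N0 \<Longrightarrow> of_nat N * g N \<le> C * of_nat N ^ E"
proof -
  obtain C N0 where C: "\<And>N. N \<ge> N0 \<Longrightarrow> of_nat N * g N \<le> C * of_nat N ^ E"
    using assms unfolding growth_def by blast
  have "of_nat N * g N \<le> \<bar>C\<bar> * of_nat N ^ E" if N: "N \<ge> N0" for N
    using C[OF N] by (meson abs_ge_self mult_right_mono of_nat_0_le_iff order_trans zero_le_power)
  then show ?thesis using that[of "\<bar>C\<bar>" N0] by simp
qed

lemma growth_mono:
  assumes "growth g E" "E \<le> E'" shows "growth g E'"
proof -
  obtain C N0 where C: "C \<ge> 0" "\<And>N. N \<ge> N0 \<Longrightarrow> of_nat N * g N \<le> C * of_nat N ^ E"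
    using growthE[OF assms(1)] by blast
  show ?thesis
  proof (rule growthI[where C = C and ?N0.0 = "max N0 1"])
    fix N assume N: "max N0 1 \<le> N"
    then have "(of_nat N :: rat) ^ E \<le> of_nat N ^ E'" using assms(2) by (intro power_increasing) auto
    then have "C * of_nat N ^ E \<le> C * of_nat N ^ E'" using C(1) by (rule mult_left_mono)
    then show "of_nat N * g N \<le> C * of_nat N ^ E'" using C(2)[of N] N by auto
  qed
qed

text \<open>Dilation by \<open>a\<close> and shift by \<open>k\<close> cost no more than the
  constant factor \<open>(a + k)^E\<close>, because \<open>a N + k \<le> (a + k) N\<close> for
  \<open>N \<ge> 1\<close>.\<close>

lemma growth_shift:
  assumes "growth g E" "\<And>N. N \<ge> N1 \<Longrightarrow> h N \<le> g (a * N + k)" "a > 0" "\<And>N. g N \<ge> 0"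
  shows "growth h E"
proof -
  obtain C N0 where C: "C \<ge> 0" "\<And>N. N \<ge> N0 \<Longrightarrow> of_nat N * g N \<le> C * of_nat N ^ E"
    using growthE[OF assms(1)] by blast
  show ?thesis
  proof (rule growthI[where C = "C * of_nat (a + k) ^ E" and ?N0.0 = "max (max N0 1) N1"])
    fix N assume N: "max (max N0 1) N1 \<le> N"
    have "N \<le> a * N + k" using assms(3) by (metis One_nat_def Suc_leI le_add1 le_trans mult_le_mono1 nat_mult_1)
    have "of_nat N * h N \<le> of_nat N * g (a * N + k)" using assms(2) N by (intro mult_left_mono) auto
    also have "\<dots> \<le> of_nat (a * N + k) * g (a * N + k)"
      using \<open>N \<le> a * N + k\<close> assms(4) by (intro mult_right_mono) (auto simp only: of_nat_le_iff)
    also have "\<dots> \<le> C * of_nat (a * N + k) ^ E" using N \<open>N \<le> a * N + k\<close> by (intro C(2)) linarith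
    also have "\<dots> \<le> C * (of_nat (a + k) * of_nat N) ^ E"
    proof (intro mult_left_mono power_mono)
      have "a * N + k \<le> (a + k) * N" using N by (simp add: algebra_simps)
      then show "(of_nat (a * N + k) :: rat) \<le> of_nat (a + k) * of_nat N" by (metis of_nat_le_iff of_nat_mult)
    qed (use C in auto)
    finally show "of_nat N * h N \<le> C * of_nat (a + k) ^ E * of_nat N ^ E" by (simp add: power_mult_distrib mult_ac)
  qed
qed

text \<open>Discrete integration: increments of order \<open>N^E\<close> add up to order
  \<open>N^(E+1)\<close>.\<close>

lemma growth_sum:
  assumes "growth d (Suc E)" "\<And>N. N \<ge> 1 \<Longrightarrow> g N \<le> g (N - 1) + d N" "\<And>N. 0 \<le> g N"
  shows "growth g (Suc (Suc E))"
proof -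
  obtain C N0 where C: "C \<ge> 0" "\<And>N. N \<ge> N0 \<Longrightarrow> of_nat N * d N \<le> C * of_nat N ^ Suc E"
    using growthE[OF assms(1)] by blast
  define N1 where "N1 = max N0 1"
  have d: "d N \<le> C * of_nat N ^ E" if "N1 \<le> N" for N
  proof -
    have "of_nat N * d N \<le> of_nat N * (C * of_nat N ^ E)" using C(2)[of N] that by (simp add: N1_def mult_ac)
    then show ?thesis using that by (simp add: N1_def)
  qed
  have g: "g (N1 + m) \<le> g N1 + of_nat m * (C * of_nat (N1 + m) ^ E)" for m
  proof (induction m)
    case (Suc m)
    have "g (N1 + Suc m) \<le> g (N1 + m) + d (N1 + Suc m)" using assms(2)[of "N1 + Suc m"] by simp
    also have "\<dots> \<le> g N1 + of_nat m * (C * of_nat (N1 + m) ^ E) + C * of_nat (N1 + Suc m) ^ E"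
      using Suc d[of "N1 + Suc m"] by (intro add_mono) auto
    also have "of_nat m * (C * of_nat (N1 + m) ^ E) \<le> of_nat m * (C * of_nat (N1 + Suc m) ^ E)"
      using C(1) by (intro mult_left_mono power_mono) auto
    finally show ?case by (simp add: algebra_simps)
  qed simp
  show ?thesis
  proof (rule growthI[where C = "g N1 + C" and ?N0.0 = N1])
    fix N assume N: "N1 \<le> N"
    then have N': "1 \<le> (of_nat N :: rat)" by (simp add: N1_def)
    have "g N \<le> g N1 + of_nat (N - N1) * (C * of_nat N ^ E)" using g[of "N - N1"] N by simp
    also have "\<dots> \<le> g N1 * of_nat N ^ Suc E + of_nat N * (C * of_nat N ^ E)"
      using mult_left_mono[OF one_le_power[OF N', of "Suc E"] assms(3)[of N1]] C(1)
      by (intro add_mono mult_right_mono) auto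
    finally have "g N \<le> (g N1 + C) * of_nat N ^ Suc E" by (simp add: algebra_simps)
    then have "of_nat N * g N \<le> of_nat N * ((g N1 + C) * of_nat N ^ Suc E)" by (rule mult_left_mono) simp
    then show "of_nat N * g N \<le> (g N1 + C) * of_nat N ^ Suc (Suc E)" by (simp add: mult_ac)
  qed
qed

section \<open>Polynomials vanishing at all positive integer points\<close>

lemma univariate_polynomial_zero:
  fixes a :: "nat \<Rightarrow> real"
  assumes "\<And>t::nat. 1 \<le> t \<Longrightarrow> (\<Sum>y<K. a y * real t ^ y) = 0" "y < K"
  shows "a y = 0"
proof (rule ccontr)
  assume "a y \<noteq> 0"
  obtain n where K: "K = Suc n" using assms(2) by (cases K) auto
  have "finite {x. (\<Sum>i\<le>n. a i * x ^ i) = 0}"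
    unfolding polyfun_finite_roots using \<open>a y \<noteq> 0\<close> assms(2) K by (auto simp: less_Suc_eq_le)
  moreover have "real ` {1..} \<subseteq> {x. (\<Sum>i\<le>n. a i * x ^ i) = 0}"
    using assms(1) by (auto simp: K lessThan_Suc_atMost)
  ultimately have "finite (real ` {1..})" by (rule finite_subset[rotated])
  then show False by (simp add: finite_image_iff inj_on_def infinite_Ici)
qed

text \<open>The variable \<open>j\<close> is split off. With the other variables fixed, the
  polynomial in it has infinitely many roots, so its coefficients, which are polynomials in fewer
  variables, vanish at all positive points.\<close>

lemma polynomial_zero_PiE:
  fixes c :: "('r \<Rightarrow> nat) \<Rightarrow> real"
  assumes "finite J"
    and "\<And>m. (\<And>j. 1 \<le> m j) \<Longrightarrow> (\<Sum>i\<in>PiE J (\<lambda>_. {..<K}). c i * (\<Prod>j\<in>J. real (m j) ^ i j)) = 0"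
    and "i \<in> PiE J (\<lambda>_. {..<K})"
  shows "c i = 0"
  using assms
proof (induction J arbitrary: c i rule: finite_induct)
  case empty
  then show ?case using empty.prems(1)[of "\<lambda>_. 1"] by simp
next
  case (insert j J)
  have z: "(\<Sum>g\<in>PiE J (\<lambda>_. {..<K}). c (g(j := y)) * (\<Prod>j\<in>J. real (m j) ^ g j)) = 0"
    if m: "\<And>j. 1 \<le> m j" and y: "y < K" for m y
  proof (rule univariate_polynomial_zero[OF _ y])
    fix t :: nat assume t: "1 \<le> t"
    have "(\<Sum>y<K. (\<Sum>g\<in>PiE J (\<lambda>_. {..<K}). c (g(j := y)) * (\<Prod>j\<in>J. real (m j) ^ g j)) * real t ^ y) =
      (\<Sum>i\<in>PiE (insert j J) (\<lambda>_. {..<K}). c i * (\<Prod>l\<in>insert j J. real ((m(j := t)) l) ^ i l))"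
      unfolding sum_PiE_insert[OF insert.hyps] sum_distrib_right
    proof (intro sum.cong refl)
      fix y g
      have "(\<Prod>l\<in>J. real ((m(j := t)) l) ^ (g(j := y)) l) = (\<Prod>l\<in>J. real (m l) ^ g l)"
        using insert.hyps by (intro prod.cong) auto
      then show "c (g(j := y)) * (\<Prod>l\<in>J. real (m l) ^ g l) * real t ^ y =
          c (g(j := y)) * (\<Prod>l\<in>insert j J. real ((m(j := t)) l) ^ (g(j := y)) l)"
        using insert.hyps by simp
    qed
    also have "\<dots> = 0" by (rule insert.prems(1)) (use m t in auto)
    finally show "(\<Sum>y<K. (\<Sum>g\<in>PiE J (\<lambda>_. {..<K}). c (g(j := y)) * (\<Prod>j\<in>J. real (m j) ^ g j)) * real t ^ y) = 0" .
  qed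
  obtain y g where "y < K" "g \<in> PiE J (\<lambda>_. {..<K})" "i = g(j := y)"
    using insert.prems(2) unfolding PiE_insert_eq by auto
  then show ?case using insert.IH[of "\<lambda>g. c (g(j := y))", OF z] by blast
qed

lemma polynomial_zero:
  fixes c :: "('r::finite \<Rightarrow> nat) \<Rightarrow> real"
  assumes "\<And>m. (\<And>j. 1 \<le> m j) \<Longrightarrow> (\<Sum>i\<in>box K. c i * (\<Prod>j\<in>UNIV. real (m j) ^ i j)) = 0" "i \<in> box K"
  shows "c i = 0"
  using polynomial_zero_PiE[where J = UNIV and K = K and c = c and i = i] assms unfolding box_eq by auto

section \<open>Monotone quasi polynomials: leading forms and growth on the diagonal\<close>

locale quasi_poly =
  fixes f :: "('r::finite \<Rightarrow> nat) \<Rightarrow> rat" and \<sigma> :: "('r \<Rightarrow> nat) \<Rightarrow> ('r \<Rightarrow> nat) \<Rightarrow> rat" and K \<alpha> c :: nat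
  assumes supp: "i \<notin> box K \<Longrightarrow> \<sigma> i n = 0"
    and per: "\<sigma> i n = \<sigma> i (\<lambda>j. n j mod \<alpha>)" and \<alpha>: "\<alpha> > 0"
    and eq: "(\<And>j. c \<le> n j) \<Longrightarrow> f n = (\<Sum>i\<in>box K. \<sigma> i n * monomial_value i n)"
    and mono: "(\<And>j. n j \<le> m j) \<Longrightarrow> f n \<le> f m"
    and nonneg: "0 \<le> f n"
begin

text \<open>The form of degree \<open>E\<close> that belongs to the residue class \<open>b\<close>,
  evaluated at \<open>\<alpha> m\<close>. It is real-valued because it is obtained as a
  limit.\<close>

definition top_form :: "nat \<Rightarrow> ('r \<Rightarrow> nat) \<Rightarrow> ('r \<Rightarrow> nat) \<Rightarrow> real" where
  "top_form E b m = (\<Sum>i\<in>box K. if multi_degree i = E then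
     real_of_rat (\<sigma> i b) * (\<Prod>j\<in>UNIV. (real \<alpha> * real (m j)) ^ i j) else 0)"

text \<open>Along \<open>n = \<alpha> k m + b\<close> the coefficients are frozen at
  \<open>b\<close>, so the function is eventually a polynomial in \<open>k\<close>, and division by
  \<open>k^E\<close> removes all terms of degree below \<open>E\<close>.\<close>

lemma top_form_limit:
  assumes top: "\<And>i n. multi_degree i > E \<Longrightarrow> \<sigma> i n = 0"
    and b: "\<And>j. b j < \<alpha>" and m: "\<And>j. 1 \<le> m j"
  shows "(\<lambda>k. real_of_rat (f (\<lambda>j. \<alpha> * k * m j + b j)) / real k ^ E) \<longlonglongrightarrow> top_form E b m"
proof -
  have lin: "(\<lambda>k. real (\<alpha> * k * m j + b j) / real k) \<longlonglongrightarrow> real \<alpha> * real (m j)" for j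
  proof -
    have "(\<lambda>k. real \<alpha> * real (m j) + real (b j) * (1 / real k)) \<longlonglongrightarrow> real \<alpha> * real (m j) + real (b j) * 0"
      by (intro tendsto_intros lim_1_over_n)
    moreover have "\<forall>\<^sub>F k in sequentially. real \<alpha> * real (m j) + real (b j) * (1 / real k) = real (\<alpha> * k * m j + b j) / real k"
      by (rule eventually_mono[OF eventually_gt_at_top[of 0]]) (simp add: field_simps)
    ultimately show ?thesis by (simp add: tendsto_cong)
  qed
  have term_lim: "(\<lambda>k. real_of_rat (\<sigma> i b) * (\<Prod>j\<in>UNIV. real (\<alpha> * k * m j + b j) ^ i j) / real k ^ E) \<longlonglongrightarrow>
    (if multi_degree i = E then real_of_rat (\<sigma> i b) * (\<Prod>j\<in>UNIV. (real \<alpha> * real (m j)) ^ i j) else 0)" for i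
  proof (cases "multi_degree i > E")
    case True
    then show ?thesis using top by simp
  next
    case False
    define e where "e = E - multi_degree i"
    have "(\<lambda>k. real_of_rat (\<sigma> i b) * (\<Prod>j\<in>UNIV. (real (\<alpha> * k * m j + b j) / real k) ^ i j) * (1 / real k) ^ e) \<longlonglongrightarrow>
      real_of_rat (\<sigma> i b) * (\<Prod>j\<in>UNIV. (real \<alpha> * real (m j)) ^ i j) * 0 ^ e"
      by (intro tendsto_intros lin lim_1_over_n)
    moreover have "real_of_rat (\<sigma> i b) * (\<Prod>j\<in>UNIV. (real (\<alpha> * k * m j + b j) / real k) ^ i j) * (1 / real k) ^ e
        = real_of_rat (\<sigma> i b) * (\<Prod>j\<in>UNIV. real (\<alpha> * k * m j + b j) ^ i j) / real k ^ E" for k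
    proof -
      have "E = multi_degree i + e" using False by (simp add: e_def)
      then show ?thesis
        by (simp add: power_divide prod_dividef power_add multi_degree_def power_sum[symmetric])
    qed
    moreover have "real_of_rat (\<sigma> i b) * (\<Prod>j\<in>UNIV. (real \<alpha> * real (m j)) ^ i j) * 0 ^ e =
      (if multi_degree i = E then real_of_rat (\<sigma> i b) * (\<Prod>j\<in>UNIV. (real \<alpha> * real (m j)) ^ i j) else 0)"
      using False by (auto simp: e_def zero_power)
    ultimately show ?thesis by simp
  qed
  have "(\<lambda>k. \<Sum>i\<in>box K. real_of_rat (\<sigma> i b) * (\<Prod>j\<in>UNIV. real (\<alpha> * k * m j + b j) ^ i j) / real k ^ E) \<longlonglongrightarrow> top_form E b m"
    unfolding top_form_def by (intro tendsto_sum term_lim)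
  moreover have "\<forall>\<^sub>F k in sequentially. (\<Sum>i\<in>box K. real_of_rat (\<sigma> i b) * (\<Prod>j\<in>UNIV. real (\<alpha> * k * m j + b j) ^ i j) / real k ^ E) =
      real_of_rat (f (\<lambda>j. \<alpha> * k * m j + b j)) / real k ^ E"
  proof (rule eventually_mono[OF eventually_ge_at_top[of c]])
    fix k assume k: "c \<le> k"
    have "c \<le> \<alpha> * k * m j + b j" for j
    proof -
      have "1 * k * 1 \<le> \<alpha> * k * m j" using \<alpha> m[of j] by (intro mult_le_mono) auto
      then show ?thesis using k by linarith
    qed
    moreover have "\<sigma> i (\<lambda>j. \<alpha> * k * m j + b j) = \<sigma> i b" for i
      using per[of i "\<lambda>j. \<alpha> * k * m j + b j"] b by (simp add: mult.assoc)
    ultimately show "(\<Sum>i\<in>box K. real_of_rat (\<sigma> i b) * (\<Prod>j\<in>UNIV. real (\<alpha> * k * m j + b j) ^ i j) / real k ^ E) =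
      real_of_rat (f (\<lambda>j. \<alpha> * k * m j + b j)) / real k ^ E"
      using eq[of "\<lambda>j. \<alpha> * k * m j + b j"]
      by (simp add: monomial_value_def of_rat_sum of_rat_mult of_rat_prod of_rat_power sum_divide_distrib
          del: of_nat_add of_nat_mult)
  qed
  ultimately show ?thesis by (simp add: tendsto_cong)
qed

lemma top_form_zeroD:
  assumes "\<And>m. (\<And>j. 1 \<le> m j) \<Longrightarrow> top_form E b m = top_form E b' m" "multi_degree i = E"
  shows "\<sigma> i b = \<sigma> i b'"
proof (cases "i \<in> box K")
  case True
  let ?c = "\<lambda>i. if multi_degree i = E then (real_of_rat (\<sigma> i b) - real_of_rat (\<sigma> i b')) * real \<alpha> ^ E else 0"
  have "?c i = 0"
  proof (rule polynomial_zero[OF _ True])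
    fix m :: "'r \<Rightarrow> nat" assume m: "\<And>j. 1 \<le> m j"
    have "(\<Sum>i\<in>box K. ?c i * (\<Prod>j\<in>UNIV. real (m j) ^ i j)) = top_form E b m - top_form E b' m"
      unfolding top_form_def sum_subtractf[symmetric]
    proof (intro sum.cong refl)
      fix i :: "'r \<Rightarrow> nat"
      show "?c i * (\<Prod>j\<in>UNIV. real (m j) ^ i j) =
        (if multi_degree i = E then real_of_rat (\<sigma> i b) * (\<Prod>j\<in>UNIV. (real \<alpha> * real (m j)) ^ i j) else 0) -
        (if multi_degree i = E then real_of_rat (\<sigma> i b') * (\<Prod>j\<in>UNIV. (real \<alpha> * real (m j)) ^ i j) else 0)"
        by (simp add: power_mult_distrib prod.distrib power_sum[symmetric] multi_degree_def left_diff_distrib right_diff_distrib mult_ac)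
    qed
    then show "(\<Sum>i\<in>box K. ?c i * (\<Prod>j\<in>UNIV. real (m j) ^ i j)) = 0" using assms(1)[OF m] by simp
  qed
  then show ?thesis using assms(2) \<alpha> by simp
qed (simp add: supp)

text \<open>For each residue class \<open>b\<close>, monotonicity gives \<open>f(\<alpha> k m) \<le>
  f(\<alpha> k m + b) \<le> f(\<alpha> (k+1) m)\<close>. After division by \<open>k^E\<close> the
  outer terms have the same limit, so every leading form agrees with that of the class zero at
  positive integer points, and hence has the same coefficients.\<close>

lemma top_constant:
  assumes top: "\<And>i n. multi_degree i > E \<Longrightarrow> \<sigma> i n = 0" and i: "multi_degree i = E"
  shows "\<sigma> i n = \<sigma> i (\<lambda>_. 0)"
proof -
  define b where "b j = n j mod \<alpha>" for j
  have b: "b j < \<alpha>" for j using \<alpha> by (simp add: b_def)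
  have "\<sigma> i b = \<sigma> i (\<lambda>_. 0)"
  proof (rule top_form_zeroD[OF _ i])
    fix m :: "'r \<Rightarrow> nat" assume m: "\<And>j. 1 \<le> m j"
    have lim: "(\<lambda>k. real_of_rat (f (\<lambda>j. \<alpha> * k * m j + b' j)) / real k ^ E) \<longlonglongrightarrow> top_form E b' m"
      if "\<And>j. b' j < \<alpha>" for b' by (rule top_form_limit[OF top that m])
    have L0: "(\<lambda>k. real_of_rat (f (\<lambda>j. \<alpha> * k * m j)) / real k ^ E) \<longlonglongrightarrow> top_form E (\<lambda>_. 0) m"
      using lim[of "\<lambda>_. 0"] \<alpha> by simp
    \<comment> \<open>Replacing \<open>k\<close> by \<open>k + 1\<close> does not affect the limit,
      since \<open>((k+1)/k)^E\<close> tends to 1.\<close>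
    have "(\<lambda>k. real_of_rat (f (\<lambda>j. \<alpha> * Suc k * m j)) / real (Suc k) ^ E * (real (Suc k) / real k) ^ E) \<longlonglongrightarrow>
       top_form E (\<lambda>_. 0) m * 1 ^ E"
    proof (intro tendsto_intros LIMSEQ_Suc[OF L0])
      have "(\<lambda>k. 1 + 1 / real k) \<longlonglongrightarrow> 1 + 0" by (intro tendsto_intros lim_1_over_n)
      moreover have "\<forall>\<^sub>F k in sequentially. 1 + 1 / real k = real (Suc k) / real k"
        by (rule eventually_mono[OF eventually_gt_at_top[of 0]]) (simp add: field_simps)
      ultimately show "(\<lambda>k. real (Suc k) / real k) \<longlonglongrightarrow> 1" by (simp add: tendsto_cong)
    qed
    then have L1: "(\<lambda>k. real_of_rat (f (\<lambda>j. \<alpha> * Suc k * m j)) / real k ^ E) \<longlonglongrightarrow> top_form E (\<lambda>_. 0) m"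
      by (simp add: power_divide del: of_nat_Suc mult_Suc_right)
    show "top_form E b m = top_form E (\<lambda>_. 0) m"
    proof (rule antisym)
      show "top_form E b m \<le> top_form E (\<lambda>_. 0) m"
      proof (rule LIMSEQ_le[OF lim[OF b] L1], intro exI allI impI)
        fix k :: nat
        have "f (\<lambda>j. \<alpha> * k * m j + b j) \<le> f (\<lambda>j. \<alpha> * Suc k * m j)"
        proof (rule mono)
          fix j
          have "b j \<le> \<alpha> * 1" "\<alpha> * 1 \<le> \<alpha> * m j" using b[of j] m[of j] by (auto intro: mult_le_mono2)
          then have "b j \<le> \<alpha> * m j" by linarith
          then show "\<alpha> * k * m j + b j \<le> \<alpha> * Suc k * m j" by (simp add: algebra_simps)
        qed
        then show "real_of_rat (f (\<lambda>j. \<alpha> * k * m j + b j)) / real k ^ E \<le> real_of_rat (f (\<lambda>j. \<alpha> * Suc k * m j)) / real k ^ E"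
          by (intro divide_right_mono) (auto simp: of_rat_less_eq simp del: mult_Suc_right)
      qed
      show "top_form E (\<lambda>_. 0) m \<le> top_form E b m"
      proof (rule LIMSEQ_le[OF L0 lim[OF b]], intro exI allI impI)
        fix k :: nat
        have "f (\<lambda>j. \<alpha> * k * m j) \<le> f (\<lambda>j. \<alpha> * k * m j + b j)" by (rule mono) simp
        then show "real_of_rat (f (\<lambda>j. \<alpha> * k * m j)) / real k ^ E \<le> real_of_rat (f (\<lambda>j. \<alpha> * k * m j + b j)) / real k ^ E"
          by (intro divide_right_mono) (auto simp: of_rat_less_eq)
      qed
    qed
  qed
  then show ?thesis using per[of i n] by (simp add: b_def[abs_def])
qed

text \<open>Every ray lies below a dilated diagonal: each coordinate of \<open>\<alpha> k m\<close>
  is at most \<open>s k\<close>, with \<open>s\<close> equal to \<open>\<alpha>\<close> times the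
  sum of the \<open>m j\<close>. Growth \<open>E' \<le> E\<close> on the diagonal therefore bounds
  \<open>f(\<alpha> k m) / k^E\<close> by a multiple of \<open>1/k\<close>, and the leading form is
  squeezed to zero.\<close>

lemma top_vanish:
  assumes gr: "growth (\<lambda>N. f (\<lambda>_. N)) E'" "E' \<le> E"
    and top: "\<And>i n. multi_degree i > E \<Longrightarrow> \<sigma> i n = 0" and i: "multi_degree i = E"
  shows "\<sigma> i n = 0"
proof -
  obtain C N0 where C: "C \<ge> 0" "\<And>N. N \<ge> N0 \<Longrightarrow> of_nat N * f (\<lambda>_. N) \<le> C * of_nat N ^ E'"
    using growthE[OF gr(1)] by blast
  \<comment> \<open>An equation \<open>x = x - x\<close>, which expresses that the form vanishes at
    \<open>m\<close>.\<close>
  have "top_form E (\<lambda>_. 0) m = top_form E (\<lambda>_. 0) m - top_form E (\<lambda>_. 0) m" if m: "\<And>j. 1 \<le> m j" for m :: "'r \<Rightarrow> nat"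
  proof -
    define s where "s = \<alpha> * (\<Sum>j\<in>UNIV. m j)"
    have ms: "\<alpha> * m j \<le> s" for j unfolding s_def by (intro mult_le_mono2 member_le_sum) auto
    have s: "s \<ge> 1" using ms[of undefined] \<alpha> m[of undefined] by (metis One_nat_def Suc_leI le_trans mult_pos_pos zero_less_one less_le_trans)
    have lim: "(\<lambda>k. real_of_rat (f (\<lambda>j. \<alpha> * k * m j)) / real k ^ E) \<longlonglongrightarrow> top_form E (\<lambda>_. 0) m"
      using top_form_limit[of E "\<lambda>_. 0" m, OF top] \<alpha> m by simp
    have ub: "real_of_rat (f (\<lambda>j. \<alpha> * k * m j)) / real k ^ E \<le> (real_of_rat C * real s ^ E') * (1 / real k)"
      if k: "k \<ge> max N0 1" for k
    proof -
      have k1: "1 \<le> real k" using k by simp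
      have "f (\<lambda>j. \<alpha> * k * m j) \<le> f (\<lambda>_. s * k)"
        using ms by (intro mono) (metis mult.assoc mult.commute mult_le_mono1)
      moreover have sk: "k \<le> s * k" using s by simp
      ultimately have "of_nat (s * k) * f (\<lambda>j. \<alpha> * k * m j) \<le> of_nat (s * k) * f (\<lambda>_. s * k)"
        by (intro mult_left_mono) auto
      moreover have "of_nat k * f (\<lambda>j. \<alpha> * k * m j) \<le> of_nat (s * k) * f (\<lambda>j. \<alpha> * k * m j)"
        using sk nonneg by (intro mult_right_mono) (auto simp only: of_nat_le_iff)
      moreover have "of_nat (s * k) * f (\<lambda>_. s * k) \<le> C * of_nat (s * k) ^ E'" using sk k by (intro C(2)) linarith
      ultimately have "of_nat k * f (\<lambda>j. \<alpha> * k * m j) \<le> C * of_nat (s * k) ^ E'" by linarith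
      then have "real_of_rat (of_nat k * f (\<lambda>j. \<alpha> * k * m j)) \<le> real_of_rat (C * of_nat (s * k) ^ E')"
        by (simp only: of_rat_less_eq)
      then have "real k * real_of_rat (f (\<lambda>j. \<alpha> * k * m j)) \<le> real_of_rat C * real s ^ E' * real k ^ E'"
        by (simp add: of_rat_mult of_rat_power power_mult_distrib)
      also have "\<dots> \<le> real_of_rat C * real s ^ E' * real k ^ E"
        using k1 gr(2) C(1) by (intro mult_left_mono power_increasing) auto
      finally show ?thesis using k1 by (simp add: field_simps)
    qed
    have "(\<lambda>k. (real_of_rat C * real s ^ E') * (1 / real k)) \<longlonglongrightarrow> (real_of_rat C * real s ^ E') * 0"
      by (intro tendsto_intros lim_1_over_n)
    then have "top_form E (\<lambda>_. 0) m \<le> (real_of_rat C * real s ^ E') * 0"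
      using ub by (intro LIMSEQ_le[OF lim]) blast+
    moreover have "0 \<le> top_form E (\<lambda>_. 0) m"
      using nonneg by (intro LIMSEQ_le_const[OF lim]) (auto intro!: divide_nonneg_nonneg)
    ultimately show ?thesis by simp
  qed
  then have z: "top_form E (\<lambda>_. 0) m = 0" if "\<And>j. 1 \<le> m j" for m using that by (metis diff_self)
  have "\<sigma> i (\<lambda>_. 0) = 0"
  proof (cases "i \<in> box K")
    case True
    let ?c = "\<lambda>i. if multi_degree i = E then real_of_rat (\<sigma> i (\<lambda>_. 0)) * real \<alpha> ^ E else 0"
    have "?c i = 0"
    proof (rule polynomial_zero[OF _ True])
      fix m :: "'r \<Rightarrow> nat" assume m: "\<And>j. 1 \<le> m j"
      have "(\<Sum>i\<in>box K. ?c i * (\<Prod>j\<in>UNIV. real (m j) ^ i j)) = top_form E (\<lambda>_. 0) m"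
        unfolding top_form_def
        by (intro sum.cong refl)
           (simp add: power_mult_distrib prod.distrib power_sum[symmetric] multi_degree_def mult_ac)
      then show "(\<Sum>i\<in>box K. ?c i * (\<Prod>j\<in>UNIV. real (m j) ^ i j)) = 0" using z[OF m] by simp
    qed
    then show ?thesis using i \<alpha> by simp
  qed (simp add: supp)
  then show ?thesis using top_constant[OF top i, of n] by simp
qed

text \<open>\<open>top_vanish\<close> presupposes that all higher coefficients are zero, so it is
  applied to a nonzero coefficient of largest degree; one exists because exponents outside
  \<open>box K\<close> do not occur.\<close>

lemma coeff_vanish:
  assumes gr: "growth (\<lambda>N. f (\<lambda>_. N)) E'" and i: "E' \<le> multi_degree i"
  shows "\<sigma> i n = 0"
proof (rule ccontr)
  assume ne: "\<sigma> i n \<noteq> 0"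
  define Z where "Z = {multi_degree i |i. E' \<le> multi_degree i \<and> (\<exists>n. \<sigma> i n \<noteq> 0)}"
  have "Z \<subseteq> multi_degree ` (box K :: ('r \<Rightarrow> nat) set)" using supp by (auto simp: Z_def)
  then have fin: "finite Z" by (rule finite_subset) simp
  have "multi_degree i \<in> Z" using i ne by (auto simp: Z_def)
  then have "Max Z \<in> Z" using fin by (intro Max_in) auto
  then obtain i' n' where i': "Max Z = multi_degree i'" "E' \<le> multi_degree i'" "\<sigma> i' n' \<noteq> 0" by (auto simp: Z_def)
  have "\<sigma> l n = 0" if "multi_degree l > multi_degree i'" for l n
  proof (rule ccontr)
    assume "\<sigma> l n \<noteq> 0"
    then have "multi_degree l \<in> Z" using that i'(2) by (auto simp: Z_def)
    then show False using Max_ge[OF fin, of "multi_degree l"] that i'(1) by simp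
  qed
  then show False using top_vanish[OF gr i'(2), of i' n'] i'(3) by blast
qed

lemma coeff_constant:
  assumes gr: "growth (\<lambda>N. f (\<lambda>_. N)) (Suc E)" and i: "multi_degree i = E"
  shows "\<sigma> i n = \<sigma> i (\<lambda>_. 0)"
  by (rule top_constant[OF coeff_vanish[OF gr] i]) auto

text \<open>By periodicity all values of \<open>\<sigma> i\<close> are taken on the residues in
  \<open>box \<alpha>\<close>, so the sum is a uniform bound.\<close>

definition coeff_bound :: "('r \<Rightarrow> nat) \<Rightarrow> rat" where
  "coeff_bound i = (\<Sum>b\<in>box \<alpha>. \<bar>\<sigma> i b\<bar>)"

lemma coeff_bound: "\<bar>\<sigma> i n\<bar> \<le> coeff_bound i"
proof -
  have "(\<lambda>j. n j mod \<alpha>) \<in> box \<alpha>" using \<alpha> by (auto simp: box_def)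
  then have "\<bar>\<sigma> i (\<lambda>j. n j mod \<alpha>)\<bar> \<le> coeff_bound i"
    unfolding coeff_bound_def by (intro member_le_sum[where f = "\<lambda>b. \<bar>\<sigma> i b\<bar>"]) auto
  then show ?thesis using per by metis
qed

lemma monomial_diagonal: "monomial_value i (\<lambda>_ :: 'r. N) = of_nat N ^ multi_degree i"
  by (simp add: monomial_value_def multi_degree_def power_sum)

text \<open>Converse to \<open>coeff_vanish\<close>: together they identify the degree with the
  growth exponent on the diagonal, up to the shift by one built into \<open>growth\<close>.\<close>

lemma growth_of_degree:
  assumes "\<And>i n. E \<le> multi_degree i \<Longrightarrow> \<sigma> i n = 0"
  shows "growth (\<lambda>N. f (\<lambda>_. N)) E"
proof (rule growthI[where C = "\<Sum>i\<in>box K. coeff_bound i" and ?N0.0 = "max c 1"])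
  fix N assume N: "max c 1 \<le> N"
  then have "of_nat N * f (\<lambda>_. N) = (\<Sum>i\<in>box K. \<sigma> i (\<lambda>_. N) * of_nat N ^ Suc (multi_degree i))"
    by (subst eq) (auto simp: monomial_diagonal sum_distrib_left mult_ac)
  also have "\<dots> \<le> (\<Sum>i\<in>box K. coeff_bound i * of_nat N ^ E)"
  proof (rule sum_mono)
    fix i :: "'r \<Rightarrow> nat"
    show "\<sigma> i (\<lambda>_. N) * of_nat N ^ Suc (multi_degree i) \<le> coeff_bound i * of_nat N ^ E"
    proof (cases "E \<le> multi_degree i")
      case True
      then show ?thesis using assms coeff_bound[of i undefined] by simp
    next
      case False
      have "\<sigma> i (\<lambda>_. N) \<le> coeff_bound i" using coeff_bound[of i "\<lambda>_. N"] by linarith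
      moreover have "(of_nat N :: rat) ^ Suc (multi_degree i) \<le> of_nat N ^ E"
        using N False by (intro power_increasing) auto
      moreover have "0 \<le> coeff_bound i" using coeff_bound[of i undefined] by linarith
      ultimately show ?thesis by (intro mult_mono) auto
    qed
  qed
  finally show "of_nat N * f (\<lambda>_. N) \<le> (\<Sum>i\<in>box K. coeff_bound i) * of_nat N ^ E" by (simp add: sum_distrib_right)
qed

lemma growth_ex: "\<exists>E. growth (\<lambda>N. f (\<lambda>_. N)) E"
proof -
  have "\<sigma> i n = 0" if "Suc (\<Sum>j\<in>(UNIV::'r set). K) \<le> multi_degree i" for i n
  proof (rule supp, rule notI)
    assume "i \<in> box K"
    then have "multi_degree i \<le> (\<Sum>j\<in>(UNIV::'r set). K)"
      unfolding multi_degree_def box_def by (intro sum_mono) (auto intro: less_imp_le)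
    then show False using that by simp
  qed
  then show ?thesis using growth_of_degree by blast
qed

text \<open>A shift by a multiple of \<open>\<alpha>\<close> leaves the periodic coefficients
  unchanged, so that differences of powers lower the degree by one. Other shifts could change
  coefficients; they are bounded by the shift \<open>a = \<alpha> k\<close> through
  monotonicity.\<close>

lemma growth_difference:
  assumes gr: "growth (\<lambda>N. f (\<lambda>_. N)) (Suc E)"
  shows "growth (\<lambda>N. f (\<lambda>_. N + k) - f (\<lambda>_. N)) E"
proof -
  define a where "a = \<alpha> * k"
  have "\<exists>C. \<forall>N\<ge>1. of_nat N * (of_nat (N + a) ^ d - of_nat N ^ d) \<le> C * (of_nat N :: rat) ^ d \<and> C \<ge> 0" for d
  proof (induction d)
    case 0
    then show ?case by (intro exI[of _ 0]) simp
  next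
    case (Suc d)
    then obtain C where C: "\<And>N. N \<ge> 1 \<Longrightarrow> of_nat N * (of_nat (N + a) ^ d - of_nat N ^ d) \<le> C * (of_nat N :: rat) ^ d" "C \<ge> 0"
      by blast
    have "of_nat N * (of_nat (N + a) ^ Suc d - of_nat N ^ Suc d) \<le> (C * (1 + of_nat a) + of_nat a) * (of_nat N :: rat) ^ Suc d"
      if N: "N \<ge> 1" for N
    proof -
      have "of_nat N * (of_nat (N + a) ^ Suc d - of_nat N ^ Suc d) =
        of_nat (N + a) * (of_nat N * (of_nat (N + a) ^ d - of_nat N ^ d)) + of_nat a * (of_nat N :: rat) ^ Suc d"
        by (simp add: algebra_simps)
      also have "\<dots> \<le> ((1 + of_nat a) * of_nat N) * (C * of_nat N ^ d) + of_nat a * (of_nat N :: rat) ^ Suc d"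
      proof (rule add_right_mono, rule mult_mono)
        have "N + a \<le> (1 + a) * N" using N by simp
        then have "(of_nat (N + a) :: rat) \<le> of_nat ((1 + a) * N)" by (simp only: of_nat_le_iff)
        then show "of_nat (N + a) \<le> (1 + of_nat a) * (of_nat N :: rat)" by (simp only: of_nat_mult of_nat_add of_nat_1)
        show "of_nat N * (of_nat (N + a) ^ d - of_nat N ^ d) \<le> C * (of_nat N :: rat) ^ d" by (rule C(1)[OF N])
        have "(of_nat N :: rat) ^ d \<le> of_nat (N + a) ^ d" by (rule power_mono) auto
        then show "0 \<le> of_nat N * (of_nat (N + a) ^ d - of_nat N ^ d :: rat)" by simp
      qed simp
      finally show ?thesis by (simp add: algebra_simps)
    qed
    moreover have "0 \<le> C * (1 + of_nat a) + of_nat a" using C(2) by simp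
    ultimately show ?case by blast
  qed
  then have "\<forall>d. \<exists>C. \<forall>N\<ge>1. of_nat N * (of_nat (N + a) ^ d - of_nat N ^ d) \<le> C * (of_nat N :: rat) ^ d \<and> C \<ge> 0" by blast
  from choice[OF this] obtain C where
    C: "\<And>d N. N \<ge> 1 \<Longrightarrow> of_nat N * (of_nat (N + a) ^ d - of_nat N ^ d) \<le> C d * (of_nat N :: rat) ^ d" "\<And>d. C d \<ge> 0"
    by (metis order_refl)
  have "growth (\<lambda>N. f (\<lambda>_. N + a) - f (\<lambda>_. N)) E"
  proof (rule growthI[where C = "\<Sum>i\<in>box K. coeff_bound i * C (multi_degree i)" and ?N0.0 = "max c 1"])
    fix N assume N: "max c 1 \<le> N"
    have per': "\<sigma> i (\<lambda>_. N + a) = \<sigma> i (\<lambda>_. N)" for i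
      using per[of i "\<lambda>_. N + a"] per[of i "\<lambda>_. N"] by (simp add: a_def)
    have "of_nat N * (f (\<lambda>_. N + a) - f (\<lambda>_. N)) = (\<Sum>i\<in>box K. \<sigma> i (\<lambda>_. N) *
        (of_nat N * (of_nat (N + a) ^ multi_degree i - of_nat N ^ multi_degree i)))"
      using N by (subst (1 2) eq)
        (auto simp: monomial_diagonal per' sum_subtractf[symmetric] sum_distrib_left right_diff_distrib mult_ac simp del: of_nat_add)
    also have "\<dots> \<le> (\<Sum>i\<in>box K. coeff_bound i * C (multi_degree i) * of_nat N ^ E)"
    proof (rule sum_mono)
      fix i :: "'r \<Rightarrow> nat"
      have cb: "\<sigma> i (\<lambda>_. N) \<le> coeff_bound i" "0 \<le> coeff_bound i" using coeff_bound[of i "\<lambda>_. N"] by linarith+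
      show "\<sigma> i (\<lambda>_. N) * (of_nat N * (of_nat (N + a) ^ multi_degree i - of_nat N ^ multi_degree i))
        \<le> coeff_bound i * C (multi_degree i) * of_nat N ^ E"
      proof (cases "Suc E \<le> multi_degree i")
        case True
        then show ?thesis using coeff_vanish[OF gr] cb C(2) by simp
      next
        case False
        have "\<sigma> i (\<lambda>_. N) * (of_nat N * (of_nat (N + a) ^ multi_degree i - of_nat N ^ multi_degree i))
          \<le> coeff_bound i * (C (multi_degree i) * of_nat N ^ multi_degree i)"
        proof (rule mult_mono)
          show "of_nat N * (of_nat (N + a) ^ multi_degree i - of_nat N ^ multi_degree i)
            \<le> C (multi_degree i) * (of_nat N :: rat) ^ multi_degree i" using N by (intro C(1)) simp
          have "(of_nat N :: rat) ^ multi_degree i \<le> of_nat (N + a) ^ multi_degree i" by (rule power_mono) auto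
          then show "0 \<le> of_nat N * (of_nat (N + a) ^ multi_degree i - of_nat N ^ multi_degree i :: rat)" by simp
        qed (use cb in auto)
        also have "\<dots> \<le> coeff_bound i * (C (multi_degree i) * of_nat N ^ E)"
          using cb C False N by (intro mult_left_mono power_increasing) auto
        finally show ?thesis by (simp add: mult_ac)
      qed
    qed
    finally show "of_nat N * (f (\<lambda>_. N + a) - f (\<lambda>_. N)) \<le> (\<Sum>i\<in>box K. coeff_bound i * C (multi_degree i)) * of_nat N ^ E"
      by (simp add: sum_distrib_right)
  qed
  then show ?thesis
  proof (rule growth_le[where ?N1.0 = 0])
    fix N :: nat
    have "f (\<lambda>_. N + k) \<le> f (\<lambda>_. N + a)" using \<alpha> by (intro mono) (simp add: a_def)
    then show "f (\<lambda>_. N + k) - f (\<lambda>_. N) \<le> f (\<lambda>_. N + a) - f (\<lambda>_. N)" by simp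
  qed
qed

end

lemma qp_imp_quasi_poly:
  fixes f :: "('r::finite \<Rightarrow> nat) \<Rightarrow> rat"
  assumes "qp D \<alpha> f" "\<alpha> > 0" "\<And>n m. (\<And>j. n j \<le> m j) \<Longrightarrow> f n \<le> f m" "\<And>n. 0 \<le> f n"
  obtains \<sigma> K c where "quasi_poly f \<sigma> K \<alpha> c"
proof -
  obtain \<sigma> where \<sigma>: "\<forall>i n. i \<notin> box D \<longrightarrow> \<sigma> i n = 0" "\<forall>i n. \<sigma> i n = \<sigma> i (\<lambda>j. n j mod \<alpha>)"
     "ev (\<lambda>n. f n = (\<Sum>i\<in>box D. \<sigma> i n * monomial_value i n))"
    using qp_imp_quasi_polynomial[OF assms(1,2)] by blast
  then obtain c where "\<And>n. (\<forall>j. c \<le> n j) \<Longrightarrow> f n = (\<Sum>i\<in>box D. \<sigma> i n * monomial_value i n)"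
    unfolding ev_def by blast
  then have "quasi_poly f \<sigma> D \<alpha> c"
    by unfold_locales (use \<sigma> assms in blast)+
  then show ?thesis by (rule that)
qed

section \<open>Hilbert functions of multigraded families\<close>

lemma qp_common:
  fixes h :: "'j::finite \<Rightarrow> ('r \<Rightarrow> nat) \<Rightarrow> rat"
  assumes "\<And>j. \<exists>\<alpha>>0. \<exists>D. qp D \<alpha> (h j)"
  shows "\<exists>\<alpha>>0. \<exists>D. \<forall>j. qp D \<alpha> (h j)"
proof -
  obtain \<alpha> D where *: "\<And>j. \<alpha> j > 0" "\<And>j. qp (D j) (\<alpha> j) (h j)" using assms by metis
  have "qp (Max (range D)) (prod \<alpha> UNIV) (h j)" for j
  proof -
    have "\<alpha> j dvd prod \<alpha> UNIV" by (rule dvd_prodI) auto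
    then obtain k where "prod \<alpha> UNIV = k * \<alpha> j" by (metis dvd_def mult.commute)
    then show ?thesis using qp_mono[OF Max_ge qp_scale[OF *(2)[of j], of k], of "range D"] by simp
  qed
  moreover have "prod \<alpha> UNIV > 0" using *(1) by (simp add: prod_pos)
  ultimately show ?thesis by blast
qed

text \<open>The value is unspecified for an infinite length, as \<open>the_enat\<close> is
  determined on finite values only; additivity and monotonicity are therefore stated under
  finiteness.\<close>

definition len_rat :: "'b set set \<Rightarrow> 'b set \<Rightarrow> 'b set \<Rightarrow> rat" where
  "len_rat L B A = of_nat (the_enat (len L B A))"

lemma len_rat_self [simp]: "len_rat L A A = 0"
  by (simp add: len_rat_def len_self zero_enat_def)

lemma len_rat_nonneg: "0 \<le> len_rat L B A"
  by (simp add: len_rat_def)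

context module
begin

abbreviation "Len \<equiv> len (submods R M)"
abbreviation "Lenr \<equiv> len_rat (submods R M)"

lemma len_rat_add:
  assumes "A \<in> submods R M" "B \<in> submods R M" "C \<in> submods R M" "B \<subseteq> C" "C \<subseteq> A" "Len B A \<noteq> \<infinity>"
  shows "Lenr B A = Lenr B C + Lenr C A"
proof -
  note add = len_add[OF assms(1-5)]
  then obtain p q where "Len B C = enat p" "Len C A = enat q" using assms(6) by (cases "Len B C"; cases "Len C A") auto
  then show ?thesis using add by (simp add: len_rat_def)
qed

lemma len_finite_sub:
  assumes "A \<subseteq> A'" "B' \<subseteq> B" "Len B' A' \<noteq> \<infinity>" shows "Len B A \<noteq> \<infinity>"
  using len_mono[OF assms(2,1), of "submods R M"] assms(3) by (cases "Len B A") auto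

text \<open>The Hilbert-Serre argument. For an operator \<open>x\<close> of degree \<open>a\<close>
  in direction \<open>j\<close>, its kernel \<open>K/B\<close> and cokernel \<open>A/Q\<close> on
  \<open>A/B\<close> are killed by \<open>x\<close>, so they satisfy the chain condition without
  \<open>x\<close>, and the exact sequence expresses the difference with step \<open>a\<close> in
  direction \<open>j\<close> through their lengths. Each direction needs an operator of its own for
  this; a direction without operators is the base case.\<close>

lemma qp_len:
  fixes S :: "('a \<times> nat \<times> 'r::finite) set"
  assumes "finite S" "\<And>x a j. (x, a, j) \<in> S \<Longrightarrow> x \<in> carrier R \<and> a > 0"
    and "A \<in> fam R M S B A" "B \<in> fam R M S B A" "acc (fam R M S B A)" "\<And>n. Len (B n) (A n) \<noteq> \<infinity>"
  shows "\<exists>\<alpha>>0. \<exists>D. qp D \<alpha> (\<lambda>n. Lenr (B n) (A n))"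
  using assms
proof (induction S arbitrary: A B rule: finite_psubset_induct)
  case (psubset S)
  note S = psubset.prems(1) and AD = famD[OF psubset.prems(2)] and BD = famD[OF psubset.prems(3)]
    and acc = psubset.prems(4) and fin = psubset.prems(5)
  have As: "v \<in> A n \<Longrightarrow> v \<in> carrier M" for v n by (rule submodsD(1)[OF AD(1)])
  show ?case
  proof (cases "\<exists>j. \<forall>x a. (x, a, j) \<notin> S")
    case True
    then obtain j where j: "\<And>x a. (x, a, j) \<notin> S" by blast
    \<comment> \<open>Cutting \<open>A\<close> down to \<open>B\<close> from height \<open>k\<close>
      on in direction \<open>j\<close> gives graded submodules, because no operator moves in that
      direction. Stationarity means that \<open>A n = B n\<close> as soon as \<open>n j\<close> is
      large.\<close>
    define N where "N k = (\<lambda>n. if n j < k then A n else B n)" for k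
    have "N k \<in> fam R M S B A" for k
    proof (rule famI)
      fix x a i n v assume *: "(x, a, i) \<in> S" "v \<in> N k n"
      then have "i \<noteq> j" using j by auto
      then have "bump i a n j = n j" by simp
      then show "x \<odot>\<^bsub>M\<^esub> v \<in> N k (bump i a n)" using * AD(4) BD(4) by (auto simp: N_def)
    qed (use AD(1) BD(1-3) in \<open>auto simp: N_def\<close>)
    moreover have "N k \<le> N (Suc k)" for k using BD(3) by (auto simp: N_def le_fun_def)
    ultimately obtain k where k: "\<And>i. i \<ge> k \<Longrightarrow> N i = N k" using accD[OF acc, of N] by metis
    have "Lenr (B n) (A n) = 0" if "k \<le> n j" for n
    proof -
      have "N (Suc (n j)) n = N k n" using k[of "Suc (n j)"] that by simp
      then have "A n = B n" using that by (simp add: N_def)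
      then show ?thesis by simp
    qed
    then have "qp 0 1 (\<lambda>n. Lenr (B n) (A n))" by (auto intro: ev_I)
    then show ?thesis by (meson zero_less_one)
  next
    case False
    have "\<exists>\<alpha>>0. \<exists>D a. a > 0 \<and> qp D \<alpha> (diff_dir a j (\<lambda>n. Lenr (B n) (A n)))" for j
    proof -
      obtain x a where xa: "(x, a, j) \<in> S" using False by blast
      have x: "x \<in> carrier R" "a > 0" using S[OF xa] by auto
      interpret X: module_hom R M M "smult M x" by (rule module_hom_smult[OF x(1)])
      define S' where "S' = S - {(x, a, j)}"
      have S': "S' \<subset> S" "(y, b, i) \<in> S' \<Longrightarrow> (y, b, i) \<in> S" for y b i using xa by (auto simp: S'_def)
      have split: "(y, b, i) \<in> S \<Longrightarrow> (y, b, i) \<in> S' \<or> (y = x \<and> b = a \<and> i = j)" for y b i by (auto simp: S'_def)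
      \<comment> \<open>The kernel of \<open>x\<close> on \<open>A/B\<close>. A family between
        \<open>B\<close> and \<open>K\<close> is automatically stable under \<open>x\<close>, since
        \<open>x\<close> maps it into \<open>B\<close>.\<close>
      define K where "K n = {v \<in> A n. x \<odot>\<^bsub>M\<^esub> v \<in> B (bump j a n)}" for n
      have Ks: "K n \<in> submods R M" for n unfolding K_def by (rule X.preimage_submods[OF AD(1) BD(1)])
      have BK: "B n \<subseteq> K n" for n using BD(3,4) xa by (auto simp: K_def)
      have KA: "K n \<subseteq> A n" for n by (auto simp: K_def)
      have SS': "\<And>y b i. (y, b, i) \<in> S' \<Longrightarrow> y \<in> carrier R \<and> b > 0" using S S'(2) by blast
      have comm: "y \<odot>\<^bsub>M\<^esub> (x \<odot>\<^bsub>M\<^esub> v) = x \<odot>\<^bsub>M\<^esub> (y \<odot>\<^bsub>M\<^esub> v)" if "y \<in> carrier R" "v \<in> carrier M" for y v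
        using that x by (simp add: smult_assoc1[symmetric] R.m_comm)
      have K1: "K \<in> fam R M S' B K"
      proof (rule famI)
        fix y b i n v assume y: "(y, b, i) \<in> S'" "v \<in> K n"
        have "y \<odot>\<^bsub>M\<^esub> (x \<odot>\<^bsub>M\<^esub> v) \<in> B (bump i b (bump j a n))"
          using BD(4)[OF S'(2)[OF y(1)]] y(2) by (auto simp: K_def)
        then show "y \<odot>\<^bsub>M\<^esub> v \<in> K (bump i b n)"
          using y AD(4)[OF S'(2)[OF y(1)]] comm[of y v] S[OF S'(2)[OF y(1)]] As by (auto simp: K_def bump_commute)
      qed (use Ks BK in auto)
      have K2: "B \<in> fam R M S' B K" by (rule famI) (use BD BK S' in auto)
      have "fam R M S' B K \<subseteq> fam R M S B A"
      proof
        fix C assume C: "C \<in> fam R M S' B K"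
        show "C \<in> fam R M S B A"
        proof (rule famI)
          fix y b i n v assume y: "(y, b, i) \<in> S" "v \<in> C n"
          have "x \<odot>\<^bsub>M\<^esub> v \<in> C (bump j a n)" using famD(3)[OF C, of n] famD(2)[OF C, of "bump j a n"] y(2) by (auto simp: K_def)
          then show "y \<odot>\<^bsub>M\<^esub> v \<in> C (bump i b n)" using split[OF y(1)] famD(4)[OF C _ y(2)] by auto
        next
          show "C n \<subseteq> A n" for n using famD(3)[OF C, of n] KA by blast
        qed (use famD[OF C] in auto)
      qed
      then have K3: "acc (fam R M S' B K)" by (rule acc_subset[OF acc])
      have K4: "Len (B n) (K n) \<noteq> \<infinity>" for n using len_finite_sub[OF KA subset_refl fin] .
      have "\<exists>\<alpha>>0. \<exists>D. qp D \<alpha> (\<lambda>n. Lenr (B n) (K n))" by (rule psubset.IH[OF S'(1) SS' K1 K2 K3 K4])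
      then obtain \<alpha>1 D1 where qp1: "\<alpha>1 > 0" "qp D1 \<alpha>1 (\<lambda>n. Lenr (B n) (K n))"
        by blast
      define dn where "dn n = n(j := n j - a)" for n
      \<comment> \<open>The image of \<open>x\<close> plus \<open>B\<close>, with nothing in the
        image where \<open>n j\<close> is below \<open>a\<close>. As \<open>x\<close> maps all of
        \<open>A\<close> into \<open>Q\<close>, families between \<open>Q\<close> and
        \<open>A\<close> are automatically stable under \<open>x\<close>.\<close>
      define Q where "Q n = (if a \<le> n j then sub_sum M (smult M x ` A (dn n)) (B n) else B n)" for n
      have Xs: "smult M x ` A n \<in> submods R M" for n by (rule X.image_submods[OF AD(1)])
      have bdn: "a \<le> n j \<Longrightarrow> bump j a (dn n) = n" and dnb: "dn (bump j a n) = n" for n by (auto simp: dn_def bump_def)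
      have Qs: "Q n \<in> submods R M" for n using sub_sum_submods[OF Xs BD(1)] BD(1) by (auto simp: Q_def)
      have BQ: "B n \<subseteq> Q n" for n using sub_sum_ub2[OF Xs BD(1)] by (auto simp: Q_def)
      have QA: "Q n \<subseteq> A n" for n
      proof (cases "a \<le> n j")
        case True
        have "smult M x ` A (dn n) \<subseteq> A n" using AD(4)[OF xa, of _ "dn n"] bdn[of n, OF True] by auto
        then show ?thesis using True BD(3) sub_sum_least[OF AD(1)] by (simp add: Q_def)
      qed (use BD(3) in \<open>simp add: Q_def\<close>)
      have Qc: "y \<odot>\<^bsub>M\<^esub> v \<in> Q (bump i b n)" if y: "(y, b, i) \<in> S'" and v: "v \<in> Q n" for y b i n v
      proof (cases "a \<le> n j")
        case True
        then obtain u w where uw: "u \<in> A (dn n)" "w \<in> B n" "v = x \<odot>\<^bsub>M\<^esub> u \<oplus>\<^bsub>M\<^esub> w"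
          using v by (auto simp: Q_def elim!: sub_sum_E)
        have c: "u \<in> carrier M" "w \<in> carrier M" "y \<in> carrier R" using uw As submodsD(1)[OF BD(1)] S[OF S'(2)[OF y]] by auto
        have "y \<odot>\<^bsub>M\<^esub> v = x \<odot>\<^bsub>M\<^esub> (y \<odot>\<^bsub>M\<^esub> u) \<oplus>\<^bsub>M\<^esub> y \<odot>\<^bsub>M\<^esub> w" using c x uw by (simp add: smult_r_distr comm)
        moreover have "dn (bump i b n) = bump i b (dn n)" using True by (auto simp: dn_def bump_def fun_eq_iff)
        then have "y \<odot>\<^bsub>M\<^esub> u \<in> A (dn (bump i b n))" using AD(4)[OF S'(2)[OF y] uw(1)] by simp
        moreover have "y \<odot>\<^bsub>M\<^esub> w \<in> B (bump i b n)" using BD(4)[OF S'(2)[OF y] uw(2)] .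
        moreover have "a \<le> bump i b n j" using True bump_ge[of n j i b] by linarith
        ultimately show ?thesis by (auto simp: Q_def intro!: sub_sum_I)
      next
        case False
        then have "v \<in> B n" using v by (simp add: Q_def)
        then show ?thesis using BD(4)[OF S'(2)[OF y]] BQ by blast
      qed
      have Q1: "A \<in> fam R M S' Q A" by (rule famI) (use AD QA S' in auto)
      have Q2: "Q \<in> fam R M S' Q A" by (rule famI) (use Qs QA Qc in auto)
      have "fam R M S' Q A \<subseteq> fam R M S B A"
      proof
        fix C assume C: "C \<in> fam R M S' Q A"
        show "C \<in> fam R M S B A"
        proof (rule famI)
          fix y b i n v assume y: "(y, b, i) \<in> S" "v \<in> C n"
          have "v \<in> A (dn (bump j a n))" using famD(3)[OF C] y(2) dnb by auto
          then have "x \<odot>\<^bsub>M\<^esub> v \<in> Q (bump j a n)" using sub_sum_ub1[OF Xs BD(1)] by (auto simp: Q_def)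
          then have "x \<odot>\<^bsub>M\<^esub> v \<in> C (bump j a n)" using famD(2)[OF C] by blast
          then show "y \<odot>\<^bsub>M\<^esub> v \<in> C (bump i b n)" using split[OF y(1)] famD(4)[OF C _ y(2)] by auto
        next
          show "B n \<subseteq> C n" for n using famD(2)[OF C, of n] BQ by blast
        qed (use famD[OF C] in auto)
      qed
      then have Q3: "acc (fam R M S' Q A)" by (rule acc_subset[OF acc])
      have Q4: "Len (Q n) (A n) \<noteq> \<infinity>" for n using len_finite_sub[OF subset_refl BQ fin] .
      have "\<exists>\<alpha>>0. \<exists>D. qp D \<alpha> (\<lambda>n. Lenr (Q n) (A n))" by (rule psubset.IH[OF S'(1) SS' Q1 Q2 Q3 Q4])
      then obtain \<alpha>2 D2 where qp2: "\<alpha>2 > 0" "qp D2 \<alpha>2 (\<lambda>n. Lenr (Q n) (A n))"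
        by blast
      \<comment> \<open>The exact sequence: the image \<open>Q/B\<close> in the shifted degree has
        the same length as \<open>A/K\<close> in degree \<open>n\<close>, so the two cancel in the
        difference.\<close>
      have "diff_dir a j (\<lambda>n. Lenr (B n) (A n)) n = Lenr (Q (bump j a n)) (A (bump j a n)) - Lenr (B n) (K n)" for n
      proof -
        let ?n = "bump j a n"
        have "Q ?n = sub_sum M (smult M x ` A n) (B ?n)" by (simp add: Q_def dnb)
        then have "Len (B ?n) (Q ?n) = Len (K n) (A n)"
          using X.len_image[OF AD(1)[of n] BD(1)[of ?n]] by (simp add: K_def)
        then have "Lenr (B ?n) (Q ?n) = Lenr (K n) (A n)" by (simp add: len_rat_def)
        then show ?thesis
          using len_rat_add[OF AD(1) BD(1) Qs BQ QA fin, of ?n] len_rat_add[OF AD(1) BD(1) Ks BK KA fin, of n]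
          by (simp add: diff_dir_def)
      qed
      moreover have "qp (max D1 D2) (\<alpha>1 * \<alpha>2) (\<lambda>n. Lenr (Q (bump j a n)) (A (bump j a n)) - Lenr (B n) (K n))"
        using qp_mono[OF _ qp_scale[OF qp1(2), of \<alpha>2], of "max D1 D2"] qp_mono[OF _ qp_scale[OF qp2(2), of \<alpha>1], of "max D1 D2"]
        by (intro qp_diff qp_bump[of _ _ "\<lambda>n. Lenr (Q n) (A n)"]) (auto simp: mult.commute)
      ultimately have "qp (max D1 D2) (\<alpha>1 * \<alpha>2) (diff_dir a j (\<lambda>n. Lenr (B n) (A n)))" by presburger
      then show ?thesis using x(2) qp1(1) qp2(1) by (meson nat_0_less_mult_iff)
    qed
    then obtain \<alpha> D a where *: "\<And>j. a j > 0" "\<And>j. \<alpha> j > 0" "\<And>j. qp (D j) (\<alpha> j) (diff_dir (a j) j (\<lambda>n. Lenr (B n) (A n)))"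
      by metis
    obtain \<alpha>' D' where \<alpha>': "\<alpha>' > 0" "\<And>j. qp D' \<alpha>' (diff_dir (a j) j (\<lambda>n. Lenr (B n) (A n)))"
      using qp_common[of "\<lambda>j. diff_dir (a j) j (\<lambda>n. Lenr (B n) (A n))"] *(2,3) by blast
    have "qp (Suc D') (prod a UNIV * \<alpha>') (\<lambda>n. Lenr (B n) (A n))"
    proof (rule qp_from_steps)
      fix j
      have "a j dvd prod a UNIV * \<alpha>'" by (rule dvd_mult2, rule dvd_prodI) auto
      then show "\<exists>a'. a' dvd prod a UNIV * \<alpha>' \<and> qp D' (prod a UNIV * \<alpha>') (diff_dir a' j (\<lambda>n. Lenr (B n) (A n)))"
        using qp_scale[OF \<alpha>'(2)] by blast
    qed
    moreover have "prod a UNIV * \<alpha>' > 0" using *(1) \<alpha>'(1) by (simp add: prod_pos)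
    ultimately show ?thesis by blast
  qed
qed

end

section \<open>Multi-Rees algebras and the lengths of \<open>A/(J_n A + B)\<close>\<close>

text \<open>\<open>J\<close> is the family of graded pieces of the multigraded algebra generated by \<open>S\<close>.\<close>

locale rees_family = cring R for R (structure) +
  fixes S :: "('a \<times> nat \<times> 'r::finite) set" and J :: "('r \<Rightarrow> nat) \<Rightarrow> 'a set"
  assumes finite_S: "finite S" and S_carrier: "(x, a, j) \<in> S \<Longrightarrow> x \<in> carrier R \<and> a > 0"
    and J_ideal: "ideal (J n) R" and J_zero: "J (\<lambda>_. 0) = carrier R"
    and J_S: "(x, a, j) \<in> S \<Longrightarrow> u \<in> J n \<Longrightarrow> x \<otimes> u \<in> J (bump j a n)"
    and J_antimono: "(\<And>j. n j \<le> n' j) \<Longrightarrow> J n' \<subseteq> J n"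
    and J_least: "(\<And>n. ideal (P n) R) \<Longrightarrow> P (\<lambda>_. 0) = carrier R \<Longrightarrow>
      (\<And>x a j u n. (x, a, j) \<in> S \<Longrightarrow> u \<in> P n \<Longrightarrow> x \<otimes> u \<in> P (bump j a n)) \<Longrightarrow> J n \<subseteq> P n"

locale rees_family_module = module R M + rees_family R S J for R (structure) and M (structure) and S and J
begin

lemma J_carrier: "J n \<subseteq> carrier R"
  using ideal.Icarr[OF J_ideal] by blast

lemma JA_submods: "A \<in> submods R M \<Longrightarrow> ideal_mult R M (J n) A \<in> submods R M"
  using ideal_mult_submods[OF J_carrier submods_subset] .

text \<open>The elements carrying \<open>A\<close> into \<open>T n\<close> form ideals that are
  everything in degree zero and are respected by the operators, so the minimality of
  \<open>J\<close> applies to them.\<close>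

lemma J_subset_colon:
  assumes "T \<in> fam R M S B T" "A \<subseteq> T (\<lambda>_. 0)" "A \<subseteq> carrier M" shows "J n \<subseteq> colon R M (T n) A"
proof (rule J_least)
  note TD = famD[OF assms(1)]
  show "ideal (colon R M (T n) A) R" for n by (rule colon_ideal[OF TD(1) assms(3)])
  show "colon R M (T (\<lambda>_. 0)) A = carrier R" using submodsD(4)[OF TD(1)] assms(2) by (auto simp: colon_def)
  fix x a j u n assume "(x, a, j) \<in> S" "u \<in> colon R M (T n) A"
  then show "x \<otimes> u \<in> colon R M (T (bump j a n)) A"
    using S_carrier[of x a j] TD(4)[of x a j] assms(3) by (auto simp: colon_def smult_assoc1 subset_iff)
qed

lemma smult_JA:
  assumes "(x, a, j) \<in> S" "A \<in> submods R M" "v \<in> ideal_mult R M (J n) A"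
  shows "x \<odot>\<^bsub>M\<^esub> v \<in> ideal_mult R M (J (bump j a n)) A"
proof -
  have x: "x \<in> carrier R" using S_carrier assms(1) by blast
  interpret X: module_hom R M M "smult M x" by (rule module_hom_smult[OF x])
  have "ideal_mult R M (J n) A \<subseteq> {v \<in> carrier M. x \<odot>\<^bsub>M\<^esub> v \<in> ideal_mult R M (J (bump j a n)) A}"
  proof (rule ideal_mult_least[OF X.preimage_submods[OF carrier_submods JA_submods[OF assms(2)]]])
    fix u w assume uw: "u \<in> J n" "w \<in> A"
    then have c: "u \<in> carrier R" "w \<in> carrier M" using J_carrier submodsD(1)[OF assms(2)] by auto
    then have "x \<odot>\<^bsub>M\<^esub> (u \<odot>\<^bsub>M\<^esub> w) = (x \<otimes> u) \<odot>\<^bsub>M\<^esub> w" using x by (simp add: smult_assoc1)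
    then show "u \<odot>\<^bsub>M\<^esub> w \<in> {v \<in> carrier M. x \<odot>\<^bsub>M\<^esub> v \<in> ideal_mult R M (J (bump j a n)) A}"
      using c ideal_mult_I[OF J_S[OF assms(1) uw(1)] uw(2)] by simp
  qed
  then show ?thesis using assms(3) by blast
qed

lemma JA_plus_B_fam:
  assumes "A \<in> submods R M" "B \<in> submods R M"
  shows "(\<lambda>n. sub_sum M (ideal_mult R M (J n) A) B) \<in> fam R M S (\<lambda>_. B) (\<lambda>n. sub_sum M (ideal_mult R M (J n) A) B)"
proof (rule famI)
  note s = JA_submods[OF assms(1)]
  show "sub_sum M (ideal_mult R M (J n) A) B \<in> submods R M" for n by (rule sub_sum_submods[OF s assms(2)])
  show "B \<subseteq> sub_sum M (ideal_mult R M (J n) A) B" for n by (rule sub_sum_ub2[OF s assms(2)])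
  fix x a j n v assume *: "(x, a, j) \<in> S" "v \<in> sub_sum M (ideal_mult R M (J n) A) B"
  then obtain w b where wb: "w \<in> ideal_mult R M (J n) A" "b \<in> B" "v = w \<oplus>\<^bsub>M\<^esub> b" by (auto elim!: sub_sum_E)
  have c: "w \<in> carrier M" "b \<in> carrier M" "x \<in> carrier R"
    using wb submodsD(1)[OF s] submodsD(1)[OF assms(2)] S_carrier[OF *(1)] by auto
  then have "x \<odot>\<^bsub>M\<^esub> v = x \<odot>\<^bsub>M\<^esub> w \<oplus>\<^bsub>M\<^esub> x \<odot>\<^bsub>M\<^esub> b" using wb by (simp add: smult_r_distr)
  then show "x \<odot>\<^bsub>M\<^esub> v \<in> sub_sum M (ideal_mult R M (J (bump j a n)) A) B"
    using smult_JA[OF *(1) assms(1) wb(1)] submodsD(4)[OF assms(2) c(3) wb(2)] by (auto intro!: sub_sum_I)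
qed auto

text \<open>By \<open>J_subset_colon\<close> the family lies inside one provided by
  \<open>acc_fam_exists\<close>, and the chain condition passes to smaller families.\<close>

lemma acc_JA_plus_B:
  assumes "acc (submods R M)" "A \<in> submods R M" "B \<in> submods R M" "B \<subseteq> A"
  shows "acc (fam R M S (\<lambda>_. B) (\<lambda>n. sub_sum M (ideal_mult R M (J n) A) B))"
proof -
  obtain T where T: "T \<in> fam R M S (\<lambda>_. B) T" "A \<subseteq> T (\<lambda>_. 0)" "acc (fam R M S (\<lambda>_. B) T)"
    using acc_fam_exists[OF finite_S _ assms] S_carrier by blast
  have "sub_sum M (ideal_mult R M (J n) A) B \<subseteq> T n" for n
    using J_subset_colon[OF T(1,2) submods_subset[OF assms(2)]] famD(1,2)[OF T(1)]
    by (intro sub_sum_least) (auto simp: ideal_mult_subset_iff J_carrier)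
  then have "fam R M S (\<lambda>_. B) (\<lambda>n. sub_sum M (ideal_mult R M (J n) A) B) \<subseteq> fam R M S (\<lambda>_. B) T"
    unfolding fam_def by blast
  then show ?thesis by (rule acc_subset[OF T(3)])
qed

text \<open>The difference in direction \<open>j\<close> is the length of \<open>F n\<close> modulo
  \<open>F\<close> one step further, and this quotient inherits the chain condition of
  \<open>F\<close>. The quotients \<open>A/F n\<close> themselves do not in general form a
  Noetherian graded module, hence the passage through differences.\<close>

lemma hilbert_qp:
  assumes "acc (submods R M)" "A \<in> submods R M" "B \<in> submods R M" "B \<subseteq> A"
    and fin: "\<And>n. Len (sub_sum M (ideal_mult R M (J n) A) B) A \<noteq> \<infinity>"
  shows "\<exists>\<alpha>>0. \<exists>D. qp D \<alpha> (\<lambda>n. Lenr (sub_sum M (ideal_mult R M (J n) A) B) A)"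
proof -
  define F where "F n = sub_sum M (ideal_mult R M (J n) A) B" for n
  have FF: "F \<in> fam R M S (\<lambda>_. B) F" unfolding F_def[abs_def] by (rule JA_plus_B_fam[OF assms(2,3)])
  have acc: "acc (fam R M S (\<lambda>_. B) F)" unfolding F_def[abs_def] by (rule acc_JA_plus_B[OF assms(1-4)])
  note FD = famD[OF FF]
  have FA: "F n \<subseteq> A" for n unfolding F_def
    by (rule sub_sum_least[OF assms(2) ideal_mult_subset[OF assms(2) J_carrier] assms(4)])
  have Fle: "F (bump j 1 n) \<subseteq> F n" for j n
    unfolding F_def using assms(2) submods_subset bump_ge
    by (intro sub_sum_mono ideal_mult_mono J_carrier J_antimono) auto
  have "\<exists>\<alpha>>0. \<exists>D. qp D \<alpha> (diff_dir 1 j (\<lambda>n. Lenr (F n) A))" for j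
  proof -
    define F' where "F' n = F (bump j 1 n)" for n
    have F'F: "F' n \<subseteq> F n" for n using Fle by (simp add: F'_def)
    have 1: "F \<in> fam R M S F' F" by (rule famI) (use FD F'F in auto)
    have 2: "F' \<in> fam R M S F' F"
    proof (rule famI)
      fix x a i n v assume "(x, a, i) \<in> S" "v \<in> F' n"
      then show "x \<odot>\<^bsub>M\<^esub> v \<in> F' (bump i a n)"
        using FD(4)[of x a i v "bump j 1 n"] by (simp add: F'_def bump_commute[of i a j])
    qed (use FD F'F in \<open>auto simp: F'_def\<close>)
    have "fam R M S F' F \<subseteq> fam R M S (\<lambda>_. B) F"
      using FD(2) unfolding fam_def F'_def by blast
    then have 3: "acc (fam R M S F' F)" by (rule acc_subset[OF acc])
    have fin': "Len (F n) A \<noteq> \<infinity>" for n using fin by (simp add: F_def)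
    then have 4: "Len (F' n) (F n) \<noteq> \<infinity>" for n
      using len_finite_sub[OF FA subset_refl, of "F' n"] unfolding F'_def by blast
    have "\<exists>\<alpha>>0. \<exists>D. qp D \<alpha> (\<lambda>n. Lenr (F' n) (F n))" by (rule qp_len[OF finite_S S_carrier 1 2 3 4])
    moreover have "diff_dir 1 j (\<lambda>n. Lenr (F n) A) = (\<lambda>n. Lenr (F' n) (F n))"
      using len_rat_add[OF assms(2) FD(1) FD(1) Fle FA fin'] by (simp add: diff_dir_def F'_def fun_eq_iff)
    ultimately show ?thesis by presburger
  qed
  then obtain \<alpha> D where \<alpha>: "\<alpha> > 0" "\<And>j. qp D \<alpha> (diff_dir 1 j (\<lambda>n. Lenr (F n) A))"
    using qp_common[of "\<lambda>j. diff_dir 1 j (\<lambda>n. Lenr (F n) A)"] by blast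
  then have "qp (Suc D) \<alpha> (\<lambda>n. Lenr (F n) A)" by (intro qp_from_steps) (meson one_dvd)
  then show ?thesis using \<alpha>(1) unfolding F_def by blast
qed

end

section \<open>Hilbert--Samuel functions over a Noetherian local ring\<close>

primrec ideal_pow :: "('a, 'c) ring_scheme \<Rightarrow> 'a set \<Rightarrow> nat \<Rightarrow> 'a set" where
  "ideal_pow R I 0 = carrier R"
| "ideal_pow R I (Suc N) = ideal_prod R I (ideal_pow R I N)"

context cring
begin

lemma ideal_pow_ideal: "ideal I R \<Longrightarrow> ideal (ideal_pow R I N) R"
  by (induction N) (auto simp: oneideal ideal_prod_is_ideal)

lemma ideal_pow_carrier: "ideal I R \<Longrightarrow> ideal_pow R I N \<subseteq> carrier R"
  using ideal.Icarr[OF ideal_pow_ideal] by blast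

lemma ideal_pow_Suc_subset: "ideal I R \<Longrightarrow> ideal_pow R I (Suc N) \<subseteq> ideal_pow R I N"
  using ideal_prod_inter[OF _ ideal_pow_ideal, of I I N] by simp

lemma ideal_pow_antimono: "ideal I R \<Longrightarrow> N \<le> N' \<Longrightarrow> ideal_pow R I N' \<subseteq> ideal_pow R I N"
  by (rule lift_Suc_antimono_le[of "ideal_pow R I"]) (use ideal_pow_Suc_subset in auto)

lemma ideal_prod_one_left: "ideal I R \<Longrightarrow> ideal_prod R (carrier R) I = I"
  using ideal_prod_one ideal_prod_commute[OF oneideal] by simp

lemma ideal_pow_add: "ideal I R \<Longrightarrow> ideal_prod R (ideal_pow R I a) (ideal_pow R I b) = ideal_pow R I (a + b)"
  by (induction a) (auto simp: ideal_prod_one_left ideal_pow_ideal ideal_prod_assoc)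

lemma ideal_prod_mono: "I \<subseteq> I' \<Longrightarrow> J \<subseteq> J' \<Longrightarrow> ideal_prod R I J \<subseteq> ideal_prod R I' J'"
  by (rule ideal_prod_least) (auto intro: ideal_prod.intros)

lemma ideal_pow_1: "ideal I R \<Longrightarrow> ideal_pow R I (Suc 0) = I"
  by (simp add: ideal_prod_one)

lemma prime_ideal_pow:
  assumes "primeideal P R" "ideal I R" "ideal_pow R I q \<subseteq> P" shows "I \<subseteq> P"
  using assms(3)
proof (induction q)
  case 0
  then show ?case using primeideal.I_notcarr[OF assms(1)] ideal.Icarr[OF primeideal.axioms(1)[OF assms(1)]] by auto
next
  case (Suc q)
  then show ?case using primeideal_divides_ideal_prod[OF assms(1,2) ideal_pow_ideal[OF assms(2)]] by auto
qed

end

locale noeth_local = cring R + noetherian_ring R for R (structure) +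
  fixes m
  assumes m_max: "maximalideal m R" and m_unique: "maximalideal m' R \<Longrightarrow> m' = m"
begin

abbreviation "pw \<equiv> ideal_pow R m"

lemma m_ideal: "ideal m R" using maximalideal.axioms(1)[OF m_max] .

lemma m_prime: "primeideal m R" by (rule maximalideal_prime[OF m_max])

lemmas pw_ideal = ideal_pow_ideal[OF m_ideal] and pw_carrier = ideal_pow_carrier[OF m_ideal]

lemma proper_subset_m:
  assumes "ideal I R" "I \<noteq> carrier R" shows "I \<subseteq> m"
proof -
  let ?X = "{J. ideal J R \<and> I \<subseteq> J \<and> J \<noteq> carrier R}"
  obtain J where J: "J \<in> ?X" "\<forall>y\<in>?X. \<not> J < y"
    using acc_maximal[OF acc_ideals, of ?X I] assms by blast
  have "maximalideal J R"
  proof (rule maximalidealI)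
    fix K assume "ideal K R" "J \<subseteq> K" "K \<subseteq> carrier R"
    then show "K = J \<or> K = carrier R" using J by blast
  qed (use J in auto)
  then show ?thesis using m_unique J by blast
qed

lemma prime_subset_m: "primeideal P R \<Longrightarrow> P \<subseteq> m"
  using proper_subset_m[OF primeideal.axioms(1)] primeideal.I_notcarr by metis

text \<open>Powers of \<open>m\<close> are the multigraded case with index type \<open>unit\<close>;
  the operators are finitely many generators of \<open>m\<close>, all of degree one.\<close>

lemma rees_pow:
  obtains S where "rees_family R S (\<lambda>n :: unit \<Rightarrow> nat. pw (n ()))"
proof -
  obtain X where X: "X \<subseteq> carrier R" "finite X" "m = Idl X" using finetely_gen[OF m_ideal] by blast
  have Xm: "X \<subseteq> m" using genideal_self[OF X(1)] X(3) by simp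
  have "rees_family R ((\<lambda>x. (x, 1, ())) ` X) (\<lambda>n :: unit \<Rightarrow> nat. pw (n ()))"
  proof (rule rees_family.intro[OF is_cring], rule rees_family_axioms.intro)
    fix x j u and a :: nat and n :: "unit \<Rightarrow> nat"
    assume "(x, a, j) \<in> (\<lambda>x. (x, 1, ())) ` X" "u \<in> pw (n ())"
    then show "x \<otimes> u \<in> pw (bump j a n ())" using Xm by (auto simp: bump_def intro!: ideal_prod.prod)
  next
    fix n n' :: "unit \<Rightarrow> nat" assume "\<And>j. n j \<le> n' j"
    then show "pw (n' ()) \<subseteq> pw (n ())" by (rule ideal_pow_antimono[OF m_ideal])
  next
    fix P and n :: "unit \<Rightarrow> nat"
    assume P: "\<And>n. ideal (P n) R" "P (\<lambda>_. 0) = carrier R"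
      "\<And>x a j u n. (x, a, j) \<in> (\<lambda>x. (x, 1, ())) ` X \<Longrightarrow> u \<in> P n \<Longrightarrow> x \<otimes> u \<in> P (bump j a n)"
    have "pw N \<subseteq> P (\<lambda>_. N)" for N
    proof (induction N)
      case (Suc N)
      interpret S: module R "self_module R" by (rule module_self)
      have "P (\<lambda>_. Suc N) \<in> submods R (self_module R)" using P(1) by (simp add: submods_self)
      then have "ideal (colon R (self_module R) (P (\<lambda>_. Suc N)) (P (\<lambda>_. N))) R"
        by (rule S.colon_ideal) (use ideal.Icarr[OF P(1)] in auto)
      moreover have "X \<subseteq> colon R (self_module R) (P (\<lambda>_. Suc N)) (P (\<lambda>_. N))"
      proof
        fix x assume x: "x \<in> X"
        have "bump () 1 (\<lambda>_. N) = (\<lambda>_. Suc N)" by (auto simp: bump_def)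
        then have "x \<otimes> u \<in> P (\<lambda>_. Suc N)" if "u \<in> P (\<lambda>_. N)" for u
          using P(3)[of x 1 "()" u "\<lambda>_. N"] x that by auto
        then show "x \<in> colon R (self_module R) (P (\<lambda>_. Suc N)) (P (\<lambda>_. N))" using x X(1) by (auto simp: colon_def)
      qed
      ultimately have "m \<subseteq> colon R (self_module R) (P (\<lambda>_. Suc N)) (P (\<lambda>_. N))"
        unfolding X(3) by (rule genideal_minimal)
      then have "a \<otimes> b \<in> P (\<lambda>_. Suc N)" if "a \<in> m" "b \<in> pw N" for a b
        using that Suc by (auto simp: colon_def)
      then have "ideal_prod R m (pw N) \<subseteq> P (\<lambda>_. Suc N)"
        using additive_subgroup.a_closed[OF ideal.axioms(1)[OF P(1)]] by (intro ideal_prod_least) auto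
      then show ?case by simp
    qed (simp add: P(2))
    from this[of "n ()"] show "pw (n ()) \<subseteq> P n" by (metis (full_types) old.unit.exhaust ext)
  qed (use X pw_ideal in auto)
  then show ?thesis by (rule that)
qed

end

text \<open>The Hilbert-Samuel function of the module \<open>A/B\<close> with respect to
  \<open>m\<close>.\<close>

definition hs ::
  "('a, 'c) ring_scheme \<Rightarrow> ('a, 'b, 'd) module_scheme \<Rightarrow> 'a set \<Rightarrow> 'b set \<Rightarrow> 'b set \<Rightarrow> nat \<Rightarrow> rat" where
  "hs R M m B A N = len_rat (submods R M) (sub_sum M (ideal_mult R M (ideal_pow R m N) A) B) A"

lemma hs_nonneg: "0 \<le> hs R M m B A N"
  by (simp add: hs_def len_rat_nonneg)

context module
begin

lemma sub_sum_commute: "A \<in> submods R M \<Longrightarrow> B \<in> submods R M \<Longrightarrow> sub_sum M A B = sub_sum M B A"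
  using sub_sum_least[OF sub_sum_submods[of B A], of A B] sub_sum_least[OF sub_sum_submods[of A B], of B A]
    sub_sum_ub1 sub_sum_ub2 by blast

lemma image_carrier_cyc: "(\<lambda>a. a \<odot>\<^bsub>M\<^esub> v) ` carrier R = cyc R M v"
  by (auto simp: cyc_def)

text \<open>Reflects the isomorphism of \<open>(B + Rv)/B\<close> with \<open>R\<close> modulo the
  annihilator of \<open>v\<close>; the right side no longer mentions \<open>M\<close>.\<close>

lemma len_cyc:
  assumes B: "B \<in> submods R M" and v: "v \<in> carrier M"
  shows "Len B (sub_sum M B (cyc R M v)) = len {I. ideal I R} (colon R M B {v}) (carrier R)"
proof -
  interpret V: module_hom R "self_module R" M "\<lambda>a. a \<odot>\<^bsub>M\<^esub> v" by (rule module_hom_cyc[OF v])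
  have "carrier R \<in> submods R (self_module R)" by (simp add: R.submods_self R.oneideal)
  from V.len_image[OF this B] show ?thesis
    by (simp add: image_carrier_cyc R.submods_self sub_sum_commute[OF B cyc_submods[OF v]] colon_def)
qed

lemma colon_cyc: "B \<in> submods R M \<Longrightarrow> v \<in> carrier M \<Longrightarrow> a \<in> colon R M B {v} \<Longrightarrow> x \<in> cyc R M v \<Longrightarrow> a \<odot>\<^bsub>M\<^esub> x \<in> B"
proof -
  assume *: "B \<in> submods R M" "v \<in> carrier M" "a \<in> colon R M B {v}" "x \<in> cyc R M v"
  then obtain r where r: "r \<in> carrier R" "x = r \<odot>\<^bsub>M\<^esub> v" by (auto simp: cyc_def)
  then have "a \<odot>\<^bsub>M\<^esub> x = r \<odot>\<^bsub>M\<^esub> (a \<odot>\<^bsub>M\<^esub> v)" using * by (simp add: colon_def smult_assoc1[symmetric] R.m_comm)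
  then show ?thesis using * r submodsD(4) by (auto simp: colon_def)
qed

lemma ideal_mult_cyc:
  assumes "ideal J R" "v \<in> carrier M" shows "ideal_mult R M J (cyc R M v) = (\<lambda>a. a \<odot>\<^bsub>M\<^esub> v) ` J"
proof (rule antisym)
  interpret V: module_hom R "self_module R" M "\<lambda>a. a \<odot>\<^bsub>M\<^esub> v" by (rule module_hom_cyc[OF assms(2)])
  have J: "J \<in> submods R (self_module R)" using assms(1) by (simp add: R.submods_self)
  show "ideal_mult R M J (cyc R M v) \<subseteq> (\<lambda>a. a \<odot>\<^bsub>M\<^esub> v) ` J"
  proof (rule ideal_mult_least[OF V.image_submods[OF J]])
    fix a x assume a: "a \<in> J" "x \<in> cyc R M v"
    then obtain r where r: "r \<in> carrier R" "x = r \<odot>\<^bsub>M\<^esub> v" by (auto simp: cyc_def)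
    have "a \<in> carrier R" "a \<otimes> r \<in> J" using a r ideal.Icarr[OF assms(1)] ideal.I_r_closed[OF assms(1)] by auto
    moreover have "a \<odot>\<^bsub>M\<^esub> x = (a \<otimes> r) \<odot>\<^bsub>M\<^esub> v" using r assms(2) calculation by (simp add: smult_assoc1)
    ultimately show "a \<odot>\<^bsub>M\<^esub> x \<in> (\<lambda>a. a \<odot>\<^bsub>M\<^esub> v) ` J" by blast
  qed
  show "(\<lambda>a. a \<odot>\<^bsub>M\<^esub> v) ` J \<subseteq> ideal_mult R M J (cyc R M v)"
    using ideal_mult_I cyc_mem[OF assms(2)] by blast
qed

end

section \<open>Prime filtrations, powers of the maximal ideal, and the Artin-Rees lemma\<close>

locale noeth_local_module = module R M + noeth_local R m for R (structure) and M (structure) and m +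
  assumes accM: "acc (submods R M)"
begin

text \<open>Existence of associated primes. A maximal annihilator among nonzero classes is prime: if
  \<open>b v\<close> is not in \<open>B\<close>, its annihilator contains that of \<open>v\<close>,
  hence equals it, so \<open>a b v\<close> in \<open>B\<close> forces \<open>a v\<close> into
  \<open>B\<close>.\<close>

lemma prime_colon_exists:
  assumes A: "A \<in> submods R M" and B: "B \<in> submods R M" and BA: "B \<subset> A"
  shows "\<exists>v\<in>A - B. primeideal (colon R M B {v}) R"
proof -
  let ?X = "{colon R M B {v} |v. v \<in> A - B}"
  have id: "v \<in> A \<Longrightarrow> ideal (colon R M B {v}) R" for v using colon_ideal[OF B, of "{v}"] submodsD(1)[OF A] by simp
  obtain v0 where "v0 \<in> A - B" using BA by blast
  then obtain P where P: "P \<in> ?X" "\<forall>y\<in>?X. \<not> P < y"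
    using acc_maximal[OF acc_ideals, of ?X "colon R M B {v0}"] id by blast
  then obtain v where v: "v \<in> A" "v \<notin> B" "P = colon R M B {v}" by blast
  have vM: "v \<in> carrier M" using v submodsD(1)[OF A] by blast
  have "primeideal P R"
  proof (rule primeidealI)
    show "ideal P R" using id v by simp
    have "\<one> \<notin> P" using v vM by (simp add: colon_def)
    then show "carrier R \<noteq> P" by blast
    fix a b assume ab: "a \<in> carrier R" "b \<in> carrier R" "a \<otimes> b \<in> P"
    show "a \<in> P \<or> b \<in> P"
    proof (cases "b \<in> P")
      case False
      then have "b \<odot>\<^bsub>M\<^esub> v \<in> A - B" using v ab submodsD(4)[OF A] by (auto simp: colon_def)
      then have "\<not> P < colon R M B {b \<odot>\<^bsub>M\<^esub> v}" using P(2) by blast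
      moreover have "P \<subseteq> colon R M B {b \<odot>\<^bsub>M\<^esub> v}"
        using colon_cyc[OF B vM] v(3) ab(2) by (auto simp: colon_def cyc_def)
      ultimately have "P = colon R M B {b \<odot>\<^bsub>M\<^esub> v}" by blast
      moreover have "a \<in> colon R M B {b \<odot>\<^bsub>M\<^esub> v}" using ab v vM by (auto simp: colon_def smult_assoc1)
      ultimately show ?thesis by blast
    qed simp
  qed (rule R.is_cring)
  then show ?thesis using v by blast
qed

text \<open>Induction along a filtration of \<open>A/B\<close> with quotients \<open>R/P\<close>, \<open>P\<close> prime.\<close>

lemma prime_filtration_induct [consumes 3, case_names refl step]:
  assumes "A \<in> submods R M" "B \<in> submods R M" "B \<subseteq> A" and "Q A"
    and "\<And>B v. B \<in> submods R M \<Longrightarrow> B \<subseteq> A \<Longrightarrow> v \<in> A \<Longrightarrow> v \<in> carrier M \<Longrightarrow> v \<notin> B \<Longrightarrow> primeideal (colon R M B {v}) R \<Longrightarrow>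
       sub_sum M B (cyc R M v) \<in> submods R M \<Longrightarrow> B \<subseteq> sub_sum M B (cyc R M v) \<Longrightarrow> sub_sum M B (cyc R M v) \<subseteq> A \<Longrightarrow>
       Q (sub_sum M B (cyc R M v)) \<Longrightarrow> Q B"
  shows "Q B"
proof -
  have "B \<subseteq> A \<longrightarrow> Q B"
    using accM assms(2)
  proof (induction B rule: acc_induct)
    case (step B)
    show ?case
    proof
      assume BA: "B \<subseteq> A"
      show "Q B"
      proof (cases "B = A")
        case False
        then obtain v where v: "v \<in> A" "v \<notin> B" "primeideal (colon R M B {v}) R"
          using prime_colon_exists[OF assms(1) step(1)] BA by blast
        have vM: "v \<in> carrier M" using v submodsD(1)[OF assms(1)] by blast
        note c = cyc_submods[OF vM]
        have s: "sub_sum M B (cyc R M v) \<in> submods R M" "B \<subseteq> sub_sum M B (cyc R M v)" "sub_sum M B (cyc R M v) \<subseteq> A"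
          using sub_sum_submods[OF step(1) c] sub_sum_ub1[OF step(1) c] sub_sum_least[OF assms(1) BA]
            cyc_subset_iff[OF assms(1) vM] v by auto
        moreover have "v \<in> sub_sum M B (cyc R M v)" using sub_sum_ub2[OF step(1) c] cyc_mem[OF vM] by blast
        ultimately have "Q (sub_sum M B (cyc R M v))" using step(2)[OF s(1)] v by blast
        then show ?thesis using assms(5)[OF step(1) BA v(1) vM v(2,3) s] by blast
      qed (use assms(4) in simp)
    qed
  qed
  then show ?thesis using assms(3) by blast
qed

text \<open>Each prime in a prime filtration of \<open>A/B\<close> contains \<open>m^q\<close>,
  hence equals \<open>m\<close>, and the factor \<open>R/m\<close> has length at most one.\<close>

lemma len_finite:
  assumes "A \<in> submods R M" "B \<in> submods R M" "B \<subseteq> A" "ideal_mult R M (pw q) A \<subseteq> B"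
  shows "Len B A \<noteq> \<infinity>"
proof -
  have "ideal_mult R M (pw q) A \<subseteq> B \<longrightarrow> Len B A \<noteq> \<infinity>"
    using assms(1-3)
  proof (induction rule: prime_filtration_induct)
    case refl
    then show ?case by (simp add: len_self)
  next
    case (step B v)
    show ?case
    proof
      assume q: "ideal_mult R M (pw q) A \<subseteq> B"
      let ?P = "colon R M B {v}" and ?C = "sub_sum M B (cyc R M v)"
      have "pw q \<subseteq> ?P" using ideal_mult_subset_iff[OF step(1) pw_carrier, of q A] q step(3) by (auto simp: colon_def)
      then have "m \<subseteq> ?P" by (rule prime_ideal_pow[OF step(6) m_ideal])
      then have P: "?P = m" using prime_subset_m[OF step(6)] by blast
      have "len {I. ideal I R} m (carrier R) \<le> 1"
        by (rule len_simple_le) (use maximalideal.I_maximal[OF m_max] in auto)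
      then have "Len B ?C \<le> 1" using len_cyc[OF step(1,4)] P by simp
      moreover have "Len ?C A \<noteq> \<infinity>" using step(10) q step(8) by blast
      ultimately show "Len B A \<noteq> \<infinity>"
        using len_add[OF assms(1) step(1) step(7) step(8,9)] by (cases "Len B ?C"; cases "Len ?C A") auto
    qed
  qed
  then show ?thesis using assms(4) by blast
qed

abbreviation "mpow N A \<equiv> ideal_mult R M (pw N) A"

lemma mpow_submods: "A \<in> submods R M \<Longrightarrow> mpow N A \<in> submods R M"
  using ideal_mult_submods[OF pw_carrier submods_subset] .

lemma mpow_subset: "A \<in> submods R M \<Longrightarrow> mpow N A \<subseteq> A"
  by (rule ideal_mult_subset[OF _ pw_carrier])

lemma mpow_Suc: "A \<in> submods R M \<Longrightarrow> mpow (Suc N) A = ideal_mult R M m (mpow N A)"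
  using ideal_mult_prod[OF m_ideal pw_ideal submods_subset] by simp

lemma mpow_add: "A \<in> submods R M \<Longrightarrow> mpow (a + b) A = mpow a (mpow b A)"
  using ideal_mult_prod[OF pw_ideal pw_ideal submods_subset, of A a b] by (simp add: ideal_pow_add[OF m_ideal])

lemma mpow_antimono: "A \<in> submods R M \<Longrightarrow> N \<le> N' \<Longrightarrow> mpow N' A \<subseteq> mpow N A"
  using ideal_mult_mono[OF ideal_pow_antimono[OF m_ideal] subset_refl pw_carrier submods_subset] .

lemma mpow_mono: "A' \<in> submods R M \<Longrightarrow> A \<subseteq> A' \<Longrightarrow> mpow N A \<subseteq> mpow N A'"
  using ideal_mult_mono[OF subset_refl _ pw_carrier submods_subset] .

lemma mpow_1: "A \<in> submods R M \<Longrightarrow> mpow (Suc 0) A = ideal_mult R M m A"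
  using ideal_pow_1[OF m_ideal] by simp

abbreviation "mB N B A \<equiv> sub_sum M (mpow N A) B"

lemma mB_submods: "A \<in> submods R M \<Longrightarrow> B \<in> submods R M \<Longrightarrow> mB N B A \<in> submods R M"
  using sub_sum_submods[OF mpow_submods] .

lemma mB_ub: "A \<in> submods R M \<Longrightarrow> B \<in> submods R M \<Longrightarrow> B \<subseteq> mB N B A" "A \<in> submods R M \<Longrightarrow> B \<in> submods R M \<Longrightarrow> mpow N A \<subseteq> mB N B A"
  by (simp_all add: sub_sum_ub2[OF mpow_submods] sub_sum_ub1[OF mpow_submods])

lemma mB_subset: "A \<in> submods R M \<Longrightarrow> B \<subseteq> A \<Longrightarrow> mB N B A \<subseteq> A"
  using sub_sum_least[OF _ mpow_subset] by blast

lemma mB_finite: "A \<in> submods R M \<Longrightarrow> B \<in> submods R M \<Longrightarrow> B \<subseteq> A \<Longrightarrow> Len (mB N B A) A \<noteq> \<infinity>"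
  using len_finite[OF _ mB_submods mB_subset mB_ub(2)] .

lemma mB_step:
  assumes "A \<in> submods R M" "B \<in> submods R M" shows "ideal_mult R M m (mB N B A) \<subseteq> mB (Suc N) B A"
proof -
  have "ideal_mult R M m (mB N B A) \<subseteq> sub_sum M (ideal_mult R M m (mpow N A)) (ideal_mult R M m B)"
    using ideal_mult_sub_sum[OF _ mpow_submods[OF assms(1)] assms(2)] ideal.Icarr[OF m_ideal] by blast
  also have "\<dots> \<subseteq> sub_sum M (mpow (Suc N) A) B"
    unfolding mpow_Suc[OF assms(1)] using ideal_mult_subset[OF assms(2)] ideal.Icarr[OF m_ideal]
    by (intro sub_sum_mono) auto
  finally show ?thesis .
qed

text \<open>Put \<open>F N = C \<inter> (m^N A + B)\<close>. The families \<open>G k\<close>, which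
  follow \<open>F\<close> up to \<open>k\<close> and from there on take powers of \<open>m\<close>
  times \<open>F k\<close>, ascend inside the Noetherian graded module with parts
  \<open>m^N A + B\<close>. Where they become stationary, \<open>F N\<close> is obtained from
  \<open>F k\<close> by multiplication with \<open>m^(N-k)\<close>, modulo \<open>B\<close>.\<close>

lemma artin_rees:
  assumes A: "A \<in> submods R M" and B: "B \<in> submods R M" and C: "C \<in> submods R M" and BC: "B \<subseteq> C" and CA: "C \<subseteq> A"
  shows "\<exists>k. \<forall>N\<ge>k. C \<inter> mB N B A \<subseteq> mB (N - k) B C"
proof -
  obtain S where "rees_family R S (\<lambda>n :: unit \<Rightarrow> nat. pw (n ()))" by (rule rees_pow)
  then interpret rees_family R S "\<lambda>n. pw (n ())" .
  interpret rees_family_module R M S "\<lambda>n. pw (n ())" ..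
  have mR: "m \<subseteq> carrier R" using ideal.Icarr[OF m_ideal] by blast
  have Sm: "x \<in> m" "a > 0" if "(x, a, j) \<in> S" for x a j
  proof -
    show "a > 0" using S_carrier[OF that] by simp
    have "x \<otimes> \<one> \<in> pw (bump j a (\<lambda>_. 0) ())" by (rule J_S[OF that]) simp
    then have "x \<in> pw a" using S_carrier[OF that] by (simp add: bump_def)
    then show "x \<in> m" using ideal_pow_antimono[OF m_ideal, of "Suc 0" a] \<open>a > 0\<close> ideal_pow_1[OF m_ideal] by auto
  qed
  define F where "F N = C \<inter> mB N B A" for N
  have Fs: "F N \<in> submods R M" for N unfolding F_def by (intro submods_inter C mB_submods A B)
  have BF: "B \<subseteq> F N" for N unfolding F_def using BC mB_ub(1)[OF A B] by blast
  have mF: "ideal_mult R M m (F N) \<subseteq> F (Suc N)" for N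
  proof -
    have "ideal_mult R M m (F N) \<subseteq> ideal_mult R M m C" "ideal_mult R M m (F N) \<subseteq> ideal_mult R M m (mB N B A)"
      unfolding F_def using mR submods_subset[OF C] submods_subset[OF mB_submods[OF A B]]
      by (intro ideal_mult_mono; blast)+
    then show ?thesis using ideal_mult_subset[OF C mR] mB_step[OF A B, of N] unfolding F_def by blast
  qed
  have mF': "mpow t (F N) \<subseteq> F (t + N)" for t N
  proof (induction t)
    case 0
    then show ?case using ideal_mult_carrier[OF Fs] by simp
  next
    case (Suc t)
    have "mpow (Suc t) (F N) = ideal_mult R M m (mpow t (F N))" by (rule mpow_Suc[OF Fs])
    also have "\<dots> \<subseteq> ideal_mult R M m (F (t + N))" using Suc mR submods_subset[OF Fs] by (intro ideal_mult_mono) auto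
    also have "\<dots> \<subseteq> F (Suc (t + N))" by (rule mF)
    finally show ?case by simp
  qed
  have mFsub: "mB t B (F N) \<subseteq> F (t + N)" for t N by (rule sub_sum_least[OF Fs mF' BF])
  define G where "G k N = (if N \<le> k then F N else mB (N - k) B (F k))" for k N
  have Gs: "G k N \<in> submods R M" for k N unfolding G_def using Fs mB_submods[OF Fs B] by auto
  have GF: "G k N \<subseteq> F N" for k N unfolding G_def using mFsub[of "N - k" k] by auto
  have BG: "B \<subseteq> G k N" for k N unfolding G_def using BF mB_ub(1)[OF Fs B] by auto
  have Gstep: "ideal_mult R M m (G k N) \<subseteq> G k (Suc N)" for k N
  proof -
    consider "N < k" | "N = k" | "N > k" by linarith
    then show ?thesis
    proof cases
      case 1
      then show ?thesis using mF by (simp add: G_def)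
    next
      case 2
      then show ?thesis using mB_ub(2)[OF Fs B, of "Suc 0" k] mpow_1[OF Fs, of k] by (simp add: G_def)
    next
      case 3
      then have "Suc N - k = Suc (N - k)" by simp
      then show ?thesis using 3 mB_step[OF Fs B, of "N - k" k] by (simp add: G_def)
    qed
  qed
  have Gmono: "G k N \<subseteq> G k N'" if "N' \<le> N" for k N N'
    using that
  proof (induction rule: dec_induct)
    case (step n)
    have "G k (Suc n) \<subseteq> G k n"
    proof -
      have FS: "F (Suc n) \<subseteq> F n" for n unfolding F_def
        using sub_sum_mono[OF mpow_antimono[OF A] subset_refl, of n "Suc n" B] by auto
      consider "n < k" | "n = k" | "n > k" by linarith
      then show ?thesis
      proof cases
        case 1
        then show ?thesis using FS by (simp add: G_def)
      next
        case 2
        then show ?thesis using sub_sum_least[OF Fs mpow_subset[OF Fs] BF] by (simp add: G_def del: ideal_pow.simps)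
      next
        case 3
        then show ?thesis using sub_sum_mono[OF mpow_antimono[OF Fs] subset_refl, of "n - k" "Suc n - k" k B] by (simp add: G_def)
      qed
    qed
    then show ?case using step by blast
  qed simp
  have Gpow: "mpow a (G k N) \<subseteq> G k (a + N)" for a k N
  proof (induction a)
    case 0
    then show ?case using ideal_mult_carrier[OF Gs] by simp
  next
    case (Suc a)
    have "mpow (Suc a) (G k N) = ideal_mult R M m (mpow a (G k N))" by (rule mpow_Suc[OF Gs])
    also have "\<dots> \<subseteq> ideal_mult R M m (G k (a + N))" using Suc mR submods_subset[OF Gs] by (intro ideal_mult_mono) auto
    also have "\<dots> \<subseteq> G k (Suc (a + N))" by (rule Gstep)
    finally show ?case by simp
  qed
  have Gfam: "(\<lambda>n. G k (n ())) \<in> fam R M S (\<lambda>_. B) (\<lambda>n. mB (n ()) B A)" for k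
  proof (rule famI)
    fix n :: "unit \<Rightarrow> nat" show "G k (n ()) \<subseteq> mB (n ()) B A" using GF[of k "n ()"] by (auto simp: F_def)
  next
    fix x a j v and n :: "unit \<Rightarrow> nat" assume x: "(x, a, j) \<in> S" "v \<in> G k (n ())"
    have "x \<otimes> \<one> \<in> pw (bump j a (\<lambda>_. 0) ())" by (rule J_S[OF x(1)]) simp
    then have "x \<in> pw a" using S_carrier[OF x(1)] by (simp add: bump_def)
    then have "x \<odot>\<^bsub>M\<^esub> v \<in> mpow a (G k (n ()))" using x(2) by (rule ideal_mult_I)
    then show "x \<odot>\<^bsub>M\<^esub> v \<in> G k (bump j a n ())" using Gpow[of a k "n ()"] by (auto simp: bump_def add.commute)
  qed (use Gs BG in auto)
  have Gasc: "G k N \<subseteq> G (Suc k) N" for k N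
  proof -
    consider "N \<le> k" | "N = Suc k" | "N > Suc k" by linarith
    then show ?thesis
    proof cases
      case 2
      then show ?thesis using GF[of k N] by (simp add: G_def)
    next
      case 3
      have "mpow (N - k) (F k) = mpow (N - Suc k) (mpow (Suc 0) (F k))"
        using mpow_add[OF Fs, of "N - Suc k" "Suc 0" k] 3 by (simp add: Suc_diff_Suc)
      also have "\<dots> \<subseteq> mpow (N - Suc k) (F (Suc k))"
        using mF'[of "Suc 0" k] by (intro mpow_mono Fs) simp
      finally have "mB (N - k) B (F k) \<subseteq> mB (N - Suc k) B (F (Suc k))" by (rule sub_sum_mono) simp
      then show ?thesis using 3 by (simp add: G_def)
    qed (simp add: G_def)
  qed
  have "acc (fam R M S (\<lambda>_. B) (\<lambda>n. mB (n ()) B A))"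
    using BC CA by (intro acc_JA_plus_B accM A B) auto
  then obtain k where k: "\<And>i. i \<ge> k \<Longrightarrow> (\<lambda>n :: unit \<Rightarrow> nat. G i (n ())) = (\<lambda>n. G k (n ()))"
    using accD[where N = "\<lambda>k (n :: unit \<Rightarrow> nat). G k (n ())", OF _ Gfam] Gasc by (auto simp: le_fun_def)
  have "C \<inter> mB N B A \<subseteq> mB (N - k) B C" if "N \<ge> k" for N
  proof -
    \<comment> \<open>Each part \<open>F N\<close> appears in \<open>G N\<close>, and stationarity
      allows \<open>G N\<close> to be replaced by \<open>G k\<close>.\<close>
    have "C \<inter> mB N B A = G N N" by (simp add: G_def F_def)
    also have "\<dots> = G k N" using fun_cong[OF k[OF that], of "\<lambda>_. N"] by simp
    also have "\<dots> \<subseteq> mB (N - k) B C"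
    proof (cases "N = k")
      case True
      have "F k \<subseteq> C" by (auto simp: F_def)
      then show ?thesis using True mB_ub[OF C B, of 0] by (auto simp: G_def ideal_mult_carrier[OF C])
    next
      case False
      then have "G k N = mB (N - k) B (F k)" using that by (simp add: G_def)
      also have "\<dots> \<subseteq> mB (N - k) B C" by (intro sub_sum_mono mpow_mono C) (auto simp: F_def)
      finally show ?thesis .
    qed
    finally show ?thesis .
  qed
  then show ?thesis by blast
qed

section \<open>Hilbert-Samuel functions along exact sequences\<close>

abbreviation "HS \<equiv> hs R M m"

text \<open>The part that is exactly additive: \<open>C\<close> is measured by the filtration
  induced from \<open>A\<close>. The inequalities that follow compare this filtration with the
  powers of \<open>m\<close> on \<open>C\<close>.\<close>

lemma hs_split:
  assumes A: "A \<in> submods R M" and B: "B \<in> submods R M" and C: "C \<in> submods R M" and BC: "B \<subseteq> C" and CA: "C \<subseteq> A"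
  shows "HS B A N = HS C A N + Lenr (C \<inter> mB N B A) C" "Len (C \<inter> mB N B A) C \<noteq> \<infinity>"
proof -
  have BA: "B \<subseteq> A" using BC CA by blast
  have le: "mB N B A \<subseteq> mB N C A" by (rule sub_sum_mono[OF subset_refl BC])
  have eq: "mB N C A = sub_sum M C (mB N B A)"
  proof (rule antisym)
    note s = mB_submods[OF A B, of N]
    show "mB N C A \<subseteq> sub_sum M C (mB N B A)"
      using sub_sum_ub1[OF C s] sub_sum_ub2[OF C s] mB_ub(2)[OF A B, of N] by (intro sub_sum_least sub_sum_submods C s) auto
    show "sub_sum M C (mB N B A) \<subseteq> mB N C A" by (rule sub_sum_least[OF mB_submods[OF A C] mB_ub(1)[OF A C] le])
  qed
  have fin: "Len (mB N B A) A \<noteq> \<infinity>" by (rule mB_finite[OF A B BA])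
  have L: "Len (mB N B A) (mB N C A) = Len (C \<inter> mB N B A) C"
    unfolding eq by (rule len_inter_join[OF C mB_submods[OF A B]])
  show "Len (C \<inter> mB N B A) C \<noteq> \<infinity>"
    unfolding L[symmetric] by (rule len_finite_sub[OF mB_subset[OF A CA] subset_refl fin])
  show "HS B A N = HS C A N + Lenr (C \<inter> mB N B A) C"
    using len_rat_add[OF A mB_submods[OF A B] mB_submods[OF A C] le mB_subset[OF A CA] fin] L
    by (simp add: hs_def len_rat_def)
qed

lemma len_rat_mono:
  assumes "B' \<subseteq> B" "Len B' A \<noteq> \<infinity>" shows "Lenr B A \<le> Lenr B' A"
proof -
  obtain p where p: "Len B' A = enat p" using assms(2) by auto
  have "Len B A \<le> Len B' A" using assms(1) by (intro len_mono) auto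
  then obtain q where "Len B A = enat q" "q \<le> p" using p by (cases "Len B A") auto
  then show ?thesis using p by (simp add: len_rat_def)
qed

lemma hs_mono:
  assumes A: "A \<in> submods R M" and B: "B \<in> submods R M" and BA: "B \<subseteq> A" and N: "N \<le> N'"
  shows "HS B A N \<le> HS B A N'"
  unfolding hs_def using sub_sum_mono[OF mpow_antimono[OF A N] subset_refl]
  by (intro len_rat_mono mB_finite A B BA)

context
  fixes A B C
  assumes A: "A \<in> submods R M" and B: "B \<in> submods R M" and C: "C \<in> submods R M" and BC: "B \<subseteq> C" and CA: "C \<subseteq> A"
begin

lemma hs_quotient_le: "HS C A N \<le> HS B A N"
  using hs_split[OF A B C BC CA, of N] by (simp add: len_rat_nonneg)

lemma hs_subadd: "HS B A N \<le> HS C A N + HS B C N"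
proof -
  have "mB N B C \<subseteq> C \<inter> mB N B A"
    using mB_subset[OF C BC] sub_sum_mono[OF mpow_mono[OF A CA] subset_refl] by blast
  then have "Lenr (C \<inter> mB N B A) C \<le> Lenr (mB N B C) C" by (rule len_rat_mono[OF _ mB_finite[OF C B BC]])
  then show ?thesis using hs_split(1)[OF A B C BC CA, of N] by (simp add: hs_def)
qed

text \<open>If \<open>C\<close> lies in \<open>mA + B\<close>, then \<open>m^(N-1) C\<close> already
  lies in \<open>m^N A + B\<close>, which gains one power of \<open>m\<close> over
  \<open>hs_subadd\<close>.\<close>

lemma hs_subadd_pred:
  assumes "C \<subseteq> mB (Suc 0) B A" "N \<ge> 1"
  shows "HS B A N \<le> HS C A N + HS B C (N - 1)"
proof -
  have "mpow (N - 1) C \<subseteq> mpow (N - 1) (mB (Suc 0) B A)" by (rule mpow_mono[OF mB_submods[OF A B] assms(1)])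
  also have "\<dots> \<subseteq> sub_sum M (mpow (N - 1) (mpow (Suc 0) A)) (mpow (N - 1) B)"
    by (rule ideal_mult_sub_sum[OF pw_carrier mpow_submods[OF A] B])
  also have "\<dots> \<subseteq> sub_sum M (mpow N A) B"
    using mpow_add[OF A, of "N - 1" "Suc 0"] mpow_subset[OF B] assms(2) by (intro sub_sum_mono) auto
  finally have "mB (N - 1) B C \<subseteq> C \<inter> mB N B A"
    using mB_subset[OF C BC] mB_ub(1)[OF A B] sub_sum_least[OF mB_submods[OF A B]] by blast
  then have "Lenr (C \<inter> mB N B A) C \<le> Lenr (mB (N - 1) B C) C" by (rule len_rat_mono[OF _ mB_finite[OF C B BC]])
  then show ?thesis using hs_split(1)[OF A B C BC CA, of N] by (simp add: hs_def)
qed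

text \<open>By Artin-Rees the induced filtration on \<open>C\<close> is contained in the powers of
  \<open>m\<close> up to a shift, so \<open>C/B\<close> contributes at least its own function at
  \<open>N - k\<close>.\<close>

lemma hs_superadd: "\<exists>k. \<forall>N\<ge>k. HS C A N + HS B C (N - k) \<le> HS B A N"
proof -
  obtain k where k: "\<And>N. N \<ge> k \<Longrightarrow> C \<inter> mB N B A \<subseteq> mB (N - k) B C"
    using artin_rees[OF A B C BC CA] by blast
  have "HS C A N + HS B C (N - k) \<le> HS B A N" if "N \<ge> k" for N
    using len_rat_mono[OF k[OF that] hs_split(2)[OF A B C BC CA]] hs_split(1)[OF A B C BC CA, of N] by (simp add: hs_def)
  then show ?thesis by blast
qed

end

end

lemma (in noeth_local) self_local_module: "noeth_local_module R (self_module R) m"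
  by (intro noeth_local_module.intro noeth_local_module_axioms.intro module_self noeth_local_axioms)
     (simp add: submods_self acc_ideals)

context noeth_local_module
begin

text \<open>The isomorphism of \<open>(B + Rv)/B\<close> with \<open>R/(B : v)\<close> respects
  powers of \<open>m\<close>. The factors of a prime filtration thus contribute functions that
  depend on the prime alone and not on \<open>M\<close>.\<close>

lemma hs_cyc:
  assumes B: "B \<in> submods R M" and v: "v \<in> carrier M"
  shows "HS B (sub_sum M B (cyc R M v)) N = hs R (self_module R) m (colon R M B {v}) (carrier R) N"
proof -
  interpret S: noeth_local_module R "self_module R" m by (rule self_local_module)
  interpret V: module_hom R "self_module R" M "\<lambda>a. a \<odot>\<^bsub>M\<^esub> v" by (rule module_hom_cyc[OF v])
  let ?V = "cyc R M v" and ?p = "colon R M B {v}" and ?J = "(\<lambda>a. a \<odot>\<^bsub>M\<^esub> v) ` pw N"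
  define C where "C = sub_sum M B ?V"
  have Vs: "?V \<in> submods R M" by (rule cyc_submods[OF v])
  have C: "C \<in> submods R M" unfolding C_def by (rule sub_sum_submods[OF B Vs])
  have BC: "B \<subseteq> C" "?V \<subseteq> C" unfolding C_def using sub_sum_ub1[OF B Vs] sub_sum_ub2[OF B Vs] by auto
  have Js: "?J \<in> submods R M" by (rule V.image_submods) (simp add: submods_self pw_ideal)
  have mB: "mB N B C = sub_sum M ?J B"
  proof (rule antisym)
    have "mpow N C \<subseteq> sub_sum M (mpow N B) (mpow N ?V)" unfolding C_def by (rule ideal_mult_sub_sum[OF pw_carrier B Vs])
    also have "\<dots> \<subseteq> sub_sum M ?J B"
      using order_trans[OF mpow_subset[OF B] sub_sum_ub2[OF Js B]] sub_sum_ub1[OF Js B] ideal_mult_cyc[OF pw_ideal v]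
      by (intro sub_sum_least sub_sum_submods Js B) auto
    finally show "mB N B C \<subseteq> sub_sum M ?J B"
      using sub_sum_ub2[OF Js B] by (intro sub_sum_least sub_sum_submods Js B)
    show "sub_sum M ?J B \<subseteq> mB N B C"
      using mpow_mono[OF C BC(2), of N] ideal_mult_cyc[OF pw_ideal v, of N] by (intro sub_sum_mono) auto
  qed
  have Bs: "mB N B C \<in> submods R M" by (rule mB_submods[OF C B])
  have R: "carrier R \<in> submods R (self_module R)" "?p \<in> submods R (self_module R)"
    using colon_ideal[OF B, of "{v}"] v by (auto simp: submods_self oneideal)
  have 1: "sub_sum M ((\<lambda>a. a \<odot>\<^bsub>M\<^esub> v) ` carrier R) (mB N B C) = C"
  proof (rule antisym)
    show "sub_sum M ((\<lambda>a. a \<odot>\<^bsub>M\<^esub> v) ` carrier R) (mB N B C) \<subseteq> C"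
      unfolding image_carrier_cyc by (rule sub_sum_least[OF C BC(2) mB_subset[OF C BC(1)]])
    show "C \<subseteq> sub_sum M ((\<lambda>a. a \<odot>\<^bsub>M\<^esub> v) ` carrier R) (mB N B C)"
      unfolding image_carrier_cyc
      by (subst (1) C_def, rule sub_sum_least[OF sub_sum_submods[OF Vs Bs]])
         (use sub_sum_ub1[OF Vs Bs] sub_sum_ub2[OF Vs Bs] mB_ub(1)[OF C B] in auto)
  qed
  have 2: "{a \<in> carrier R. a \<odot>\<^bsub>M\<^esub> v \<in> mB N B C} = sub_sum (self_module R) (pw N) ?p"
  proof (rule antisym)
    show "{a \<in> carrier R. a \<odot>\<^bsub>M\<^esub> v \<in> mB N B C} \<subseteq> sub_sum (self_module R) (pw N) ?p"
    proof
      fix a assume "a \<in> {a \<in> carrier R. a \<odot>\<^bsub>M\<^esub> v \<in> mB N B C}"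
      then obtain u b where ub: "a \<in> carrier R" "u \<in> pw N" "b \<in> B" "a \<odot>\<^bsub>M\<^esub> v = u \<odot>\<^bsub>M\<^esub> v \<oplus>\<^bsub>M\<^esub> b"
        unfolding mB by (auto elim!: sub_sum_E)
      have c: "u \<in> carrier R" "b \<in> carrier M" using ub pw_carrier submodsD(1)[OF B] by auto
      have "(a \<ominus> u) \<odot>\<^bsub>M\<^esub> v = a \<odot>\<^bsub>M\<^esub> v \<ominus>\<^bsub>M\<^esub> u \<odot>\<^bsub>M\<^esub> v"
        using ub c v by (simp add: R.minus_eq M.minus_eq smult_l_distr smult_l_minus)
      also have "\<dots> = b" using ub c v by simp
      finally have "a \<ominus> u \<in> ?p" using ub c by (simp add: colon_def)
      moreover have "a = u \<oplus> (a \<ominus> u)" using ub c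
        by (simp add: R.minus_eq R.a_lcomm R.r_neg)
      ultimately show "a \<in> sub_sum (self_module R) (pw N) ?p"
        using S.sub_sum_I[of u "pw N" "a \<ominus> u" ?p] ub(2) by simp
    qed
    show "sub_sum (self_module R) (pw N) ?p \<subseteq> {a \<in> carrier R. a \<odot>\<^bsub>M\<^esub> v \<in> mB N B C}"
    proof
      fix a assume "a \<in> sub_sum (self_module R) (pw N) ?p"
      then obtain u b where ub: "u \<in> pw N" "b \<in> ?p" "a = u \<oplus> b" by (auto elim!: S.sub_sum_E)
      then have c: "u \<in> carrier R" "b \<in> carrier R" using pw_carrier by (auto simp: colon_def)
      then have "a \<odot>\<^bsub>M\<^esub> v = u \<odot>\<^bsub>M\<^esub> v \<oplus>\<^bsub>M\<^esub> b \<odot>\<^bsub>M\<^esub> v" using ub v by (simp add: smult_l_distr)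
      then show "a \<in> {a \<in> carrier R. a \<odot>\<^bsub>M\<^esub> v \<in> mB N B C}"
        unfolding mB using ub c by (auto simp: colon_def intro!: sub_sum_I)
    qed
  qed
  have 3: "ideal_mult R (self_module R) (pw N) (carrier R) = pw N"
  proof (rule antisym)
    show "ideal_mult R (self_module R) (pw N) (carrier R) \<subseteq> pw N"
      by (rule S.ideal_mult_least) (auto simp: submods_self pw_ideal intro: ideal.I_r_closed[OF pw_ideal])
    show "pw N \<subseteq> ideal_mult R (self_module R) (pw N) (carrier R)"
    proof
      fix u assume u: "u \<in> pw N"
      then show "u \<in> ideal_mult R (self_module R) (pw N) (carrier R)"
        using S.ideal_mult_I[OF u R.one_closed] subsetD[OF pw_carrier u] by simp
    qed
  qed
  show ?thesis
    using V.len_image[OF R(1) Bs] unfolding 1 2 by (simp add: hs_def 3 len_rat_def C_def)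
qed

end

section \<open>Dimension and the growth of Hilbert--Samuel functions\<close>

text \<open>The number \<open>n\<close> counts inclusions, not primes, so the supremum of such
  \<open>n\<close> is the dimension of \<open>R/I\<close>.\<close>

definition prime_chain :: "('a, 'c) ring_scheme \<Rightarrow> 'a set \<Rightarrow> nat \<Rightarrow> bool" where
  "prime_chain R I n \<longleftrightarrow>
     (\<exists>P. (\<forall>i\<le>n. primeideal (P i) R) \<and> (\<forall>i<n. P i \<subset> P (Suc i)) \<and> I \<subseteq> P 0)"

lemma prime_chain_mono: "prime_chain R I n \<Longrightarrow> I' \<subseteq> I \<Longrightarrow> prime_chain R I' n"
  unfolding prime_chain_def by blast

lemma prime_chain_0: "primeideal p R \<Longrightarrow> prime_chain R p 0"
  unfolding prime_chain_def by (auto intro!: exI[of _ "\<lambda>_. p"])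

lemma prime_chain_Cons:
  assumes "prime_chain R q n" "primeideal p R" "p \<subset> q" shows "prime_chain R p (Suc n)"
proof -
  obtain P where P: "\<forall>i\<le>n. primeideal (P i) R" "\<forall>i<n. P i \<subset> P (Suc i)" "q \<subseteq> P 0"
    using assms(1) unfolding prime_chain_def by blast
  let ?P = "\<lambda>i. case i of 0 \<Rightarrow> p | Suc i \<Rightarrow> P i"
  have "primeideal (?P i) R" if "i \<le> Suc n" for i using P(1) assms(2) that by (cases i) auto
  moreover have "?P i \<subset> ?P (Suc i)" if "i < Suc n" for i using P assms(3) that by (cases i) auto
  ultimately show ?thesis unfolding prime_chain_def by (intro exI[of _ ?P]) auto
qed

section \<open>Chains of primes in a quotient ring\<close>

lemma (in cring) primeideal_quotient_iff:
  assumes I: "ideal I R" and P: "ideal P R" "I \<subseteq> P"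
  shows "primeideal ((+>) I ` P) (R Quot I) \<longleftrightarrow> primeideal P R"
proof -
  let ?Q = "(+>) I ` P"
  have Qid: "ideal ?Q (R Quot I)" by (rule ring_ideal_imp_quot_ideal[OF I P(1)])
  then have Qc: "?Q \<subseteq> carrier (R Quot I)" using ideal.Icarr[OF Qid] by blast
  have UQ: "\<Union>?Q = P" using ideal_incl_iff[OF I P(1)] P(2) by blast
  have mem: "a \<in> carrier R \<Longrightarrow> I +> a \<in> ?Q \<longleftrightarrow> a \<in> P" for a
    using canonical_proj_vimage_mem_iff[OF I Qc, of a] UQ by simp
  have car: "X \<in> carrier (R Quot I) \<Longrightarrow> \<exists>a\<in>carrier R. X = I +> a" for X
    by (auto simp: FactRing_def A_RCOSETS_def')
  have mult: "a \<in> carrier R \<Longrightarrow> b \<in> carrier R \<Longrightarrow> (I +> a) \<otimes>\<^bsub>R Quot I\<^esub> (I +> b) = I +> (a \<otimes> b)" for a b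
    using ring_hom_mult[OF ideal.rcos_ring_hom[OF I]] by simp
  have hc: "a \<in> carrier R \<Longrightarrow> I +> a \<in> carrier (R Quot I)" for a
    using ring_hom_closed[OF ideal.rcos_ring_hom[OF I]] .
  show ?thesis
  proof
    assume Q: "primeideal ?Q (R Quot I)"
    show "primeideal P R"
    proof (rule primeidealI[OF P(1) is_cring])
      show "carrier R \<noteq> P"
      proof
        assume "carrier R = P"
        then have "carrier (R Quot I) \<subseteq> ?Q" using car by blast
        then show False using primeideal.I_notcarr[OF Q] Qc by blast
      qed
      show "a \<in> P \<or> b \<in> P" if "a \<in> carrier R" "b \<in> carrier R" "a \<otimes> b \<in> P" for a b
        using primeideal.I_prime[OF Q hc[OF that(1)] hc[OF that(2)]] that mem mult by simp
    qed
  next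
    assume P': "primeideal P R"
    show "primeideal ?Q (R Quot I)"
    proof (rule primeidealI[OF Qid ideal.quotient_is_cring[OF I is_cring]])
      show "carrier (R Quot I) \<noteq> ?Q"
      proof
        assume "carrier (R Quot I) = ?Q"
        then have "a \<in> P" if "a \<in> carrier R" for a using hc[OF that] mem[OF that] by simp
        then have "carrier R \<subseteq> P" by blast
        then show False using primeideal.I_notcarr[OF P'] ideal.Icarr[OF P(1)] by blast
      qed
      fix X Y assume "X \<in> carrier (R Quot I)" "Y \<in> carrier (R Quot I)" and XY: "X \<otimes>\<^bsub>R Quot I\<^esub> Y \<in> ?Q"
      then obtain a b where "a \<in> carrier R" "X = I +> a" "b \<in> carrier R" "Y = I +> b" using car by meson
      then show "X \<in> ?Q \<or> Y \<in> ?Q" using primeideal.I_prime[OF P', of a b] XY mem mult by auto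
    qed
  qed
qed

lemma (in cring) krull_dim_quotient:
  assumes I: "ideal I R"
  shows "krull_dim (R Quot I) = Sup {ereal (real n) |n. prime_chain R I n}"
proof -
  note bij = quot_ideal_correspondence[OF I]
  have "(\<exists>Q. (\<forall>i\<le>n. primeideal (Q i) (R Quot I)) \<and> (\<forall>i<n. Q i \<subset> Q (Suc i))) \<longleftrightarrow> prime_chain R I n" for n
  proof
    assume "\<exists>Q. (\<forall>i\<le>n. primeideal (Q i) (R Quot I)) \<and> (\<forall>i<n. Q i \<subset> Q (Suc i))"
    then obtain Q where Q: "\<And>i. i \<le> n \<Longrightarrow> primeideal (Q i) (R Quot I)" "\<And>i. i < n \<Longrightarrow> Q i \<subset> Q (Suc i)" by blast
    have "\<forall>i. \<exists>P. i \<le> n \<longrightarrow> (ideal P R \<and> I \<subseteq> P \<and> Q i = (+>) I ` P)"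
    proof
      fix i
      have "i \<le> n \<Longrightarrow> Q i \<in> (\<lambda>J. (+>) I ` J) ` {J. ideal J R \<and> I \<subseteq> J}"
        using primeideal.axioms(1)[OF Q(1)] bij_betw_imp_surj_on[OF bij] by blast
      then show "\<exists>P. i \<le> n \<longrightarrow> (ideal P R \<and> I \<subseteq> P \<and> Q i = (+>) I ` P)" by blast
    qed
    from choice[OF this] obtain P where P: "\<And>i. i \<le> n \<Longrightarrow> ideal (P i) R \<and> I \<subseteq> P i \<and> Q i = (+>) I ` P i" by blast
    have U: "\<Union>(Q i) = P i" if "i \<le> n" for i using P[OF that] ideal_incl_iff[OF I, of "P i"] by auto
    have "primeideal (P i) R" if "i \<le> n" for i
      using Q(1)[OF that] P[OF that] primeideal_quotient_iff[OF I, of "P i"] by simp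
    moreover have "P i \<subset> P (Suc i)" if "i < n" for i
    proof -
      have "P i \<subseteq> P (Suc i)" using Q(2)[OF that] U[of i] U[of "Suc i"] that by auto
      moreover have "P i \<noteq> P (Suc i)" using Q(2)[OF that] P[of i] P[of "Suc i"] that by auto
      ultimately show ?thesis by blast
    qed
    ultimately show "prime_chain R I n" unfolding prime_chain_def using P[of 0] by (intro exI[of _ P]) auto
  next
    assume "prime_chain R I n"
    then obtain P where P: "\<And>i. i \<le> n \<Longrightarrow> primeideal (P i) R" "\<And>i. i < n \<Longrightarrow> P i \<subset> P (Suc i)" "I \<subseteq> P 0"
      unfolding prime_chain_def by blast
    have IP: "i \<le> n \<Longrightarrow> I \<subseteq> P i" for i
      by (induction i) (use P(2,3) in \<open>auto dest!: less_imp_le[of "_ :: 'a set"] simp: Suc_le_eq\<close>)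
    have id: "i \<le> n \<Longrightarrow> P i \<in> {J. ideal J R \<and> I \<subseteq> J}" for i using IP primeideal.axioms(1)[OF P(1)] by blast
    let ?Q = "\<lambda>i. (+>) I ` P i"
    have "primeideal (?Q i) (R Quot I)" if "i \<le> n" for i
      using P(1)[OF that] id[OF that] primeideal_quotient_iff[OF I, of "P i"] by simp
    moreover have "?Q i \<subset> ?Q (Suc i)" if "i < n" for i
    proof -
      have "?Q i \<noteq> ?Q (Suc i)"
        using inj_onD[OF bij_betw_imp_inj_on[OF bij], of "P i" "P (Suc i)"] id[of i] id[of "Suc i"] P(2)[OF that] that by auto
      then show ?thesis using P(2)[OF that] by blast
    qed
    ultimately show "\<exists>Q. (\<forall>i\<le>n. primeideal (Q i) (R Quot I)) \<and> (\<forall>i<n. Q i \<subset> Q (Suc i))"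
      by (intro exI[of _ ?Q]) simp
  qed
  then show ?thesis by (simp add: krull_dim_def)
qed

section \<open>Growth of Hilbert-Samuel functions and chains of primes above the annihilator\<close>

context noeth_local_module
begin

lemma hs_cyc_fun:
  assumes "B \<in> submods R M" "v \<in> carrier M"
  shows "HS B (sub_sum M B (cyc R M v)) = hs R (self_module R) m (colon R M B {v}) (carrier R)"
  using hs_cyc[OF assms] by blast

lemma hs_quasi_poly:
  assumes "A \<in> submods R M" "B \<in> submods R M" "B \<subseteq> A"
  obtains \<sigma> K \<alpha> c where "quasi_poly (\<lambda>n :: unit \<Rightarrow> nat. HS B A (n ())) \<sigma> K \<alpha> c"
proof -
  obtain S where "rees_family R S (\<lambda>n :: unit \<Rightarrow> nat. pw (n ()))" by (rule rees_pow)
  then interpret rees_family R S "\<lambda>n. pw (n ())" .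
  interpret rees_family_module R M S "\<lambda>n. pw (n ())" ..
  have "\<exists>\<alpha>>0. \<exists>D. qp D \<alpha> (\<lambda>n :: unit \<Rightarrow> nat. HS B A (n ()))"
    unfolding hs_def by (rule hilbert_qp[OF accM assms mB_finite[OF assms]])
  then obtain \<alpha> D where "\<alpha> > 0" "qp D \<alpha> (\<lambda>n :: unit \<Rightarrow> nat. HS B A (n ()))" by blast
  then show ?thesis
    using qp_imp_quasi_poly[of D \<alpha> "\<lambda>n :: unit \<Rightarrow> nat. HS B A (n ())"] hs_mono[OF assms] hs_nonneg that by metis
qed

lemma hs_growth_ex:
  assumes "A \<in> submods R M" "B \<in> submods R M" "B \<subseteq> A" shows "\<exists>E. growth (HS B A) E"
proof -
  obtain \<sigma> K \<alpha> c where "quasi_poly (\<lambda>n :: unit \<Rightarrow> nat. HS B A (n ())) \<sigma> K \<alpha> c" by (rule hs_quasi_poly[OF assms])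
  from quasi_poly.growth_ex[OF this] show ?thesis by simp
qed

lemma hs_growth_difference:
  assumes "A \<in> submods R M" "B \<in> submods R M" "B \<subseteq> A" "growth (HS B A) (Suc E)"
  shows "growth (\<lambda>N. HS B A (N + k) - HS B A N) E"
proof -
  obtain \<sigma> K \<alpha> c where "quasi_poly (\<lambda>n :: unit \<Rightarrow> nat. HS B A (n ())) \<sigma> K \<alpha> c" by (rule hs_quasi_poly[OF assms(1-3)])
  from quasi_poly.growth_difference[OF this] show ?thesis using assms(4) by simp
qed

lemma growth_quotient:
  assumes "A \<in> submods R M" "B \<in> submods R M" "C \<in> submods R M" "B \<subseteq> C" "C \<subseteq> A" "growth (HS B A) E"
  shows "growth (HS C A) E"
  by (rule growth_le[OF assms(6) hs_quotient_le[OF assms(1-5)]])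

text \<open>Superadditivity holds only up to the shift of Artin-Rees, which
  \<open>growth_shift\<close> absorbs.\<close>

lemma growth_sub:
  assumes "A \<in> submods R M" "B \<in> submods R M" "C \<in> submods R M" "B \<subseteq> C" "C \<subseteq> A" "growth (HS B A) E"
  shows "growth (HS B C) E"
proof -
  obtain k where k: "\<And>N. N \<ge> k \<Longrightarrow> HS C A N + HS B C (N - k) \<le> HS B A N"
    using hs_superadd[OF assms(1-5)] by blast
  have "HS B C N \<le> HS B A (1 * N + k)" for N
  proof -
    have "HS C A (N + k) + HS B C N \<le> HS B A (N + k)" using k[of "N + k"] by simp
    then show ?thesis using hs_nonneg[of R M m C A "N + k"] by simp
  qed
  then show ?thesis by (intro growth_shift[OF assms(6), of 0 _ 1 k]) (auto simp: hs_nonneg)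
qed

lemma growth_extension:
  assumes "A \<in> submods R M" "B \<in> submods R M" "C \<in> submods R M" "B \<subseteq> C" "C \<subseteq> A" "growth (HS B C) E" "growth (HS C A) E"
  shows "growth (HS B A) E"
  by (rule growth_le[OF growth_add[OF assms(7,6)] hs_subadd[OF assms(1-5)]])

lemma growth_self: "growth (HS A A) E" if "A \<in> submods R M"
proof (rule growthI[where C = 0])
  have "mB N A A = A" for N using mB_ub(1)[OF that that] mB_subset[OF that subset_refl] by blast
  then show "of_nat N * HS A A N \<le> 0 * of_nat N ^ E" for N by (simp add: hs_def)
qed

text \<open>A product of the primes in a prime filtration annihilates \<open>A/B\<close>, so a prime
  above the annihilator contains one of them. The induction uses this in the form
  \<open>(B : v) (B + Rv : A) \<subseteq> (B : A)\<close>.\<close>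

lemma prime_below:
  assumes A: "A \<in> submods R M" and B: "B \<in> submods R M" "B \<subseteq> A" and P: "primeideal P R" "colon R M B A \<subseteq> P"
  shows "\<exists>C v. C \<in> submods R M \<and> B \<subseteq> C \<and> v \<in> carrier M \<and> sub_sum M C (cyc R M v) \<subseteq> A \<and>
     primeideal (colon R M C {v}) R \<and> colon R M C {v} \<subseteq> P"
proof -
  have "colon R M B A \<subseteq> P \<longrightarrow> (\<exists>C v. C \<in> submods R M \<and> B \<subseteq> C \<and> v \<in> carrier M \<and>
     sub_sum M C (cyc R M v) \<subseteq> A \<and> primeideal (colon R M C {v}) R \<and> colon R M C {v} \<subseteq> P)"
    using A B
  proof (induction rule: prime_filtration_induct)
    case refl
    have "carrier R \<subseteq> colon R M A A" using submodsD(4)[OF A] by (auto simp: colon_def)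
    then show ?case using primeideal.I_notcarr[OF P(1)] ideal.Icarr[OF primeideal.axioms(1)[OF P(1)]] by blast
  next
    case (step B v)
    let ?C = "sub_sum M B (cyc R M v)" and ?p = "colon R M B {v}"
    show ?case
    proof
      assume BP: "colon R M B A \<subseteq> P"
      have "ideal_prod R ?p (colon R M ?C A) \<subseteq> colon R M B A"
      proof (rule ideal_prod_least)
        show "x \<in> colon R M B A \<Longrightarrow> y \<in> colon R M B A \<Longrightarrow> x \<oplus> y \<in> colon R M B A" for x y
          using additive_subgroup.a_closed[OF ideal.axioms(1)[OF colon_ideal[OF step(1) submods_subset[OF A]]]] .
        fix a b assume ab: "a \<in> ?p" "b \<in> colon R M ?C A"
        have "(a \<otimes> b) \<odot>\<^bsub>M\<^esub> x \<in> B" if x: "x \<in> A" for x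
        proof -
          have xM: "x \<in> carrier M" using submodsD(1)[OF A x] .
          have "b \<odot>\<^bsub>M\<^esub> x \<in> ?C" using ab(2) x by (simp add: colon_def)
          then obtain u w where uw: "u \<in> B" "w \<in> cyc R M v" "b \<odot>\<^bsub>M\<^esub> x = u \<oplus>\<^bsub>M\<^esub> w" by (auto elim!: sub_sum_E)
          have c: "a \<in> carrier R" "b \<in> carrier R" "u \<in> carrier M" "w \<in> carrier M"
            using ab uw submodsD(1)[OF step(1)] submodsD(1)[OF cyc_submods[OF step(4)]] by (auto simp: colon_def)
          have "(a \<otimes> b) \<odot>\<^bsub>M\<^esub> x = a \<odot>\<^bsub>M\<^esub> u \<oplus>\<^bsub>M\<^esub> a \<odot>\<^bsub>M\<^esub> w" using c xM uw(3) by (simp add: smult_assoc1 smult_r_distr)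
          then show ?thesis
            using submodsD(3)[OF step(1)] submodsD(4)[OF step(1) c(1) uw(1)] colon_cyc[OF step(1,4) ab(1) uw(2)] by simp
        qed
        then show "a \<otimes> b \<in> colon R M B A" using ab by (auto simp: colon_def)
      qed
      then have "?p \<subseteq> P \<or> colon R M ?C A \<subseteq> P"
        using primeideal_divides_ideal_prod[OF P(1) primeideal.axioms(1)[OF step(6)] colon_ideal[OF step(7) submods_subset[OF A]]] BP
        by blast
      then show "\<exists>C v. C \<in> submods R M \<and> B \<subseteq> C \<and> v \<in> carrier M \<and>
         sub_sum M C (cyc R M v) \<subseteq> A \<and> primeideal (colon R M C {v}) R \<and> colon R M C {v} \<subseteq> P"
      proof
        assume "?p \<subseteq> P"
        then show ?thesis using step by (intro exI[of _ B] exI[of _ v]) auto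
      next
        assume "colon R M ?C A \<subseteq> P"
        then obtain C w where "C \<in> submods R M" "?C \<subseteq> C" "w \<in> carrier M"
         "sub_sum M C (cyc R M w) \<subseteq> A" "primeideal (colon R M C {w}) R" "colon R M C {w} \<subseteq> P" using step(10) by blast
        then show ?thesis using step(8) by blast
      qed
    qed
  qed
  then show ?thesis using P(2) by blast
qed

end

context noeth_local
begin

abbreviation "hsR I N \<equiv> hs R (self_module R) m I (carrier R) N"

lemma colon_self_prime:
  assumes "primeideal p R" "x \<in> carrier R" "x \<notin> p" shows "colon R (self_module R) p {x} = p"
proof -
  note p = primeideal.axioms(1)[OF assms(1)]
  have "a \<otimes> x \<in> p \<longleftrightarrow> a \<in> p" if a: "a \<in> carrier R" for a
    using primeideal.I_prime[OF assms(1) a assms(2)] ideal.I_r_closed[OF p _ assms(2), of a] assms(3) by blast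
  then show ?thesis using ideal.Icarr[OF p] by (auto simp: colon_def)
qed

text \<open>Primes strictly above \<open>p\<close> enter twice: the second prime of a chain gives
  the lower bound for the growth, and the primes in a filtration of \<open>R/(p + xR)\<close>, which
  all contain \<open>x\<close>, give the upper bound.\<close>

theorem prime_growth_iff:
  assumes "primeideal p R"
  shows "growth (hsR p) E \<longleftrightarrow> \<not> prime_chain R p E"
proof -
  interpret S: noeth_local_module R "self_module R" m by (rule self_local_module)
  have sub: "I \<in> submods R (self_module R) \<longleftrightarrow> ideal I R" for I by (simp add: submods_self)
  have Rs: "carrier R \<in> submods R (self_module R)" by (simp add: sub oneideal)
  have icarr: "I \<subseteq> carrier R" if "ideal I R" for I using ideal.Icarr[OF that] by blast
  have "p \<in> {I. ideal I R}" using primeideal.axioms(1)[OF assms] by simp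
  with acc_ideals have "primeideal p R \<longrightarrow> (\<forall>E. growth (hsR p) E \<longleftrightarrow> \<not> prime_chain R p E)"
  proof (induction p rule: acc_induct)
    case (step p)
    show ?case
    proof (intro impI allI)
      fix E
      assume p: "primeideal p R"
      have pid: "ideal p R" and ps: "p \<in> submods R (self_module R)" using step(1) by (auto simp: sub)
      have IH: "growth (hsR q) E \<longleftrightarrow> \<not> prime_chain R q E" if "primeideal q R" "p \<subset> q" for q E
        using step(2)[of q] that primeideal.axioms(1)[OF that(1)] by blast
      define C where "C x = sub_sum (self_module R) p (cyc R (self_module R) x)" for x
      have C: "C x \<in> submods R (self_module R)" "p \<subseteq> C x" "x \<in> C x" "C x \<subseteq> carrier R"
        "x \<notin> p \<Longrightarrow> hs R (self_module R) m p (C x) = hsR p" if x: "x \<in> carrier R" for x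
      proof -
        have c: "cyc R (self_module R) x \<in> submods R (self_module R)" "x \<in> cyc R (self_module R) x"
          using x S.cyc_submods[of x] S.cyc_mem[of x] by auto
        show Cs: "C x \<in> submods R (self_module R)" "p \<subseteq> C x" "x \<in> C x"
          using S.sub_sum_submods[OF ps c(1)] S.sub_sum_ub1[OF ps c(1)] S.sub_sum_ub2[OF ps c(1)] c(2) by (auto simp: C_def)
        then show "C x \<subseteq> carrier R" using sub icarr by blast
        show "x \<notin> p \<Longrightarrow> hs R (self_module R) m p (C x) = hsR p"
          using S.hs_cyc[OF ps, of x] x colon_self_prime[OF p x] by (simp add: C_def fun_eq_iff)
      qed
      have Cle: "C x \<subseteq> I" if "x \<in> I" "p \<subseteq> I" "ideal I R" for x I
        unfolding C_def using that S.cyc_subset_iff[of I x] icarr[of I] by (intro S.sub_sum_least) (auto simp: sub)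
      have "False" if gr: "growth (hsR p) E" and ch: "prime_chain R p E"
      proof -
        obtain P where P: "\<And>i. i \<le> E \<Longrightarrow> primeideal (P i) R" "\<And>i. i < E \<Longrightarrow> P i \<subset> P (Suc i)" "p \<subseteq> P 0"
          using ch unfolding prime_chain_def by blast
        show False
        proof (cases E)
          \<comment> \<open>Exponent 0 would make the function vanish eventually, whereas
            \<open>R/(m^N + p)\<close> is nonzero for \<open>N \<ge> 1\<close>.\<close>
          case 0
          obtain c N0 where c: "\<And>N. N \<ge> N0 \<Longrightarrow> of_nat N * hsR p N \<le> c * of_nat N ^ E"
            using gr unfolding growth_def by blast
          have "1 \<le> hsR p (Suc N)" for N
          proof -
            have "S.mpow (Suc N) (carrier R) \<subseteq> m"
              using ideal_pow_antimono[OF m_ideal, of "Suc 0" "Suc N"] ideal_pow_1[OF m_ideal] m_ideal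
              by (intro S.ideal_mult_least) (auto simp: sub intro!: ideal.I_r_closed[OF m_ideal])
            then have "S.mB (Suc N) p (carrier R) \<subseteq> m"
              using prime_subset_m[OF p] by (intro S.sub_sum_least) (auto simp: sub m_ideal)
            then have "S.mB (Suc N) p (carrier R) \<noteq> carrier R"
              using maximalideal.I_notcarr[OF m_max] icarr[OF m_ideal] by blast
            moreover have "S.mB (Suc N) p (carrier R) \<subseteq> carrier R" by (rule S.mB_subset[OF Rs icarr[OF pid]])
            ultimately have "1 \<le> S.Len (S.mB (Suc N) p (carrier R)) (carrier R)"
              by (intro len_pos Rs S.mB_submods ps) auto
            moreover obtain l where "S.Len (S.mB (Suc N) p (carrier R)) (carrier R) = enat l"
              using S.mB_finite[OF Rs ps icarr[OF pid], of "Suc N"] by auto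
            ultimately show ?thesis by (simp add: hs_def len_rat_def one_enat_def)
          qed
          note ge1 = this
          define N where "N = Suc (max N0 (nat \<lceil>c\<rceil>))"
          have "of_nat N * hsR p N \<le> c" using c[of N] 0 by (simp add: N_def)
          moreover have "of_nat N * 1 \<le> of_nat N * hsR p N" unfolding N_def by (intro mult_left_mono ge1) simp
          moreover have "c < of_nat N" unfolding N_def by linarith
          ultimately show False by linarith
        next
          case (Suc E')
          have p1: "primeideal (P 1) R" "p \<subset> P 1" using P Suc by (auto dest: P(2)[of 0])
          then obtain x where x: "x \<in> P 1" "x \<notin> p" by blast
          have P1: "ideal (P 1) R" using primeideal.axioms(1)[OF p1(1)] .
          have xR: "x \<in> carrier R" using x icarr[OF P1] by blast
          note Cx = C[OF xR]
          \<comment> \<open>Since \<open>p\<close> is prime, \<open>(p : x) = p\<close>, and the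
            function of \<open>C x / p\<close> is that of \<open>R/p\<close>. The function of
            \<open>R / C x\<close> is therefore at most a difference of \<open>hsR p\<close>, whose
            exponent is one less.\<close>
          obtain k where k: "\<And>N. N \<ge> k \<Longrightarrow> hsR (C x) N + hs R (self_module R) m p (C x) (N - k) \<le> hsR p N"
            using S.hs_superadd[OF Rs ps Cx(1) Cx(2) Cx(4)] by blast
          have "growth (\<lambda>N. hsR p (N + k) - hsR p N) E'"
            using S.hs_growth_difference[OF Rs ps icarr[OF pid]] gr Suc by simp
          then have "growth (hsR (C x)) E'"
          proof (rule growth_le)
            fix N :: nat
            have "hsR (C x) N \<le> hsR (C x) (N + k)" by (rule S.hs_mono[OF Rs Cx(1) Cx(4)]) simp
            moreover have "hsR (C x) (N + k) + hsR p N \<le> hsR p (N + k)"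
              using k[of "N + k"] Cx(5)[OF x(2)] by simp
            ultimately show "hsR (C x) N \<le> hsR p (N + k) - hsR p N" by linarith
          qed
          moreover have "C x \<subseteq> P 1" using Cle x(1) p1(2) P1 by blast
          ultimately have "growth (hsR (P 1)) E'"
            using S.growth_quotient[OF Rs Cx(1) _ _ icarr[OF P1]] P1 by (simp add: sub)
          then have "\<not> prime_chain R (P 1) E'" using IH[OF p1] by blast
          moreover have "prime_chain R (P 1) E'"
            unfolding prime_chain_def using P(1,2) Suc by (intro exI[of _ "\<lambda>i. P (Suc i)"]) auto
          ultimately show False by blast
        qed
      qed
      moreover have "growth (hsR p) E" if nch: "\<not> prime_chain R p E"
      proof (cases "p = m")
        case True
        have "E \<noteq> 0" using nch prime_chain_0[OF p] by (cases E) auto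
        have "growth (hsR p) 1"
        proof (rule growthI[where C = 1])
          fix N
          have "len {I. ideal I R} m (carrier R) \<le> 1"
            by (rule len_simple_le) (use maximalideal.I_maximal[OF m_max] in auto)
          moreover have "S.Len (S.mB N p (carrier R)) (carrier R) \<le> S.Len m (carrier R)"
            using S.mB_ub(1)[OF Rs ps, of N] True by (intro len_mono) auto
          ultimately have "S.Len (S.mB N p (carrier R)) (carrier R) \<le> 1" by (simp add: submods_self)
          then have "hsR p N \<le> 1"
            by (cases "S.Len (S.mB N p (carrier R)) (carrier R)") (auto simp: hs_def len_rat_def one_enat_def)
          then show "of_nat N * hsR p N \<le> 1 * of_nat N ^ 1" by (simp add: mult_left_le)
        qed
        then show ?thesis using growth_mono[of _ 1 E] \<open>E \<noteq> 0\<close> by simp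
      next
        case False
        then have pm: "p \<subset> m" using prime_subset_m[OF p] by blast
        have "prime_chain R p (Suc 0)" by (rule prime_chain_Cons[OF prime_chain_0[OF m_prime] p pm])
        \<comment> \<open>The inclusion \<open>p \<subset> m\<close> is a chain with one step, so
          \<open>E\<close> is at least 2, as \<open>growth_sum\<close> requires.\<close>
        then obtain E' where E: "E = Suc (Suc E')" using nch prime_chain_0[OF p] by (metis nat.exhaust)
        have nchq: "growth (hsR q) (Suc E')" if "primeideal q R" "p \<subset> q" for q
          using IH[OF that] prime_chain_Cons[OF _ p that(2)] nch E by blast
        obtain x where x: "x \<in> m" "x \<notin> p" using pm by blast
        have xR: "x \<in> carrier R" using x icarr[OF m_ideal] by blast
        note Cx = C[OF xR]
        \<comment> \<open>The trivial premise lets the induction carry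
          \<open>C x \<subseteq> B\<close>, so that every prime met on the way contains both
          \<open>p\<close> and \<open>x\<close>.\<close>
        have "C x \<subseteq> C x \<longrightarrow> growth (hsR (C x)) (Suc E')"
          using Rs Cx(1) Cx(4)
        proof (induction rule: S.prime_filtration_induct[where Q = "\<lambda>B. C x \<subseteq> B \<longrightarrow> growth (hsR B) (Suc E')"])
          case refl
          then show ?case using S.growth_self[OF Rs] by simp
        next
          case (step B v)
          show ?case
          proof
            assume CB: "C x \<subseteq> B"
            have Bid: "ideal B R" using step(1) by (simp add: sub)
            have "v \<in> carrier R" using step(4) by simp
            then have "B \<subseteq> colon R (self_module R) B {v}"
              using ideal.I_r_closed[OF Bid] icarr[OF Bid] by (auto simp: colon_def)
            then have "p \<subset> colon R (self_module R) B {v}" using CB Cx(2,3) x(2) by blast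
            then have "growth (hsR (colon R (self_module R) B {v})) (Suc E')" by (rule nchq[OF step(6)])
            then have "growth (hs R (self_module R) m B (sub_sum (self_module R) B (cyc R (self_module R) v))) (Suc E')"
              unfolding S.hs_cyc_fun[OF step(1,4)] .
            moreover have "growth (hsR (sub_sum (self_module R) B (cyc R (self_module R) v))) (Suc E')"
              using step(10) CB step(8) by blast
            ultimately show "growth (hsR B) (Suc E')"
              using S.growth_extension[OF Rs step(1,7,8,9)] by blast
          qed
        qed
        then have "growth (hsR (C x)) (Suc E')" by blast
        \<comment> \<open>As \<open>x\<close> lies in \<open>m\<close>, so does \<open>C x\<close>
          modulo \<open>p\<close>. Hence \<open>C x / p\<close> is counted only at
          \<open>N - 1\<close>, where it again contributes the function of
          \<open>R/p\<close>.\<close>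
        moreover have "hsR p N \<le> hsR p (N - 1) + hsR (C x) N" if "N \<ge> 1" for N
        proof -
          have "x \<otimes> \<one> \<in> S.mpow (Suc 0) (carrier R)"
            using S.ideal_mult_I[of x "pw (Suc 0)" \<one> "carrier R"] x(1) ideal_pow_1[OF m_ideal] by simp
          then have "x \<in> S.mB (Suc 0) p (carrier R)" using xR subsetD[OF S.mB_ub(2)[OF Rs ps, of "Suc 0"], of x]
            by (simp del: ideal_pow.simps)
          then have "C x \<subseteq> S.mB (Suc 0) p (carrier R)"
            using Cle S.mB_ub(1)[OF Rs ps] S.mB_submods[OF Rs ps] sub by blast
          then show ?thesis
            using S.hs_subadd_pred[OF Rs ps Cx(1) Cx(2) Cx(4) _ that] Cx(5)[OF x(2)] by simp
        qed
        ultimately show ?thesis unfolding E by (intro growth_sum hs_nonneg)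
      qed
      ultimately show "growth (hsR p) E \<longleftrightarrow> \<not> prime_chain R p E" by blast
    qed
  qed
  then show ?thesis using assms by blast
qed

end

context noeth_local_module
begin

text \<open>The growth of \<open>A/B\<close> is the largest among the factors \<open>R/p\<close> of
  a prime filtration. A chain above the annihilator starts above some such \<open>p\<close> by
  \<open>prime_below\<close>; conversely all these \<open>p\<close> contain the annihilator, so
  their chains are chains above it.\<close>

theorem hs_growth_iff:
  assumes A: "A \<in> submods R M" and B: "B \<in> submods R M" "B \<subseteq> A"
  shows "growth (HS B A) E \<longleftrightarrow> \<not> prime_chain R (colon R M B A) E"
proof
  assume gr: "growth (HS B A) E"
  show "\<not> prime_chain R (colon R M B A) E"
  proof
    assume "prime_chain R (colon R M B A) E"
    then obtain P where P: "\<forall>i\<le>E. primeideal (P i) R" "\<forall>i<E. P i \<subset> P (Suc i)" "colon R M B A \<subseteq> P 0"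
      unfolding prime_chain_def by blast
    then obtain C v where C: "C \<in> submods R M" "B \<subseteq> C" "v \<in> carrier M" "sub_sum M C (cyc R M v) \<subseteq> A"
       "primeideal (colon R M C {v}) R" "colon R M C {v} \<subseteq> P 0"
      using prime_below[OF A B, of "P 0"] by blast
    note c = cyc_submods[OF C(3)]
    let ?C = "sub_sum M C (cyc R M v)"
    have s: "?C \<in> submods R M" "C \<subseteq> ?C" using sub_sum_submods[OF C(1) c] sub_sum_ub1[OF C(1) c] by auto
    have "growth (HS B ?C) E" using C(2) s(2) by (intro growth_sub[OF A B(1) s(1) _ C(4) gr]) auto
    then have "growth (HS C ?C) E" by (rule growth_quotient[OF s(1) B(1) C(1,2) s(2)])
    then have "growth (hsR (colon R M C {v})) E" unfolding hs_cyc_fun[OF C(1,3)] .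
    then have "\<not> prime_chain R (colon R M C {v}) E" using prime_growth_iff[OF C(5)] by blast
    then show False using P C(6) unfolding prime_chain_def by blast
  qed
next
  assume "\<not> prime_chain R (colon R M B A) E"
  moreover have "\<not> prime_chain R (colon R M B A) E \<longrightarrow> growth (HS B A) E"
    using A B
  proof (induction rule: prime_filtration_induct)
    case refl
    then show ?case using growth_self[OF A] by simp
  next
    case (step B v)
    show ?case
    proof
      assume nch: "\<not> prime_chain R (colon R M B A) E"
      let ?C = "sub_sum M B (cyc R M v)"
      have "colon R M B A \<subseteq> colon R M B {v}" using step(3) by (auto simp: colon_def)
      then have "\<not> prime_chain R (colon R M B {v}) E" using prime_chain_mono nch by blast
      then have 1: "growth (HS B ?C) E" unfolding hs_cyc_fun[OF step(1,4)] using prime_growth_iff[OF step(6)] by blast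
      have "colon R M B A \<subseteq> colon R M ?C A" using step(8) by (auto simp: colon_def)
      then have "\<not> prime_chain R (colon R M ?C A) E" using prime_chain_mono nch by blast
      then show "growth (HS B A) E" using growth_extension[OF A step(1,7,8,9) 1] step(10) by blast
    qed
  qed
  ultimately show "growth (HS B A) E" by blast
qed

end

section \<open>Noetherian filtrations\<close>

lemma (in cring) finsum_in_ideal:
  assumes "ideal I R" "\<And>i. i \<le> n \<Longrightarrow> f i \<in> I" shows "finsum R f {..n::nat} \<in> I"
  using assms(2)
proof (induction n)
  case 0
  then show ?case using ideal.Icarr[OF assms(1)] by simp
next
  case (Suc n)
  then have "finsum R f {..Suc n} = f (Suc n) \<oplus> finsum R f {..n}"
    using ideal.Icarr[OF assms(1)] by (intro finsum_Suc) auto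
  then show ?case using Suc additive_subgroup.a_closed[OF ideal.axioms(1)[OF assms(1)]] by simp
qed

text \<open>A pair \<open>(u, n)\<close> is the homogeneous element \<open>u t\<^sup>n\<close> of the Rees algebra; the last clause replaces generation
  as an algebra by minimality among multiplicative families of ideals.\<close>

definition filtration_generators ::
  "('a, 'b) ring_scheme \<Rightarrow> (nat \<Rightarrow> 'a set) \<Rightarrow> ('a \<times> nat) set \<Rightarrow> bool" where
  "filtration_generators R I G \<longleftrightarrow> finite G \<and> (\<forall>u n. (u, n) \<in> G \<longrightarrow> u \<in> I n \<and> n > 0) \<and>
     (\<forall>P n. (\<forall>n. ideal (P n) R) \<longrightarrow> P 0 = carrier R \<longrightarrow>
       (\<forall>a b u v. u \<in> P a \<longrightarrow> v \<in> P b \<longrightarrow> u \<otimes>\<^bsub>R\<^esub> v \<in> P (a + b)) \<longrightarrow>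
       (\<forall>u n. (u, n) \<in> G \<longrightarrow> u \<in> P n) \<longrightarrow> I n \<subseteq> P n)"

lemma filtration_generatorsD:
  assumes "filtration_generators R I G"
  shows "finite G" "(u, n) \<in> G \<Longrightarrow> u \<in> I n \<and> n > 0"
    "(\<And>n. ideal (P n) R) \<Longrightarrow> P 0 = carrier R \<Longrightarrow>
       (\<And>a b u v. u \<in> P a \<Longrightarrow> v \<in> P b \<Longrightarrow> u \<otimes>\<^bsub>R\<^esub> v \<in> P (a + b)) \<Longrightarrow> (\<And>u n. (u, n) \<in> G \<Longrightarrow> u \<in> P n) \<Longrightarrow> I n \<subseteq> P n"
  using assms unfolding filtration_generators_def by simp_all

text \<open>The coefficients of positive degree of the algebra generators suffice: polynomials with
  \<open>n\<close>th coefficient in \<open>P n\<close> form a subring, and it contains the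
  generators once these coefficients lie in \<open>P\<close>. Constant terms are covered by
  \<open>P 0 = R\<close>.\<close>

lemma (in cring) filtration_generators_exist:
  assumes "noetherian_filtration R I" shows "\<exists>G. filtration_generators R I G"
proof -
  interpret U: UP_cring R "UP R" by (simp add: UP_cring_def is_cring)
  obtain S where S: "finite S" "S \<subseteq> rees_carrier R I"
      "rees_carrier R I = generate_ring (UP R) ((\<lambda>a. monom (UP R) a 0) ` carrier R \<union> S)"
    using assms unfolding noetherian_filtration_def by blast
  have I: "ideal (I n) R" for n using assms by (simp add: noetherian_filtration_def filtration_def)
  have SU: "p \<in> carrier (UP R)" "coeff (UP R) p n \<in> I n" if "p \<in> S" for p n
    using S(2) that by (auto simp: rees_carrier_def)
  define G where "G = (\<Union>p\<in>S. (\<lambda>n. (coeff (UP R) p n, n)) ` {1..deg R p})"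
  have "I n \<subseteq> P n" if P: "\<And>n. ideal (P n) R" "P 0 = carrier R"
    "\<And>a b u v. u \<in> P a \<Longrightarrow> v \<in> P b \<Longrightarrow> u \<otimes> v \<in> P (a + b)" "\<And>u n. (u, n) \<in> G \<Longrightarrow> u \<in> P n" for P n
  proof
    have zero: "\<zero> \<in> P n" for n using additive_subgroup.zero_closed[OF ideal.axioms(1)[OF P(1)]] .
    have gen: "p \<in> carrier (UP R) \<and> (\<forall>n. coeff (UP R) p n \<in> P n)"
      if "p \<in> generate_ring (UP R) ((\<lambda>a. monom (UP R) a 0) ` carrier R \<union> S)" for p
      using that
    proof induction
      case one
      then show ?case using zero P(2) by simp
    next
      case (incl p)
      then consider a where "a \<in> carrier R" "p = monom (UP R) a 0" | "p \<in> S" by blast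
      then show ?case
      proof cases
        case 1
        then show ?thesis using zero P(2) by simp
      next
        case 2
        have "coeff (UP R) p n \<in> P n" for n
        proof -
          consider "n = 0" | "1 \<le> n" "n \<le> deg R p" | "deg R p < n" by linarith
          then show ?thesis
          proof cases
            case 1
            then show ?thesis using SU(1)[OF 2] P(2) by simp
          next
            case b: 2
            then have "(coeff (UP R) p n, n) \<in> G" unfolding G_def using 2 by force
            then show ?thesis by (rule P(4))
          next
            case 3
            then show ?thesis using U.deg_aboveD[OF 3 SU(1)[OF 2]] zero by simp
          qed
        qed
        then show ?thesis using SU(1)[OF 2] by blast
      qed
    next
      case (a_inv p)
      then show ?case using additive_subgroup.a_inv_closed[OF ideal.axioms(1)[OF P(1)]] by auto
    next
      case (eng_add p q)
      then show ?case using additive_subgroup.a_closed[OF ideal.axioms(1)[OF P(1)]] by auto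
    next
      case (eng_mult p q)
      have "(\<Oplus>i\<in>{..n}. coeff (UP R) p i \<otimes> coeff (UP R) q (n - i)) \<in> P n" for n
      proof (rule finsum_in_ideal[OF P(1)])
        fix i assume "i \<le> n"
        then show "coeff (UP R) p i \<otimes> coeff (UP R) q (n - i) \<in> P n"
          using P(3)[of "coeff (UP R) p i" i "coeff (UP R) q (n - i)" "n - i"] eng_mult by simp
      qed
      then show ?case using eng_mult by simp
    qed
    fix u assume u: "u \<in> I n"
    then have uR: "u \<in> carrier R" using ideal.Icarr[OF I] by blast
    have "monom (UP R) u n \<in> rees_carrier R I"
      using u uR additive_subgroup.zero_closed[OF ideal.axioms(1)[OF I]] by (auto simp: rees_carrier_def)
    then show "u \<in> P n" using gen[of "monom (UP R) u n"] uR unfolding S(3) by (metis U.coeff_monom)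
  qed
  moreover have "finite G" using S(1) by (simp add: G_def)
  moreover have "u \<in> I n \<and> n > 0" if "(u, n) \<in> G" for u n using that SU(2) by (auto simp: G_def)
  ultimately have "filtration_generators R I G" unfolding filtration_generators_def by simp
  then show ?thesis by blast
qed

lemma filtrationD:
  assumes "filtration R I"
  shows "ideal (I n) R" "I 0 = carrier R" "I (Suc n) \<subseteq> I n" "ideal_prod R (I i) (I j) \<subseteq> I (i + j)"
  using assms by (auto simp: filtration_def)

lemma filtration_antimono: "filtration R I \<Longrightarrow> n \<le> n' \<Longrightarrow> I n' \<subseteq> I n"
  by (rule lift_Suc_antimono_le[of I]) (auto dest: filtrationD(3))

section \<open>Products of ideals and the algebra of several filtrations\<close>

context cring
begin

abbreviation "iprod F T \<equiv> finprod (ideals_set R) F T"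

lemma iprod_ideal: "(\<And>j. j \<in> T \<Longrightarrow> ideal (F j) R) \<Longrightarrow> ideal (iprod F T) R"
  using comm_monoid.finprod_closed[OF ideals_set_is_comm_monoid, of F T] by (auto simp: ideals_set_def)

lemma iprod_insert:
  "finite T \<Longrightarrow> j \<notin> T \<Longrightarrow> (\<And>i. ideal (F i) R) \<Longrightarrow> iprod F (insert j T) = ideal_prod R (F j) (iprod F T)"
  using comm_monoid.finprod_insert[OF ideals_set_is_comm_monoid, of T j F] by (auto simp: ideals_set_def)

lemma iprod_empty: "iprod F {} = carrier R"
  using comm_monoid.finprod_empty[OF ideals_set_is_comm_monoid, of F] by (simp add: ideals_set_def)

lemma iprod_mono:
  assumes "\<And>i. ideal (F i) R" "\<And>i. ideal (F' i) R" "\<And>i. F i \<subseteq> F' i" "finite T"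
  shows "iprod F T \<subseteq> iprod F' T"
  using assms(4)
proof (induction T rule: finite_induct)
  case (insert j T)
  then show ?case by (simp add: iprod_insert assms(1,2) ideal_prod_mono[OF assms(3)])
qed (simp add: iprod_empty)

lemma iprod_subset_factor:
  assumes "\<And>i. ideal (F i) R" "finite T" "j \<in> T" shows "iprod F T \<subseteq> F j"
proof -
  have "iprod F T = ideal_prod R (F j) (iprod F (T - {j}))"
    using iprod_insert[of "T - {j}" j F] assms by (simp add: insert_absorb)
  then show ?thesis using ideal_prod_inter[OF assms(1)[of j] iprod_ideal[where T = "T - {j}", OF assms(1)]] by auto
qed

text \<open>The operators are the generators of the single filtrations, each placed in its own
  direction; multiplicativity of the filtrations keeps them inside the family of products.\<close>

lemma rees_family_product:
  fixes I :: "'r::finite \<Rightarrow> nat \<Rightarrow> 'a set"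
  assumes "\<And>j. noetherian_filtration R (I j)"
  obtains S where "rees_family R S (\<lambda>n. iprod (\<lambda>j. I j (n j)) UNIV)"
proof -
  have fil: "filtration R (I j)" for j using assms by (simp add: noetherian_filtration_def)
  note I = filtrationD[OF fil]
  obtain G where "\<And>j. filtration_generators R (I j) (G j)" using filtration_generators_exist[OF assms] by metis
  note G = filtration_generatorsD[OF this]
  have G2: "u \<in> I j n \<and> n > 0" if "(u, n) \<in> G j" for u n j using G(2)[OF that] .
  define S where "S = (\<Union>j. (\<lambda>(u, n). (u, n, j)) ` G j)"
  have S: "(u, a, j) \<in> S \<longleftrightarrow> (u, a) \<in> G j" for u a j by (auto simp: S_def)
  let ?J = "\<lambda>n. iprod (\<lambda>j. I j (n j)) UNIV"
  have "rees_family R S ?J"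
  proof (rule rees_family.intro[OF is_cring], rule rees_family_axioms.intro)
    show "finite S" unfolding S_def using G(1) by auto
    show "x \<in> carrier R \<and> a > 0" if "(x, a, j) \<in> S" for x a j
      using G2[OF that[unfolded S]] ideal.Icarr[OF I(1)] by blast
    show "ideal (?J n) R" for n by (rule iprod_ideal[OF I(1)])
    show "?J (\<lambda>_. 0) = carrier R"
      using comm_monoid.finprod_one_eqI[OF ideals_set_is_comm_monoid, of UNIV "\<lambda>j. I j 0"] I(2)
      by (simp add: ideals_set_def)
    show "?J n' \<subseteq> ?J n" if "\<And>j. n j \<le> n' j" for n n'
      using that by (intro iprod_mono I(1) filtration_antimono[OF fil]) auto
  next
    fix x a j u n assume x: "(x, a, j) \<in> S" "u \<in> ?J n"
    define K where "K n = iprod (\<lambda>i. I i (n i)) (UNIV - {j})" for n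
    have J: "?J n = ideal_prod R (I j (n j)) (K n)" for n
      using iprod_insert[of "UNIV - {j}" j "\<lambda>i. I i (n i)"] I(1) by (simp add: K_def insert_absorb)
    have Kid: "ideal (K n) R" for n unfolding K_def by (rule iprod_ideal[OF I(1)])
    have "K (bump j a n) = K n"
      unfolding K_def using I(1)
      by (intro comm_monoid.finprod_cong'[OF ideals_set_is_comm_monoid]) (auto simp: ideals_set_def)
    then have "?J (bump j a n) = ideal_prod R (I j (n j + a)) (K n)" by (simp add: J)
    moreover have "x \<otimes> u \<in> ideal_prod R (I j a) (ideal_prod R (I j (n j)) (K n))"
      using x(2) G2[OF x(1)[unfolded S]] by (auto simp: J intro!: ideal_prod.prod)
    then have "x \<otimes> u \<in> ideal_prod R (ideal_prod R (I j a) (I j (n j))) (K n)"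
      using ideal_prod_assoc[OF I(1) I(1) Kid] by simp
    then have "x \<otimes> u \<in> ideal_prod R (I j (n j + a)) (K n)"
      using ideal_prod_mono[OF I(4)[of j a "n j"] subset_refl, of "K n"] by (auto simp: add.commute)
    ultimately show "x \<otimes> u \<in> ?J (bump j a n)" by simp
  next
    fix P and n :: "'r \<Rightarrow> nat"
    assume P: "\<And>n. ideal (P n) R" "P (\<lambda>_. 0) = carrier R"
      "\<And>x a j u n. (x, a, j) \<in> S \<Longrightarrow> u \<in> P n \<Longrightarrow> x \<otimes> u \<in> P (bump j a n)"
    have Pc: "\<And>n u. u \<in> P n \<Longrightarrow> u \<in> carrier R" using ideal.Icarr[OF P(1)] .
    have key: "u \<otimes> w \<in> P (bump j k n)" if "u \<in> I j k" "w \<in> P n" for j k u w n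
    proof -
      interpret M: module R "self_module R" by (rule module_self)
      \<comment> \<open>The elements that raise every \<open>P n\<close> by \<open>k\<close> in
        direction \<open>j\<close>. This family is multiplicative in \<open>k\<close> and contains
        the generators of \<open>I j\<close>, so it contains \<open>I j\<close>.\<close>
      define P' where "P' k = (\<Inter>n. colon R (self_module R) (P (bump j k n)) (P n))" for k
      have P'I: "u \<in> P' k \<longleftrightarrow> u \<in> carrier R \<and> (\<forall>n. \<forall>w\<in>P n. u \<otimes> w \<in> P (bump j k n))" for u k
        by (auto simp: P'_def colon_def)
      have "I j k \<subseteq> P' k"
      proof (rule G(3))
        show "ideal (P' k) R" for k
          unfolding P'_def using P(1) Pc
          by (intro i_Intersect) (auto intro!: M.colon_ideal simp: submods_self)
        show "P' 0 = carrier R" using ideal.I_l_closed[OF P(1)] by (auto simp: P'I)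
        show "u \<in> P' n" if "(u, n) \<in> G j" for u n
          using that P(3)[of u n j] G(2)[OF that] ideal.Icarr[OF I(1)] by (auto simp: P'I S)
        show "u \<otimes> v \<in> P' (a + b)" if uv: "u \<in> P' a" "v \<in> P' b" for a b u v
        proof -
          have c: "u \<in> carrier R" "v \<in> carrier R" using uv P'I by auto
          have "(u \<otimes> v) \<otimes> w \<in> P (bump j (a + b) n)" if w: "w \<in> P n" for n w
          proof -
            have "u \<otimes> (v \<otimes> w) \<in> P (bump j a (bump j b n))" using uv w P'I by blast
            then show ?thesis using c Pc[OF w] by (simp add: m_assoc)
          qed
          then show ?thesis using c by (simp add: P'I)
        qed
      qed
      then show ?thesis using that P'I by blast
    qed
    have "iprod (\<lambda>j. I j (n j)) T \<subseteq> P (\<lambda>j. if j \<in> T then n j else 0)" if "finite T" for T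
      using that
    proof (induction T rule: finite_induct)
      case empty
      then show ?case by (simp add: iprod_empty P(2))
    next
      case (insert j T)
      have "bump j (n j) (\<lambda>j. if j \<in> T then n j else 0) = (\<lambda>i. if i \<in> insert j T then n i else 0)"
        using insert.hyps by (auto simp: bump_def)
      then have "u \<otimes> w \<in> P (\<lambda>i. if i \<in> insert j T then n i else 0)"
        if "u \<in> I j (n j)" "w \<in> iprod (\<lambda>j. I j (n j)) T" for u w
        using key[OF that(1), of w "\<lambda>j. if j \<in> T then n j else 0"] insert.IH that(2) by auto
      then show ?case
        unfolding iprod_insert[OF insert.hyps I(1)]
        using additive_subgroup.a_closed[OF ideal.axioms(1)[OF P(1)]] by (intro ideal_prod_least) auto
    qed
    from this[of UNIV] show "?J n \<subseteq> P n" by simp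
  qed
  then show ?thesis by (rule that)
qed

end

section \<open>Filtrations by primary ideals and the maximal ideal\<close>

context noeth_local
begin

lemma mpow_self: "ideal J R \<Longrightarrow> ideal_mult R (self_module R) J (carrier R) = J"
proof (rule antisym)
  interpret S: module R "self_module R" by (rule module_self)
  assume J: "ideal J R"
  show "ideal_mult R (self_module R) J (carrier R) \<subseteq> J"
    by (rule S.ideal_mult_least) (auto simp: submods_self J intro: ideal.I_r_closed[OF J])
  show "J \<subseteq> ideal_mult R (self_module R) J (carrier R)"
  proof
    fix u assume u: "u \<in> J"
    then show "u \<in> ideal_mult R (self_module R) J (carrier R)"
      using S.ideal_mult_I[OF u one_closed] ideal.Icarr[OF J u] by simp
  qed
qed

lemma prime_nat_pow:
  assumes "primeideal p R" "x \<in> carrier R" "x [^] (k::nat) \<in> p" shows "x \<in> p"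
  using assms(3)
proof (induction k)
  case 0
  then show ?case using ideal.one_imp_carrier[OF primeideal.axioms(1)[OF assms(1)]] primeideal.I_notcarr[OF assms(1)] by auto
next
  case (Suc k)
  then show ?case using primeideal.I_prime[OF assms(1), of "x [^] k" x] assms(2) by auto
qed

text \<open>The primes in a prime filtration of \<open>R/I\<close> contain \<open>I\<close>, hence a
  power of every element of \<open>m\<close>, hence \<open>m\<close>. So \<open>m\<close>
  annihilates each factor, and each factor costs one power of \<open>m\<close>.\<close>

lemma pow_subset_of_radical:
  assumes I: "ideal I R" and rad: "m \<subseteq> radical R I"
  shows "\<exists>q. pw q \<subseteq> I"
proof -
  interpret S: noeth_local_module R "self_module R" m by (rule self_local_module)
  have Rs: "carrier R \<in> submods R (self_module R)" "I \<in> submods R (self_module R)" by (simp_all add: submods_self oneideal I)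
  have IR: "I \<subseteq> carrier R" using ideal.Icarr[OF I] by blast
  have mR: "m \<subseteq> carrier R" using ideal.Icarr[OF m_ideal] by blast
  have "I \<subseteq> I \<longrightarrow> (\<exists>q. S.mpow q (carrier R) \<subseteq> I)"
    using Rs IR
  proof (induction rule: S.prime_filtration_induct[where Q = "\<lambda>B. I \<subseteq> B \<longrightarrow> (\<exists>q. S.mpow q (carrier R) \<subseteq> B)"])
    case refl
    then show ?case using S.mpow_subset[OF Rs(1)] by blast
  next
    case (step B v)
    let ?p = "colon R (self_module R) B {v}" and ?C = "sub_sum (self_module R) B (cyc R (self_module R) v)"
    show ?case
    proof
      assume IB: "I \<subseteq> B"
      then obtain q where q: "S.mpow q (carrier R) \<subseteq> ?C" using step(8,10) by blast
      have B: "ideal B R" using step(1) by (simp add: submods_self)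
      have vR: "v \<in> carrier R" using step(4) by simp
      then have "B \<subseteq> ?p" using ideal.I_r_closed[OF B] ideal.Icarr[OF B] by (auto simp: colon_def)
      then have Ip: "I \<subseteq> ?p" using IB by blast
      have mp: "m \<subseteq> ?p"
      proof
        fix x assume x: "x \<in> m"
        then obtain k :: nat where "x \<in> carrier R" "x [^] k \<in> I" using rad by (auto simp: radical_def)
        then show "x \<in> ?p" using prime_nat_pow[OF step(6)] Ip by blast
      qed
      have "S.mpow (Suc q) (carrier R) = ideal_mult R (self_module R) m (S.mpow q (carrier R))" by (rule S.mpow_Suc[OF Rs(1)])
      also have "\<dots> \<subseteq> ideal_mult R (self_module R) m ?C"
        using q mR S.submods_subset[OF step(7)] by (intro S.ideal_mult_mono) auto
      also have "\<dots> \<subseteq> sub_sum (self_module R) (ideal_mult R (self_module R) m B) (ideal_mult R (self_module R) m (cyc R (self_module R) v))"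
        by (rule S.ideal_mult_sub_sum[OF mR step(1) S.cyc_submods[OF step(4)]])
      also have "\<dots> \<subseteq> B"
        using S.colon_cyc[OF step(1,4)] mp
        by (intro S.sub_sum_least[OF step(1) S.ideal_mult_subset[OF step(1) mR] S.ideal_mult_least[OF step(1)]]) blast
      finally show "\<exists>q. S.mpow q (carrier R) \<subseteq> B" by blast
    qed
  qed
  then show ?thesis using mpow_self[OF pw_ideal] by auto
qed

lemma max_ideal_eq: "max_ideal R = m"
  unfolding max_ideal_def by (rule the_equality, rule m_max, rule m_unique)

text \<open>The ideal \<open>I 1\<close> contains some \<open>m^q\<close>, and \<open>I N\<close>
  contains the \<open>N\<close>th power of \<open>I 1\<close>.\<close>

lemma primary_filtration_lower:
  assumes "filtration_by_primary R I" shows "\<exists>q. \<forall>N. pw (q * N) \<subseteq> I N"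
proof -
  have fil: "filtration R I" using assms by (simp add: filtration_by_primary_def)
  have "primary_to R m (I 1)" using assms unfolding filtration_by_primary_def max_ideal_eq by (metis order_refl)
  then have rad: "radical R (I 1) = m" by (simp add: primary_to_def)
  note I = filtrationD[OF fil]
  obtain q where q: "pw q \<subseteq> I 1" using pow_subset_of_radical[OF I(1)[of 1]] rad by blast
  have "pw (q * N) \<subseteq> I N" for N
  proof (induction N)
    case 0
    then show ?case by (simp add: I(2))
  next
    case (Suc N)
    have "pw (q * Suc N) = ideal_prod R (pw q) (pw (q * N))" by (simp add: ideal_pow_add[OF m_ideal])
    also have "\<dots> \<subseteq> ideal_prod R (I 1) (I N)" by (rule ideal_prod_mono[OF q Suc])
    also have "\<dots> \<subseteq> I (Suc N)" using I(4)[of 1 N] by simp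
    finally show ?case .
  qed
  then show ?thesis by blast
qed

text \<open>The generators lie in \<open>m\<close> and have degree below \<open>a\<close>, so
  elements of degree \<open>n\<close> are sums of products with at least \<open>n/a\<close>
  generators as factors, and therefore lie in \<open>m\<close> to the power \<open>n/a\<close>
  rounded up.\<close>

lemma primary_filtration_upper:
  assumes "filtration_by_primary R I" "noetherian_filtration R I" shows "\<exists>a>0. \<forall>N. I (a * N) \<subseteq> pw N"
proof -
  obtain G where "filtration_generators R I G" using filtration_generators_exist[OF assms(2)] by blast
  note G = filtration_generatorsD[OF this]
  have Im: "I n \<subseteq> m" if "n \<ge> 1" for n
  proof
    fix u assume u: "u \<in> I n"
    have id: "ideal (I n) R" using assms(1) by (simp add: filtration_by_primary_def filtration_def)
    then have "u [^] (1::nat) \<in> I n" using u ideal.Icarr[OF id u] by simp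
    then have "u \<in> radical R (I n)" unfolding radical_def using ideal.Icarr[OF id u] by blast
    then show "u \<in> m" using assms(1) that by (auto simp: filtration_by_primary_def primary_to_def max_ideal_eq)
  qed
  define a where "a = Suc (Max (insert 0 (snd ` G)))"
  have a: "n < a" if "(u, n) \<in> G" for u n
  proof -
    have "n \<in> insert 0 (snd ` G)" using that by force
    then have "n \<le> Max (insert 0 (snd ` G))" using G(1) by (intro Max_ge) auto
    then show ?thesis by (simp add: a_def)
  qed
  \<comment> \<open>This is \<open>n/a\<close> rounded up. It is subadditive, so the ideals
    \<open>pw (c n)\<close> form a multiplicative family to which minimality applies.\<close>
  define c where "c n = (n + (a - 1)) div a" for n
  have a0: "a > 0" by (simp add: a_def)
  have c_le: "c n \<le> k \<longleftrightarrow> n \<le> a * k" for n k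
  proof -
    have "c n \<le> k \<longleftrightarrow> n + (a - 1) < a * Suc k"
      unfolding c_def using a0 by (metis less_Suc_eq_le less_mult_imp_div_less mult.commute div_less_iff_less_mult)
    then show ?thesis using a0 by simp arith
  qed
  have "I n \<subseteq> pw (c n)" for n
  proof (rule G(3))
    show "ideal (pw (c n)) R" for n by (rule pw_ideal)
    show "pw (c 0) = carrier R" using c_le[of 0 0] by simp
    show "u \<in> pw (c n)" if "(u, n) \<in> G" for u n
    proof -
      have "c n \<le> 1" using a[OF that] c_le[of n 1] by simp
      moreover have "u \<in> pw (Suc 0)" using G(2)[OF that] Im[of n] ideal_pow_1[OF m_ideal] by auto
      ultimately show ?thesis using ideal_pow_antimono[OF m_ideal, of "c n" "Suc 0"] by auto
    qed
    show "u \<otimes> v \<in> pw (c (b + d))" if "u \<in> pw (c b)" "v \<in> pw (c d)" for b d u v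
    proof -
      have "u \<otimes> v \<in> pw (c b + c d)" using ideal_prod.prod[OF that, of R] ideal_pow_add[OF m_ideal] by simp
      moreover have "c (b + d) \<le> c b + c d"
        using c_le[of b "c b"] c_le[of d "c d"] by (simp add: c_le distrib_left)
      ultimately show ?thesis using ideal_pow_antimono[OF m_ideal] by blast
    qed
  qed
  moreover have "c (a * N) = N" for N
  proof (rule antisym)
    show "c (a * N) \<le> N" by (simp add: c_le)
    show "N \<le> c (a * N)" using c_le[of "a * N" "c (a * N)"] a0 by simp
  qed
  ultimately show ?thesis using a0 by metis
qed

lemma iprod_lower:
  assumes "\<And>j. pw (q j * n j) \<subseteq> F j" "\<And>j. ideal (F j) R" "finite T"
  shows "pw (\<Sum>j\<in>T. q j * n j) \<subseteq> iprod F T"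
  using assms(3)
proof (induction T rule: finite_induct)
  case (insert j T)
  then have "pw (\<Sum>j\<in>insert j T. q j * n j) = ideal_prod R (pw (q j * n j)) (pw (\<Sum>j\<in>T. q j * n j))"
    by (simp add: ideal_pow_add[OF m_ideal])
  then show ?case unfolding iprod_insert[OF insert.hyps assms(2)] using ideal_prod_mono[OF assms(1) insert.IH] by simp
qed (simp add: iprod_empty)

end

section \<open>Lengths of quotient modules\<close>

context module
begin

lemma quotient_module_hom:
  assumes N: "N \<in> submods R M"
  shows "module_hom R M (quotient_module M N) (\<lambda>x. N +>\<^bsub>M\<^esub> x)"
    and "carrier (quotient_module M N) = (\<lambda>x. N +>\<^bsub>M\<^esub> x) ` carrier M"
    and "\<And>x y. x \<in> carrier M \<Longrightarrow> y \<in> carrier M \<Longrightarrow> N +>\<^bsub>M\<^esub> x = N +>\<^bsub>M\<^esub> y \<longleftrightarrow> x \<ominus>\<^bsub>M\<^esub> y \<in> N"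
proof -
  let ?Q = "quotient_module M N"
  have sub: "additive_subgroup N M"
    using N by (simp add: submods_def additive_subgroup_def submodule_def)
  then interpret A: abelian_subgroup N M by (rule abelian_subgroupI3) (rule M.abelian_group_axioms)
  show carr: "carrier ?Q = (\<lambda>x. N +>\<^bsub>M\<^esub> x) ` carrier M"
    by (auto simp: quotient_module_def A_RCOSETS_def')
  show eq: "N +>\<^bsub>M\<^esub> x = N +>\<^bsub>M\<^esub> y \<longleftrightarrow> x \<ominus>\<^bsub>M\<^esub> y \<in> N" if "x \<in> carrier M" "y \<in> carrier M" for x y
    using A.a_rcos_module[of y x] A.a_repr_independence'[of x y] A.a_rcos_self[of x] that
    by (auto simp: M.minus_eq)
  have add: "(N +>\<^bsub>M\<^esub> x) \<oplus>\<^bsub>?Q\<^esub> (N +>\<^bsub>M\<^esub> y) = N +>\<^bsub>M\<^esub> (x \<oplus>\<^bsub>M\<^esub> y)" if "x \<in> carrier M" "y \<in> carrier M" for x y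
    using A.a_rcos_sum[OF that] by (simp add: quotient_module_def)
  have smult: "a \<odot>\<^bsub>?Q\<^esub> (N +>\<^bsub>M\<^esub> x) = N +>\<^bsub>M\<^esub> (a \<odot>\<^bsub>M\<^esub> x)" if a: "a \<in> carrier R" and x: "x \<in> carrier M" for a x
  proof -
    have const: "N +>\<^bsub>M\<^esub> (a \<odot>\<^bsub>M\<^esub> y) = N +>\<^bsub>M\<^esub> (a \<odot>\<^bsub>M\<^esub> x)" if y: "y \<in> N +>\<^bsub>M\<^esub> x" for y
    proof -
      have yM: "y \<in> carrier M" using y A.a_elemrcos_carrier[OF x] by blast
      have "N +>\<^bsub>M\<^esub> y = N +>\<^bsub>M\<^esub> x" using A.a_repr_independence'[OF y x] by simp
      then have "y \<ominus>\<^bsub>M\<^esub> x \<in> N" using eq[OF yM x] by simp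
      then have "a \<odot>\<^bsub>M\<^esub> y \<ominus>\<^bsub>M\<^esub> a \<odot>\<^bsub>M\<^esub> x \<in> N"
        using submodsD(4)[OF N a] smult_diff[OF a yM x] by metis
      then show ?thesis using eq a x yM by simp
    qed
    have "(\<Union>y\<in>N +>\<^bsub>M\<^esub> x. N +>\<^bsub>M\<^esub> (a \<odot>\<^bsub>M\<^esub> y)) = N +>\<^bsub>M\<^esub> (a \<odot>\<^bsub>M\<^esub> x)"
      by (rule SUP_eq_const) (use A.a_rcos_self[OF x] const in blast)+
    then show ?thesis by (simp add: quotient_module_def)
  qed
  have zero: "\<zero>\<^bsub>?Q\<^esub> = N +>\<^bsub>M\<^esub> \<zero>\<^bsub>M\<^esub>"
    using A.a_subset M.a_coset_add_zero by (simp add: quotient_module_def)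
  have "module R ?Q"
  proof (rule moduleI)
    show "abelian_group ?Q"
    proof (rule abelian_groupI)
      show "\<exists>y\<in>carrier ?Q. y \<oplus>\<^bsub>?Q\<^esub> x = \<zero>\<^bsub>?Q\<^esub>" if x: "x \<in> carrier ?Q" for x
      proof -
        obtain u where u: "u \<in> carrier M" "x = N +>\<^bsub>M\<^esub> u" using x carr by auto
        then have "(N +>\<^bsub>M\<^esub> (\<ominus>\<^bsub>M\<^esub> u)) \<oplus>\<^bsub>?Q\<^esub> x = \<zero>\<^bsub>?Q\<^esub>" by (simp add: add zero M.l_neg)
        then show ?thesis using u carr by blast
      qed
    qed (auto simp: carr add zero M.a_ac)
  qed (auto simp: carr add smult smult_l_distr smult_r_distr smult_assoc1 R.is_cring)
  then show "module_hom R M ?Q (\<lambda>x. N +>\<^bsub>M\<^esub> x)"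
    by (intro module_hom.intro module_hom_axioms.intro module_axioms) (auto simp: carr add smult)
qed

lemma module_length_quotient:
  assumes N: "N \<in> submods R M"
  shows "module_length R (quotient_module M N) = Len N (carrier M)"
proof -
  let ?Q = "quotient_module M N" and ?\<pi> = "\<lambda>x. N +>\<^bsub>M\<^esub> x"
  interpret Q: module_hom R M ?Q ?\<pi> by (rule quotient_module_hom[OF N])
  note carr = quotient_module_hom(2)[OF N] and eq = quotient_module_hom(3)[OF N]
  \<comment> \<open>The chains in \<open>module_length\<close> are not confined to an interval; the
    empty set and \<open>UNIV\<close> serve as bounds that impose nothing.\<close>
  have "module_length R ?Q = len (submods R ?Q) {} UNIV"
    by (simp add: module_length_def len_def chain_in_def submods_def)
  also have "\<dots> = Len N (carrier M)"
  proof (rule antisym)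
    show "len (submods R ?Q) {} UNIV \<le> Len N (carrier M)"
    proof (rule len_strict_map[where \<phi> = "\<lambda>X. {x \<in> carrier M. ?\<pi> x \<in> X}"])
      fix X assume X: "X \<in> submods R ?Q"
      have "?\<pi> x \<in> X" if "x \<in> N" for x
      proof -
        have xM: "x \<in> carrier M" using submodsD(1)[OF N that] .
        have "?\<pi> x = ?\<pi> \<zero>\<^bsub>M\<^esub>" using eq[OF xM M.zero_closed] submodsD(6)[OF N that submodsD(2)[OF N]] by simp
        then show ?thesis using Q.M.submodsD(2)[OF X] Q.f_zero by simp
      qed
      then show "{x \<in> carrier M. ?\<pi> x \<in> X} \<in> submods R M \<and> N \<subseteq> {x \<in> carrier M. ?\<pi> x \<in> X} \<and> {x \<in> carrier M. ?\<pi> x \<in> X} \<subseteq> carrier M"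
        using Q.preimage_submods[OF carrier_submods X] submods_subset[OF N] by auto
    next
      fix X Y assume "X \<in> submods R ?Q" "Y \<in> submods R ?Q" "X \<subset> Y"
      then obtain y where y: "y \<in> Y" "y \<notin> X" by blast
      then have "y \<in> carrier ?Q" using Q.M.submodsD(1)[OF \<open>Y \<in> submods R ?Q\<close>] by blast
      then obtain x where x: "x \<in> carrier M" "?\<pi> x = y" unfolding carr by blast
      then have "x \<in> {x \<in> carrier M. ?\<pi> x \<in> Y}" "x \<notin> {x \<in> carrier M. ?\<pi> x \<in> X}" using y by auto
      moreover have "{x \<in> carrier M. ?\<pi> x \<in> X} \<subseteq> {x \<in> carrier M. ?\<pi> x \<in> Y}" using \<open>X \<subset> Y\<close> by blast
      ultimately show "{x \<in> carrier M. ?\<pi> x \<in> X} \<subset> {x \<in> carrier M. ?\<pi> x \<in> Y}" by blast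
    qed
    show "Len N (carrier M) \<le> len (submods R ?Q) {} UNIV"
    proof (rule len_strict_map[where \<phi> = "\<lambda>X. ?\<pi> ` X"])
      fix X Y assume XY: "X \<in> submods R M" "Y \<in> submods R M" "N \<subseteq> X" "X \<subset> Y"
      then obtain y where y: "y \<in> Y" "y \<notin> X" by blast
      have yM: "y \<in> carrier M" using submodsD(1)[OF XY(2) y(1)] .
      have "?\<pi> y \<notin> ?\<pi> ` X"
      proof
        assume "?\<pi> y \<in> ?\<pi> ` X"
        then obtain x where x: "x \<in> X" "?\<pi> y = ?\<pi> x" by blast
        then have "y \<ominus>\<^bsub>M\<^esub> x \<in> X" using eq[OF yM submodsD(1)[OF XY(1) x(1)]] XY(3) by blast
        then show False using submods_diff_cancel[OF XY(1) yM x(1)] y(2) by blast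
      qed
      then show "?\<pi> ` X \<subset> ?\<pi> ` Y" using XY(4) y(1) by blast
    qed (use Q.image_submods in auto)
  qed
  finally show ?thesis .
qed

end

section \<open>Lengths along products of filtrations\<close>

lemma (in noetherian_ring) noeth_local_max_ideal:
  assumes "local_ring R" shows "noeth_local R (max_ideal R)"
proof -
  have ex: "cring R" "\<exists>!m. maximalideal m R" using assms by (auto simp: local_ring_def)
  have "maximalideal (max_ideal R) R" unfolding max_ideal_def by (rule theI'[OF ex(2)])
  then show ?thesis
    using ex by (intro noeth_local.intro noeth_local_axioms.intro noetherian_ring_axioms) auto
qed

lemma Sup_ereal_less_nat:
  "Sup {ereal (real n) |n. n < E} = (if E = 0 then -\<infinity> else ereal (real (E - 1)))"
proof (cases E)
  case 0
  then show ?thesis by (simp add: bot_ereal_def)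
next
  case (Suc e)
  have "Sup {ereal (real n) |n. n < Suc e} = ereal (real e)"
    by (rule antisym) (auto intro!: Sup_least Sup_upper)
  then show ?thesis using Suc by simp
qed

context noeth_local_module
begin

text \<open>If \<open>E\<close> is the smallest growth exponent, chains of primes above the
  annihilator have fewer than \<open>E\<close> steps. For \<open>E = 0\<close> there is no prime at
  all, the annihilator is \<open>R\<close>, and the supremum is over the empty set.\<close>

lemma module_dim_eq:
  assumes "\<And>E'. growth (HS {\<zero>\<^bsub>M\<^esub>} (carrier M)) E' \<longleftrightarrow> E \<le> E'"
  shows "module_dim R M = (if E = 0 then -\<infinity> else ereal (real (E - 1)))"
proof -
  have ann: "annihilator R M = colon R M {\<zero>\<^bsub>M\<^esub>} (carrier M)" by (auto simp: annihilator_def colon_def)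
  have "prime_chain R (annihilator R M) n \<longleftrightarrow> n < E" for n
    using hs_growth_iff[OF carrier_submods zero_submods, of n] assms[of n] unfolding ann by auto
  then show ?thesis
    unfolding module_dim_def using krull_dim_quotient[of "annihilator R M"] colon_ideal[OF zero_submods, of "carrier M"]
    by (simp add: ann Sup_ereal_less_nat)
qed

lemma sub_sum_zero: "A \<in> submods R M \<Longrightarrow> sub_sum M A {\<zero>\<^bsub>M\<^esub>} = A"
  using submodsD(1) by (force simp: sub_sum_def)

text \<open>On the diagonal the products and the powers of \<open>m\<close> are comparable up to
  dilation: \<open>m^(s k) M\<close> lies in \<open>N\<close> at \<open>(k, ..., k)\<close>, and
  \<open>N\<close> at \<open>(a k, ..., a k)\<close> lies in \<open>m^k M\<close>. The two length
  functions thus have the same growth exponents.\<close>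

lemma product_filtration_length:
  fixes I :: "'r::finite \<Rightarrow> nat \<Rightarrow> 'a set"
  assumes prim: "\<And>j. filtration_by_primary R (I j)" and noeth: "\<And>j. noetherian_filtration R (I j)"
  defines "N \<equiv> \<lambda>n. ideal_mult R M (iprod (\<lambda>j. I j (n j)) UNIV) (carrier M)"
  obtains \<sigma> K \<alpha> c E where "quasi_poly (\<lambda>n. Lenr (N n) (carrier M)) \<sigma> K \<alpha> c"
    "\<And>E'. growth (\<lambda>k. Lenr (N (\<lambda>_. k)) (carrier M)) E' \<longleftrightarrow> E \<le> E'"
    "\<And>E'. growth (HS {\<zero>\<^bsub>M\<^esub>} (carrier M)) E' \<longleftrightarrow> E \<le> E'"
    "\<And>n. N n \<in> submods R M" "\<And>n. Len (N n) (carrier M) \<noteq> \<infinity>"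
proof -
  let ?J = "\<lambda>n. iprod (\<lambda>j. I j (n j)) UNIV"
  have fil: "filtration R (I j)" for j using noeth by (simp add: noetherian_filtration_def)
  note I = filtrationD(1)[OF fil]
  obtain S where "rees_family R S ?J" by (rule rees_family_product[OF noeth])
  then interpret rees_family R S ?J .
  interpret rees_family_module R M S ?J ..
  have Ns: "N n \<in> submods R M" for n unfolding N_def by (rule JA_submods[OF carrier_submods])
  have "\<forall>j. \<exists>q. \<forall>k. pw (q * k) \<subseteq> I j k" using primary_filtration_lower[OF prim] by blast
  from choice[OF this] obtain q where q: "\<And>j k. pw (q j * k) \<subseteq> I j k" by blast
  have lower: "pw (\<Sum>j\<in>UNIV. q j * n j) \<subseteq> ?J n" for n by (rule iprod_lower[OF q I]) simp
  have NC: "mpow (\<Sum>j\<in>UNIV. q j * n j) (carrier M) \<subseteq> N n" for n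
    unfolding N_def by (rule ideal_mult_mono[OF lower subset_refl J_carrier subset_refl])
  have fin: "Len (N n) (carrier M) \<noteq> \<infinity>" for n
    by (rule len_finite[OF carrier_submods Ns submods_subset[OF Ns] NC])
  have antimono: "N m \<subseteq> N n" if "\<And>j. n j \<le> m j" for n m
    unfolding N_def by (rule ideal_mult_mono[OF J_antimono[OF that] subset_refl J_carrier subset_refl])
  have eq0: "sub_sum M (N n) {\<zero>\<^bsub>M\<^esub>} = N n" for n by (rule sub_sum_zero[OF Ns])
  have "\<exists>\<alpha>>0. \<exists>D. qp D \<alpha> (\<lambda>n. Lenr (N n) (carrier M))"
    using hilbert_qp[OF accM carrier_submods zero_submods] fin eq0 by (simp add: N_def)
  then obtain \<alpha> D where qp: "\<alpha> > 0" "qp D \<alpha> (\<lambda>n. Lenr (N n) (carrier M))" by blast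
  obtain \<sigma> K c where Q: "quasi_poly (\<lambda>n. Lenr (N n) (carrier M)) \<sigma> K \<alpha> c"
    by (rule qp_imp_quasi_poly[OF qp(2,1) len_rat_mono[OF antimono fin] len_rat_nonneg])
  have HS: "HS {\<zero>\<^bsub>M\<^esub>} (carrier M) k = Lenr (mpow k (carrier M)) (carrier M)" for k
    by (simp add: hs_def sub_sum_zero[OF mpow_submods[OF carrier_submods]])
  \<comment> \<open>The successor makes the dilation factor positive even if all \<open>q j\<close>
    are zero.\<close>
  define s where "s = Suc (\<Sum>j\<in>UNIV. q j)"
  \<comment> \<open>A product lies in each of its factors, so an upper bound for one filtration is
    enough; \<open>undefined\<close> stands for an arbitrary index.\<close>
  obtain a where a: "a > 0" "\<And>k. I undefined (a * k) \<subseteq> pw k"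
    using primary_filtration_upper[OF prim[of undefined] noeth[of undefined]] by blast
  have iff: "growth (\<lambda>k. Lenr (N (\<lambda>_. k)) (carrier M)) E' \<longleftrightarrow> growth (HS {\<zero>\<^bsub>M\<^esub>} (carrier M)) E'" for E'
  proof
    assume "growth (HS {\<zero>\<^bsub>M\<^esub>} (carrier M)) E'"
    then show "growth (\<lambda>k. Lenr (N (\<lambda>_. k)) (carrier M)) E'"
    proof (rule growth_shift[of _ _ 0 _ s 0])
      fix k :: nat
      have "(\<Sum>j\<in>UNIV. q j * k) \<le> s * k" by (simp add: s_def sum_distrib_right[symmetric])
      then have "mpow (s * k) (carrier M) \<subseteq> N (\<lambda>_. k)"
        using mpow_antimono[OF carrier_submods] NC[of "\<lambda>_. k"] by blast
      then show "Lenr (N (\<lambda>_. k)) (carrier M) \<le> HS {\<zero>\<^bsub>M\<^esub>} (carrier M) (s * k + 0)"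
        unfolding HS add_0_right
        by (rule len_rat_mono[OF _ len_finite[OF carrier_submods mpow_submods[OF carrier_submods] mpow_subset[OF carrier_submods] subset_refl]])
    qed (auto simp: s_def hs_nonneg)
  next
    assume "growth (\<lambda>k. Lenr (N (\<lambda>_. k)) (carrier M)) E'"
    then show "growth (HS {\<zero>\<^bsub>M\<^esub>} (carrier M)) E'"
    proof (rule growth_shift[of _ _ 0 _ a 0])
      fix k :: nat
      have "?J (\<lambda>_. a * k) \<subseteq> I undefined (a * k)" by (rule iprod_subset_factor[OF I]) auto
      then have "?J (\<lambda>_. a * k) \<subseteq> pw k" using a(2) by blast
      then have "N (\<lambda>_. a * k) \<subseteq> mpow k (carrier M)"
        unfolding N_def by (rule ideal_mult_mono[OF _ subset_refl pw_carrier subset_refl])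
      then show "HS {\<zero>\<^bsub>M\<^esub>} (carrier M) k \<le> Lenr (N (\<lambda>_. a * k + 0)) (carrier M)"
        unfolding HS add_0_right by (rule len_rat_mono[OF _ fin])
    qed (auto simp: a len_rat_nonneg)
  qed
  define E where "E = (LEAST E. growth (HS {\<zero>\<^bsub>M\<^esub>} (carrier M)) E)"
  have "\<exists>E. growth (HS {\<zero>\<^bsub>M\<^esub>} (carrier M)) E"
    by (rule hs_growth_ex[OF carrier_submods zero_submods]) auto
  then have "growth (HS {\<zero>\<^bsub>M\<^esub>} (carrier M)) E" unfolding E_def by (rule LeastI_ex)
  then have E: "growth (HS {\<zero>\<^bsub>M\<^esub>} (carrier M)) E' \<longleftrightarrow> E \<le> E'" for E'
    using growth_mono Least_le[of "growth (HS {\<zero>\<^bsub>M\<^esub>} (carrier M))" E'] unfolding E_def by blast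
  show ?thesis
    by (rule that[OF Q _ E Ns fin]) (simp add: iff E)
qed

end

text \<open>Let \<open>E\<close> be the smallest growth exponent, so that
  \<open>dim M = E - 1\<close>. Coefficients of degree at least \<open>E\<close> vanish and those of
  degree \<open>E - 1\<close> are constant; if \<open>E > 0\<close>, one of the latter is nonzero,
  since otherwise the growth would be smaller.\<close>

theorem proposition3p5:
  fixes R :: "('a, 'c) ring_scheme"
    and M :: "('a, 'b, 'd) module_scheme"
    and I :: "'r::finite \<Rightarrow> nat \<Rightarrow> 'a set"
  assumes "noetherian_local_ring R"
    and "finitely_generated_module R M"
    and "\<And>j. filtration_by_primary R (I j)"
    and "\<And>j. noetherian_filtration R (I j)"
  shows "\<exists>c>0. \<exists>\<sigma> :: ('r \<Rightarrow> nat) \<Rightarrow> ('r \<Rightarrow> nat) \<Rightarrow> rat.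
           quasi_polynomial \<sigma> \<and>
           total_degree \<sigma> = module_dim R M \<and>
           (\<forall>n. (\<forall>j. n j \<ge> c) \<longrightarrow>
              (\<exists>l. module_length R
                     (quotient_module M
                        (ideal_smult R (finprod (ideals_set R) (\<lambda>j. I j (n j)) UNIV) M)) = enat l \<and>
                   rat_of_nat l =
                     (\<Sum>i | ereal (real (multi_degree i)) \<le> module_dim R M.
                        \<sigma> i n * monomial_value i n))) \<and>
           (\<forall>i. ereal (real (multi_degree i)) = module_dim R M \<longrightarrow> (\<exists>a. \<forall>n. \<sigma> i n = a))"
proof -
  have R: "noetherian_ring R" "local_ring R" using assms(1) by (auto simp: noetherian_local_ring_def)
  interpret noeth_local R "max_ideal R" by (rule noetherian_ring.noeth_local_max_ideal[OF R])
  interpret module R M using assms(2) by (simp add: finitely_generated_module_def)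
  obtain X where "finite X" "X \<subseteq> carrier M" "submodule_span R M X = carrier M"
    using assms(2) by (auto simp: finitely_generated_module_def)
  then interpret noeth_local_module R M "max_ideal R"
    by unfold_locales (rule acc_submods[OF acc_ideals])
  define N where "N n = ideal_mult R M (iprod (\<lambda>j. I j (n j)) UNIV) (carrier M)" for n
  define f where "f n = Lenr (N n) (carrier M)" for n
  obtain \<sigma> K \<alpha> c E where Q: "quasi_poly f \<sigma> K \<alpha> c"
    and gf: "\<And>E'. growth (\<lambda>k. f (\<lambda>_. k)) E' \<longleftrightarrow> E \<le> E'"
    and gh: "\<And>E'. growth (HS {\<zero>\<^bsub>M\<^esub>} (carrier M)) E' \<longleftrightarrow> E \<le> E'"
    and Ns: "\<And>n. N n \<in> submods R M" and fin: "\<And>n. Len (N n) (carrier M) \<noteq> \<infinity>"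
    unfolding f_def[abs_def] N_def by (rule product_filtration_length[where I = I, OF assms(3,4)]) blast
  interpret Q: quasi_poly f \<sigma> K \<alpha> c by (rule Q)
  have dim: "module_dim R M = (if E = 0 then -\<infinity> else ereal (real (E - 1)))" by (rule module_dim_eq[OF gh])
  have le: "ereal (real k) \<le> module_dim R M \<longleftrightarrow> k < E" for k by (auto simp: dim)
  have van: "\<sigma> i n = 0" if "E \<le> multi_degree i" for i n by (rule Q.coeff_vanish[OF _ that]) (simp add: gf)
  have "quasi_polynomial \<sigma>"
    unfolding quasi_polynomial_def
  proof (intro conjI allI)
    fix i
    have "\<sigma> i (n(j := n j + \<alpha>)) = \<sigma> i n" for n j
    proof -
      have "(\<lambda>l. (n(j := n j + \<alpha>)) l mod \<alpha>) = (\<lambda>l. n l mod \<alpha>)" by auto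
      then show ?thesis using Q.per[of i n] Q.per[of i "n(j := n j + \<alpha>)"] by metis
    qed
    then show "periodic (\<sigma> i)" unfolding periodic_def using Q.\<alpha> by blast
    show "finite {i. \<exists>n. \<sigma> i n \<noteq> 0}" by (rule finite_subset[of _ "box K"]) (use Q.supp in auto)
  qed
  moreover have "total_degree \<sigma> = module_dim R M"
  proof (rule antisym)
    show "total_degree \<sigma> \<le> module_dim R M"
      unfolding total_degree_def using van by (intro Sup_least) (force simp: le)
    show "module_dim R M \<le> total_degree \<sigma>"
    proof (cases E)
      case 0
      then show ?thesis by (simp add: dim)
    next
      case (Suc e)
      have "\<not> growth (\<lambda>k. f (\<lambda>_. k)) e" by (simp add: gf Suc)
      then obtain i n where i: "e \<le> multi_degree i" "\<sigma> i n \<noteq> 0" using Q.growth_of_degree by blast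
      then have "multi_degree i = e" using van[of i n] Suc by linarith
      then show ?thesis unfolding total_degree_def using i(2) by (intro Sup_upper) (auto simp: dim Suc)
    qed
  qed
  moreover have "\<exists>l. module_length R (quotient_module M
        (ideal_smult R (finprod (ideals_set R) (\<lambda>j. I j (n j)) UNIV) M)) = enat l \<and>
      rat_of_nat l = (\<Sum>i | ereal (real (multi_degree i)) \<le> module_dim R M. \<sigma> i n * monomial_value i n)"
    if n: "\<forall>j. max c 1 \<le> n j" for n
  proof -
    have smult: "ideal_smult R (finprod (ideals_set R) (\<lambda>j. I j (n j)) UNIV) M = N n"
      by (simp add: ideal_smult_def ideal_mult_def N_def)
    obtain l where l: "Len (N n) (carrier M) = enat l" using fin[of n] by auto
    have "{i :: 'r \<Rightarrow> nat. multi_degree i < E} \<subseteq> box E"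
    proof
      fix i :: "'r \<Rightarrow> nat" assume "i \<in> {i. multi_degree i < E}"
      moreover have "i j \<le> multi_degree i" for j unfolding multi_degree_def by (rule member_le_sum) auto
      ultimately show "i \<in> box E" unfolding box_def by (auto intro: le_less_trans)
    qed
    then have fin': "finite {i :: 'r \<Rightarrow> nat. multi_degree i < E}" by (rule finite_subset) simp
    have "rat_of_nat l = f n" by (simp add: f_def len_rat_def l)
    also have "\<dots> = (\<Sum>i\<in>box K. \<sigma> i n * monomial_value i n)" using n by (intro Q.eq) simp
    \<comment> \<open>The two index sets are compared through their union: coefficients vanish
      outside \<open>box K\<close>, and also in degrees at least \<open>E\<close>.\<close>
    also have "\<dots> = (\<Sum>i\<in>box K \<union> {i. multi_degree i < E}. \<sigma> i n * monomial_value i n)"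
      using fin' Q.supp by (intro sum.mono_neutral_left) auto
    also have "\<dots> = (\<Sum>i | multi_degree i < E. \<sigma> i n * monomial_value i n)"
      using fin' van by (intro sum.mono_neutral_right) auto
    finally show ?thesis unfolding smult module_length_quotient[OF Ns] by (intro exI[of _ l]) (simp add: l le)
  qed
  moreover have "\<exists>a. \<forall>n. \<sigma> i n = a" if "ereal (real (multi_degree i)) = module_dim R M" for i
  proof -
    have E: "E = Suc (multi_degree i)" using that by (auto simp: dim split: if_splits)
    then show ?thesis using Q.coeff_constant[of "multi_degree i" i] gf by blast
  qed
  ultimately show ?thesis by (intro exI[of _ "max c 1"] conjI exI[of _ \<sigma>]) auto
qed

end
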